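(* There exists a non-empty family $\mathcal{F}$ of quasiregular mappings $\mathbb{R}^3\to\mathbb{R}^3$ of transcendental type such that for all $f\in\mathcal{F}$: $f(x)=0$ if and only if $x=0$; the Julia set $J(f)$ contains half-rays; and the quasi-Fatou set $QF(f)$ is connected. Moreover, there exists a non-empty family $\mathcal{G}$ of quasimeromorphic mappings $\mathbb{R}^3\to\hat{\mathbb{R}}^3$ of transcendental type such that for all $g\in\mathcal{G}$: $\mathcal{O}^{-}_{g}(\infty)=\{0,\infty\}$; and there exist half-rays on which the iterates of $g$ neither stay bounded nor tend to infinity (that is, for every point $x$ of these half-rays, the sequence $(g^n(x))_{n\ge 0}$ is neither bounded nor tends to infinity).
   Context: $\hat{\mathbb{R}}^d=\mathbb{R}^d\cup\{\infty\}$. Let $d\ge 2$ and let $G\subset\mathbb{R}^d$ be a domain. A continuous map $f:G\to\mathbb{R}^d$ in $W^{1}_{d,\mathrm{loc}}(G)$ is quasiregular if there is $K\ge 1$ such that $\left(\sup_{|h|=1}|Df(x)(h)|\right)^d\le K J_f(x)$ for almost every $x\in G$, where $J_f$ is the Jacobian determinant. A continuous map $f:G\to\hat{\mathbb{R}}^d$ is quasimeromorphic if every $x\in G$ has a neighbourhood $U_x$ such that either $f$ or $M\circ f$ is quasiregular from $U_x$ into $\mathbb{R}^d$, where $M:\hat{\mathbb{R}}^d\to\hat{\mathbb{R}}^d$ is a sense-preserving M\"obius map with $M(\infty)\in\mathbb{R}^d$. A quasiregular or quasimeromorphic map on $\mathbb{R}^d$ is of transcendental type if it has an essential singularity at infinity,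 i.e. it has no limit in $\hat{\mathbb{R}}^d$ as $x\to\infty$. The backward orbit is $\mathcal{O}^{-}_{g}(\infty)=\bigcup_{n\ge 0}g^{-n}(\infty)$, with $g^{-0}(\infty)=\{\infty\}$ and $g^{-(n+1)}(\infty)=\{x\in\mathbb{R}^d:g(x)\in g^{-n}(\infty)\}$. For a quasiregular map $f:\mathbb{R}^d\to\mathbb{R}^d$, the Julia set is $$J(f)=\{x\in\mathbb{R}^d:\operatorname{cap}(\mathbb{R}^d\setminus\mathcal{O}^{+}_{f}(U_x))=0\text{ for all neighbourhoods }U_x\subset\mathbb{R}^d\text{ of }x\},$$ where $\mathcal{O}^{+}_f(U)=\bigcup_{k\ge 0}f^k(U)$, and the quasi-Fatou set is $QF(f)=\mathbb{R}^d\setminus J(f)$. Here $\operatorname{cap}$ is the conformal capacity: a compact set $C\subset\mathbb{R}^d$ has $\operatorname{cap}(C)=0$ if for some (equivalently every) bounded open $A\supset C$ the infimum of $\int_A|\nabla u|^d\,dx$ over non-negative $u\in C_0^\infty(A)$ with $u\ge 1$ on $C$ is $0$; a closed set has capacity zero if all its compact subsets do. A half-ray is a set of the form $\{p+tv:t>0\}$ with $p,v\in\mathbb{R}^3$, $v\ne 0$. *)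

theory Defs
  imports "HOL-Analysis.Analysis"
begin

section \<open>Test functions\<close>

definition partial_deriv :: "'n \<Rightarrow> (real^'n::finite \<Rightarrow> real) \<Rightarrow> real^'n \<Rightarrow> real" where
  "partial_deriv i u x = frechet_derivative u (at x) (axis i 1)"

definition gradient :: "(real^'n::finite \<Rightarrow> real) \<Rightarrow> real^'n \<Rightarrow> real^'n" where
  "gradient u x = (\<chi> i. partial_deriv i u x)"

primrec Ck :: "nat \<Rightarrow> (real^'n::finite \<Rightarrow> real) \<Rightarrow> bool" where
  "Ck 0 u \<longleftrightarrow> continuous_on UNIV u"
| "Ck (Suc k) u \<longleftrightarrow> (\<forall>x. u differentiable (at x)) \<and> (\<forall>i. Ck k (partial_deriv i u))"

text \<open>
  The space of smooth functions with compact support in the open set \<open>A\<close>; each of them is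
  extended by \<open>0\<close> to the whole space.
\<close>
definition test_functions :: "(real^'n::finite) set \<Rightarrow> (real^'n \<Rightarrow> real) set" where
  "test_functions A =
     {u. (\<forall>k. Ck k u) \<and> compact (closure {x. u x \<noteq> 0}) \<and> closure {x. u x \<noteq> 0} \<subseteq> A}"

section \<open>Quasiregular maps\<close>

definition Lp_loc ::
    "nat \<Rightarrow> (real^'n::finite) set \<Rightarrow> (real^'n \<Rightarrow> 'b::euclidean_space) \<Rightarrow> bool" where
  "Lp_loc p G u \<longleftrightarrow>
     u \<in> borel_measurable (lebesgue_on G) \<and>
     (\<forall>K. compact K \<and> K \<subseteq> G \<longrightarrow> set_integrable lebesgue K (\<lambda>x. norm (u x) ^ p))"

text \<open>\<open>Df x $ i $ j\<close> is the weak \<open>j\<close>-th partial derivative of the \<open>i\<close>-th component of \<open>f\<close>.\<close>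
definition weak_derivative_on ::
    "(real^'n::finite) set \<Rightarrow> (real^'n \<Rightarrow> real^'m::finite) \<Rightarrow> (real^'n \<Rightarrow> real^'n^'m) \<Rightarrow> bool" where
  "weak_derivative_on G f Df \<longleftrightarrow>
     (\<forall>i j. \<forall>\<phi>\<in>test_functions G.
        (LINT x:G|lebesgue. f x $ i * partial_deriv j \<phi> x) =
        - (LINT x:G|lebesgue. Df x $ i $ j * \<phi> x))"

text \<open>
  \<open>f\<close> lies in the local Sobolev space with exponent \<open>p\<close> on \<open>G\<close> and \<open>Df\<close> is its weak derivative,
  which is determined up to a null set.
\<close>
definition W1_loc_deriv ::
    "nat \<Rightarrow> (real^'n::finite) set \<Rightarrow> (real^'n \<Rightarrow> real^'m::finite) \<Rightarrow> (real^'n \<Rightarrow> real^'n^'m) \<Rightarrow> bool"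
  where
  "W1_loc_deriv p G f Df \<longleftrightarrow> Lp_loc p G f \<and> Lp_loc p G Df \<and> weak_derivative_on G f Df"

definition quasiregular_on :: "(real^'n::finite) set \<Rightarrow> (real^'n \<Rightarrow> real^'n) \<Rightarrow> bool" where
  "quasiregular_on G f \<longleftrightarrow>
     open G \<and> connected G \<and> G \<noteq> {} \<and> continuous_on G f \<and>
     (\<exists>Df. W1_loc_deriv CARD('n) G f Df \<and>
        (\<exists>K\<ge>1. AE x in lebesgue_on G.
           (SUP h\<in>sphere 0 1. norm (Df x *v h)) ^ CARD('n) \<le> K * det (Df x)))"

section \<open>The one-point compactification and Moebius maps\<close>

text \<open>
  The extended space is the type \<^typ>\<open>(real^'n) option\<close>, with \<^const>\<open>None\<close> as the point at
  infinity and the topology of the one-point compactification.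
\<close>
abbreviation extended_space :: "(real^'n::finite) option topology" where
  "extended_space \<equiv> Alexandroff_compactification euclidean"

fun sphere_reflection ::
    "real^'n::finite \<Rightarrow> real \<Rightarrow> (real^'n) option \<Rightarrow> (real^'n) option" where
  "sphere_reflection a r None = Some a"
| "sphere_reflection a r (Some x) =
     (if x = a then None else Some (a + (r / norm (x - a))\<^sup>2 *\<^sub>R (x - a)))"

text \<open>Reflection in the hyperplane \<open>{x. v \<bullet> x = t}\<close>, where \<open>v \<noteq> 0\<close>.\<close>
fun plane_reflection ::
    "real^'n::finite \<Rightarrow> real \<Rightarrow> (real^'n) option \<Rightarrow> (real^'n) option" where
  "plane_reflection v t None = None"
| "plane_reflection v t (Some x) = Some (x - (2 * (v \<bullet> x - t) / (v \<bullet> v)) *\<^sub>R v)"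

inductive moebius :: "((real^'n::finite) option \<Rightarrow> (real^'n) option) \<Rightarrow> bool" where
  id: "moebius id"
| sphere: "moebius M \<Longrightarrow> r > 0 \<Longrightarrow> moebius (sphere_reflection a r \<circ> M)"
| plane: "moebius M \<Longrightarrow> v \<noteq> 0 \<Longrightarrow> moebius (plane_reflection v t \<circ> M)"

text \<open>
  A Moebius map is smooth away from infinity and from its pole, so the Jacobian below is that of a
  differentiable map. The value of \<^const>\<open>the\<close> at the pole plays no role.
\<close>
definition sense_preserving_moebius ::
    "((real^'n::finite) option \<Rightarrow> (real^'n) option) \<Rightarrow> bool" where
  "sense_preserving_moebius M \<longleftrightarrow> moebius M \<and>
     (\<forall>x. M (Some x) \<noteq> None \<longrightarrow> det (jacobian (\<lambda>z. the (M (Some z))) (at x)) > 0)"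

section \<open>Quasimeromorphic maps\<close>

text \<open>A map into the extended space is quasiregular into the finite space.\<close>
definition finite_quasiregular_on ::
    "(real^'n::finite) set \<Rightarrow> (real^'n \<Rightarrow> (real^'n) option) \<Rightarrow> bool" where
  "finite_quasiregular_on U f \<longleftrightarrow> (\<forall>x\<in>U. f x \<noteq> None) \<and> quasiregular_on U (\<lambda>x. the (f x))"

definition quasimeromorphic_on ::
    "(real^'n::finite) set \<Rightarrow> (real^'n \<Rightarrow> (real^'n) option) \<Rightarrow> bool" where
  "quasimeromorphic_on G f \<longleftrightarrow>
     open G \<and> connected G \<and> G \<noteq> {} \<and>
     continuous_map (top_of_set G) extended_space f \<and>
     (\<forall>x\<in>G. \<exists>U. open U \<and> x \<in> U \<and> U \<subseteq> G \<and>
        (finite_quasiregular_on U f \<or>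
         (\<exists>M. sense_preserving_moebius M \<and> M None \<noteq> None \<and> finite_quasiregular_on U (M \<circ> f))))"

text \<open>
  No limit in the extended space at infinity. For a map \<open>f\<close> into the finite space this is applied
  to \<open>Some \<circ> f\<close>.
\<close>
definition transcendental_type :: "(real^'n::finite \<Rightarrow> (real^'n) option) \<Rightarrow> bool" where
  "transcendental_type f \<longleftrightarrow> (\<nexists>l. limitin extended_space f l at_infinity)"

primrec preimage_of_infinity ::
    "(real^'n::finite \<Rightarrow> (real^'n) option) \<Rightarrow> nat \<Rightarrow> (real^'n) option set" where
  "preimage_of_infinity g 0 = {None}"
| "preimage_of_infinity g (Suc n) = Some ` {x. g x \<in> preimage_of_infinity g n}"

definition backward_orbit_of_infinity ::
    "(real^'n::finite \<Rightarrow> (real^'n) option) \<Rightarrow> (real^'n) option set" where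
  "backward_orbit_of_infinity g = (\<Union>n. preimage_of_infinity g n)"

text \<open>\<open>y\<close> is the sequence of iterates \<open>g\<^sup>n (y 0)\<close>, all of which are finite.\<close>
definition finite_orbit :: "(real^'n::finite \<Rightarrow> (real^'n) option) \<Rightarrow> (nat \<Rightarrow> real^'n) \<Rightarrow> bool" where
  "finite_orbit g y \<longleftrightarrow> (\<forall>n. g (y n) = Some (y (Suc n)))"

section \<open>Conformal capacity and the Julia set\<close>

definition conformal_capacity :: "(real^'n::finite) set \<Rightarrow> (real^'n) set \<Rightarrow> ennreal" where
  "conformal_capacity A C =
     (INF u\<in>{u \<in> test_functions A. (\<forall>x. 0 \<le> u x) \<and> (\<forall>x\<in>C. 1 \<le> u x)}.
        \<integral>\<^sup>+x\<in>A. ennreal (norm (gradient u x) ^ CARD('n)) \<partial>lebesgue)"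

definition compact_capacity_zero :: "(real^'n::finite) set \<Rightarrow> bool" where
  "compact_capacity_zero C \<longleftrightarrow>
     (\<exists>A. open A \<and> bounded A \<and> C \<subseteq> A \<and> conformal_capacity A C = 0)"

text \<open>
  Used for closed sets: in the Julia set below the complement is closed whenever \<open>f\<close> is a
  nonconstant quasiregular map, since such maps are open.
\<close>
definition capacity_zero :: "(real^'n::finite) set \<Rightarrow> bool" where
  "capacity_zero E \<longleftrightarrow> (\<forall>C. compact C \<and> C \<subseteq> E \<longrightarrow> compact_capacity_zero C)"

definition forward_orbit :: "('a \<Rightarrow> 'a) \<Rightarrow> 'a set \<Rightarrow> 'a set" where
  "forward_orbit f U = (\<Union>k. (f ^^ k) ` U)"

definition julia_set :: "(real^'n::finite \<Rightarrow> real^'n) \<Rightarrow> (real^'n) set" where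
  "julia_set f = {x. \<forall>U. open U \<and> x \<in> U \<longrightarrow> capacity_zero (UNIV - forward_orbit f U)}"

definition quasi_fatou_set :: "(real^'n::finite \<Rightarrow> real^'n) \<Rightarrow> (real^'n) set" where
  "quasi_fatou_set f = UNIV - julia_set f"

text \<open>
  A half-ray contains infinitely many others (move \<open>p\<close> along it), so the existence of one half-ray
  in a set is the same as the existence of several.
\<close>
definition half_ray :: "(real^'n::finite) set \<Rightarrow> bool" where
  "half_ray R \<longleftrightarrow> (\<exists>p v. v \<noteq> 0 \<and> R = {p + t *\<^sub>R v | t. t > 0})"

end

theory Submission
  imports Defs
begin

text \<open>
  The starting point is the Zorich type map \<open>exp t * (tri a, - min (cotri a) (tri s), - cotri s)\<close>
  (with a signed minimum), where \<open>tri\<close> and \<open>cotri\<close> are triangle waves replacing sine and cosine; it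
  omits \<open>0\<close>. To create exactly one zero, a face common to two of its beams is slit open above a
  certain height and one further copy of the whole space, slit along the image of that face, is
  glued in. The resulting map is explicit, piecewise smooth, and its Jacobian is \<open>exp (3 * t)\<close>
  almost everywhere, so it is quasiregular; it is also locally Lipschitz and co-Lipschitz at scale
  \<open>exp t\<close>.

  After multiplication by a small constant a large half space \<open>t < \<tau>\<close> is mapped into a ball inside
  itself, and the map expands on the complement. Hence the orbit of a neighbourhood of a point that
  never enters the half space covers everything except \<open>0\<close>, which has capacity zero, and the
  quasi-Fatou set is the basin of the half space. The basin is connected because every component
  of a preimage contains the unique zero. The symmetry axis far up never enters the half space.
  Composing with an orientation preserving inversion gives a map with a unique pole and no zero,
  which interchanges the two ends of the axis.
\<close>

text \<open>A beam is mapped onto a closed half-space minus the origin, so the Zorich map comes near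
  \<open>0\<close> only as the height tends to minus infinity. The slit face has as image the wedge
  \<open>2 * Y $ 3 + 1 + 2 * \<bar>Y $ 1\<bar> \<le> 0\<close> in the plane
  \<open>Y $ 2 = 0\<close>. It misses the origin, which is therefore an interior point of the glued
  copy and is hit there exactly once. The obstacle is that openness, lifting of segments and
  covering must all be quantitative, since small balls are followed through unboundedly many
  iterates. Triangle waves make every piece invertible in closed form; comparing these inverses at
  nearby points gives the co-Lipschitz estimate that does this work. The estimate also dictates the
  constants: balls must grow until they exceed the size of a few beams, whereupon they cover a whole
  shell, and \<open>\<tau>\<close> is taken large enough for that. Capacity is needed at two
  extremes only: the set omitted by an orbit lies in \<open>{0}\<close>, or it contains a
  ball.\<close>

section \<open>Weak derivatives of locally Lipschitz maps\<close>

text \<open>All translates of \<open>S\<close> along \<open>e\<close> have the same measure.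
  Averaging it over \<open>r\<close> in the unit interval and exchanging the integrals leaves an
  inner integral over a countable set. This disposes of the interfaces between the pieces of the map
  without parametrizing them.\<close>

lemma negligible_countable_fibres:
  fixes S :: "'a::euclidean_space set"
  assumes S: "S \<in> sets borel"
    and fib: "\<And>x. countable {r. x + r *\<^sub>R e \<in> S}"
  shows "negligible S"
proof -
  have [measurable]: "S \<in> sets borel" by (rule S)
  have shift: "(\<integral>\<^sup>+x. indicator S (x + r *\<^sub>R e) \<partial>lborel) = emeasure lborel S" for r
  proof -
    have "emeasure lborel S = (\<integral>\<^sup>+x. indicator S x \<partial>distr lborel borel ((+) (r *\<^sub>R e)))"
      by (subst lborel_distr_plus) (simp add: S)
    also have "\<dots> = (\<integral>\<^sup>+x. indicator S (r *\<^sub>R e + x) \<partial>lborel)"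
      by (rule nn_integral_distr) auto
    finally show ?thesis by (simp add: add.commute)
  qed
  have "emeasure lborel S = (\<integral>\<^sup>+r. indicator {0..1} r * emeasure lborel S \<partial>(lborel :: real measure))"
    by (subst nn_integral_multc) auto
  also have "\<dots> = (\<integral>\<^sup>+r. (\<integral>\<^sup>+x. indicator {0..1::real} r * indicator S (x + r *\<^sub>R e) \<partial>lborel) \<partial>lborel)"
    by (simp add: nn_integral_cmult shift)
  also have "\<dots> = (\<integral>\<^sup>+x. (\<integral>\<^sup>+r. indicator {0..1::real} r * indicator S (x + r *\<^sub>R e) \<partial>lborel) \<partial>lborel)"
    by (rule lborel_pair.Fubini') measurable
  also have "\<dots> = (\<integral>\<^sup>+x. 0 \<partial>(lborel :: 'a measure))"
  proof (rule nn_integral_cong)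
    fix x :: 'a
    have "{r. x + r *\<^sub>R e \<in> S} \<in> null_sets lborel"
      using fib countable_imp_null_set_lborel by blast
    then have "AE r in lborel. r \<notin> {r. x + r *\<^sub>R e \<in> S}"
      by (rule AE_not_in)
    then have "(\<integral>\<^sup>+r. indicator {0..1::real} r * indicator S (x + r *\<^sub>R e) \<partial>lborel) = (\<integral>\<^sup>+r. 0 \<partial>(lborel::real measure))"
      by (intro nn_integral_cong_AE) (auto elim!: eventually_mono)
    then show "(\<integral>\<^sup>+r. indicator {0..1::real} r * indicator S (x + r *\<^sub>R e) \<partial>lborel) = 0"
      by simp
  qed
  finally have "S \<in> null_sets lborel" using S by (auto intro!: null_setsI)
  then show ?thesis
    by (simp add: negligible_iff_null_sets null_sets_completionI)
qed

text \<open>Translation invariance makes every difference quotient of \<open>v\<close> integrate to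
  zero; the Lipschitz bound and the bounded support dominate the passage to the limit. Applied to a
  component times a test function this is integration by parts.\<close>

lemma integral_directional_derivative_eq_0:
  fixes v :: "'a::euclidean_space \<Rightarrow> real"
  assumes v: "integrable lborel v" and supp: "\<And>x. norm x > B \<Longrightarrow> v x = 0"
    and \<delta>: "\<delta> > 0" and lip: "\<And>x r. 0 < r \<Longrightarrow> r \<le> \<delta> \<Longrightarrow> \<bar>v (x + r *\<^sub>R e) - v x\<bar> \<le> L * r"
    and v': "v' \<in> borel_measurable lebesgue"
    and der: "AE x in lebesgue. ((\<lambda>r. (v (x + r *\<^sub>R e) - v x) / r) \<longlongrightarrow> v' x) (at_right 0)"
  shows "integrable lebesgue v'" "(LINT x|lebesgue. v' x) = 0"
proof -
  have [measurable]: "v \<in> borel_measurable borel" using v by auto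
  define \<rho> where "\<rho> n = \<delta> / real (Suc n)" for n
  have \<rho>: "\<rho> n > 0" "\<rho> n \<le> \<delta>" for n
    using \<delta> by (auto simp: \<rho>_def field_simps)
  have lim: "filterlim \<rho> (at_right 0) sequentially"
  proof (rule tendsto_imp_filterlim_at_right)
    have "(\<lambda>n. \<delta> * (1 / real (Suc n))) \<longlonglongrightarrow> \<delta> * 0"
      by (intro tendsto_mult tendsto_const lim_1_over_n[THEN LIMSEQ_Suc])
    then show "\<rho> \<longlonglongrightarrow> 0" by (simp add: \<rho>_def[abs_def])
    show "\<forall>\<^sub>F x in sequentially. 0 < \<rho> x" using \<rho> by simp
  qed
  define s where "s n x = (v (x + \<rho> n *\<^sub>R e) - v x) / \<rho> n" for n x
  have sm [measurable]: "s n \<in> borel_measurable borel" for n unfolding s_def by measurable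
  have tr: "integrable lborel (\<lambda>x. v (x + h))" "(LINT x|lborel. v (x + h)) = (LINT x|lborel. v x)" for h
  proof -
    have "integrable (distr lborel borel ((+) h)) v" by (subst lborel_distr_plus) (rule v)
    then show "integrable lborel (\<lambda>x. v (x + h))"
      by (subst (asm) integrable_distr_eq) (auto simp: add.commute)
    have "(LINT x|lborel. v x) = (LINT x|distr lborel borel ((+) h). v x)"
      by (subst lborel_distr_plus) simp
    also have "\<dots> = (LINT x|lborel. v (h + x))" by (rule integral_distr) auto
    finally show "(LINT x|lborel. v (x + h)) = (LINT x|lborel. v x)" by (simp add: add.commute)
  qed
  have s0: "(LINT x|lebesgue. s n x) = 0" for n
  proof -
    have "(LINT x|lebesgue. s n x) = (LINT x|lborel. s n x)"
      by (rule integral_completion) auto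
    also have "\<dots> = 0" unfolding s_def by (simp add: tr v)
    finally show ?thesis .
  qed
  \<comment> \<open>The shifts have length at most \<open>\<delta> * norm e\<close>, so this
    enlarged ball contains the supports of all the quotients.\<close>
  define w where "w x = L * indicat_real (cball (0::'a) (B + \<delta> * norm e)) x" for x
  have wi: "integrable lebesgue w"
    unfolding w_def by (intro integrable_mult_right integrable_real_indicator)
      (use emeasure_bounded_finite[OF bounded_cball] in auto)
  have lims: "AE x in lebesgue. (\<lambda>n. s n x) \<longlonglongrightarrow> v' x"
    using der by eventually_elim (unfold s_def, erule filterlim_compose[OF _ lim])
  have L0: "L \<ge> 0"
  proof -
    have "0 \<le> L * \<delta>" using lip[of \<delta> 0] \<delta> by linarith
    then show ?thesis using \<delta> by (simp add: zero_le_mult_iff)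
  qed
  have bd: "norm (s n x) \<le> w x" for n x
  proof (cases "norm x \<le> B + \<delta> * norm e")
    case True
    have "\<bar>v (x + \<rho> n *\<^sub>R e) - v x\<bar> \<le> L * \<rho> n" by (rule lip) (use \<rho> in auto)
    then show ?thesis using True \<rho>[of n] by (simp add: s_def w_def field_simps)
  next
    case False
    have "norm (\<rho> n *\<^sub>R e) \<le> \<delta> * norm e" using \<rho>[of n] by (simp add: mult_right_mono)
    then have "norm (x + \<rho> n *\<^sub>R e) > B" using False norm_diff_ineq[of x "\<rho> n *\<^sub>R e"] by simp
    moreover have "norm x > B" using False \<delta> by (smt (verit) mult_nonneg_nonneg norm_ge_zero)
    ultimately show ?thesis using False by (simp add: s_def w_def supp)
  qed
  have sml: "s n \<in> borel_measurable lebesgue" for n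
    by (rule measurable_completion) simp
  show "integrable lebesgue v'"
    by (rule integrable_dominated_convergence[OF v' sml wi lims]) (use bd in auto)
  have "(\<lambda>n. LINT x|lebesgue. s n x) \<longlonglongrightarrow> (LINT x|lebesgue. v' x)"
    by (rule integral_dominated_convergence[OF v' sml wi lims]) (use bd in auto)
  then show "(LINT x|lebesgue. v' x) = 0"
    using s0 by (simp add: LIMSEQ_const_iff)
qed

lemma has_derivative_imp_directional:
  fixes f :: "'a::real_normed_vector \<Rightarrow> 'b::real_normed_vector"
  assumes "(f has_derivative D) (at x)"
  shows "((\<lambda>r. (f (x + r *\<^sub>R h) - f x) /\<^sub>R r) \<longlongrightarrow> D h) (at 0)"
proof -
  have lin: "linear D" using assms has_derivative_linear by blast
  have "((\<lambda>r. f (x + r *\<^sub>R h)) has_derivative (\<lambda>r. D (r *\<^sub>R h))) (at 0)"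
    by (rule has_derivative_compose[where f = "\<lambda>r. x + r *\<^sub>R h", unfolded o_def])
       (auto intro!: derivative_eq_intros assms)
  then have "((\<lambda>r. f (x + r *\<^sub>R h)) has_vector_derivative D h) (at 0)"
    by (simp add: has_vector_derivative_def linear_scale[OF lin])
  then have "((\<lambda>y. (f (x + y *\<^sub>R h) - f x - y *\<^sub>R D h) /\<^sub>R norm y) \<longlongrightarrow> 0) (at 0)"
    by (simp add: has_vector_derivative_def has_derivative_at_within)
  from tendsto_norm_zero[OF this]
  have "((\<lambda>y. norm (f (x + y *\<^sub>R h) - f x - y *\<^sub>R D h) / norm y) \<longlongrightarrow> 0) (at 0)"
    by (simp add: divide_inverse_commute)
  then have "((\<lambda>y. norm ((f (x + y *\<^sub>R h) - f x) /\<^sub>R y - D h)) \<longlongrightarrow> 0) (at 0)"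
  proof (rule Lim_transform_eventually)
    show "\<forall>\<^sub>F y in at 0. norm (f (x + y *\<^sub>R h) - f x - y *\<^sub>R D h) / norm y
        = norm ((f (x + y *\<^sub>R h) - f x) /\<^sub>R y - D h)"
    proof (rule eventually_at_filter[THEN iffD2], rule always_eventually, intro allI impI)
      fix y :: real assume "y \<noteq> 0"
      then have "(f (x + y *\<^sub>R h) - f x) /\<^sub>R y - D h = (f (x + y *\<^sub>R h) - f x - y *\<^sub>R D h) /\<^sub>R y"
        by (simp add: scaleR_diff_right)
      then show "norm (f (x + y *\<^sub>R h) - f x - y *\<^sub>R D h) / norm y
        = norm ((f (x + y *\<^sub>R h) - f x) /\<^sub>R y - D h)"
        by (simp add: divide_inverse_commute)
    qed
  qed
  then show ?thesis
    by (rule LIM_zero_cancel[OF tendsto_norm_zero_cancel])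
qed

lemma eventually_line_in_open:
  fixes x :: "'a::real_normed_vector"
  assumes "open G" "x \<in> G"
  shows "\<forall>\<^sub>F r in at 0. x + r *\<^sub>R h \<in> G"
proof -
  have "((\<lambda>r. x + r *\<^sub>R h) \<longlongrightarrow> x + 0 *\<^sub>R h) (at 0)" by (intro tendsto_intros)
  then show ?thesis using topological_tendstoD[of "\<lambda>r. x + r *\<^sub>R h" x "at 0" G] assms by simp
qed

lemma has_derivative_bound_lipschitz:
  fixes f :: "'a::real_normed_vector \<Rightarrow> 'b::real_normed_vector"
  assumes der: "(f has_derivative D) (at x)" and U: "open U" "x \<in> U" and lip: "L-lipschitz_on U f"
  shows "norm (D h) \<le> L * norm h"
proof -
  have "((\<lambda>r. norm ((f (x + r *\<^sub>R h) - f x) /\<^sub>R r)) \<longlongrightarrow> norm (D h)) (at 0)"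
    by (intro tendsto_norm has_derivative_imp_directional der)
  moreover have "\<forall>\<^sub>F r in at 0. norm ((f (x + r *\<^sub>R h) - f x) /\<^sub>R r) \<le> L * norm h"
  proof -
    have "\<forall>\<^sub>F r in at 0. x + r *\<^sub>R h \<in> U" using U by (rule eventually_line_in_open)
    then show ?thesis
      using eventually_neq_at_within[of 0 0 UNIV]
    proof eventually_elim
      case (elim r)
      have "dist (f (x + r *\<^sub>R h)) (f x) \<le> L * dist (x + r *\<^sub>R h) x"
        using lip elim(1) U(2) by (rule lipschitz_onD)
      then have "norm (f (x + r *\<^sub>R h) - f x) / \<bar>r\<bar> \<le> L * norm h"
        using elim(2) by (simp add: dist_norm field_simps)
      then show ?case by (simp add: divide_inverse_commute)
    qed
  qed
  ultimately show ?thesis by (rule tendsto_upperbound) simp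
qed

lemma continuous_on_locally_lipschitz:
  fixes f :: "'a::{heine_borel,real_normed_vector} \<Rightarrow> 'b::metric_space"
  assumes G: "open G" and lip: "\<And>K. compact K \<Longrightarrow> K \<subseteq> G \<Longrightarrow> \<exists>L. L-lipschitz_on K f"
  shows "continuous_on G f"
  unfolding continuous_on_eq_continuous_at[OF G]
proof
  fix x assume "x \<in> G"
  then obtain e where e: "e > 0" "cball x e \<subseteq> G" using G open_contains_cball by blast
  obtain L where "L-lipschitz_on (cball x e) f" using lip[OF compact_cball e(2)] by blast
  then have "continuous_on (ball x e) f"
    using lipschitz_on_continuous_on continuous_on_subset ball_subset_cball by blast
  then show "isCont f x" using e(1) by (simp add: continuous_on_eq_continuous_at)
qed

lemma norm_matrix_le_entries:
  fixes A :: "real^'n::finite^'m::finite"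
  assumes "\<And>i j. \<bar>A $ i $ j\<bar> \<le> B"
  shows "norm A \<le> real CARD('m) * (real CARD('n) * B)"
proof -
  have "norm A \<le> (\<Sum>i\<in>UNIV. norm (A $ i))" unfolding norm_vec_def by (rule L2_set_le_sum) simp
  also have "\<dots> \<le> (\<Sum>i\<in>(UNIV::'m set). \<Sum>j\<in>(UNIV::'n set). \<bar>A $ i $ j\<bar>)"
    by (intro sum_mono norm_le_l1_cart)
  also have "\<dots> \<le> (\<Sum>i\<in>(UNIV::'m set). \<Sum>j\<in>(UNIV::'n set). B)"
    by (intro sum_mono assms)
  finally show ?thesis by simp
qed

lemma test_functionsD:
  assumes "\<phi> \<in> test_functions A"
  shows "\<phi> differentiable (at x)" "continuous_on UNIV \<phi>" "continuous_on UNIV (partial_deriv j \<phi>)"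
    "compact (closure {x. \<phi> x \<noteq> 0})" "closure {x. \<phi> x \<noteq> 0} \<subseteq> A"
    "x \<notin> closure {x. \<phi> x \<noteq> 0} \<Longrightarrow> \<phi> x = 0"
    "x \<notin> closure {x. \<phi> x \<noteq> 0} \<Longrightarrow> partial_deriv j \<phi> x = 0"
proof -
  have "Ck (Suc 0) \<phi>" using assms by (auto simp: test_functions_def)
  then show d: "\<phi> differentiable (at x)" "continuous_on UNIV (partial_deriv j \<phi>)" for x by auto
  have "Ck 0 \<phi>" using assms by (auto simp: test_functions_def)
  then show "continuous_on UNIV \<phi>" by simp
  show "compact (closure {x. \<phi> x \<noteq> 0})" "closure {x. \<phi> x \<noteq> 0} \<subseteq> A"
    using assms by (auto simp: test_functions_def)
  show "\<phi> x = 0" if "x \<notin> closure {x. \<phi> x \<noteq> 0}"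
    using that closure_subset[of "{x. \<phi> x \<noteq> 0}"] by auto
  show "partial_deriv j \<phi> x = 0" if x: "x \<notin> closure {x. \<phi> x \<noteq> 0}"
  proof -
    have "((\<lambda>_. 0) has_derivative (\<lambda>_. 0)) (at x)" by simp
    then have "(\<phi> has_derivative (\<lambda>_. 0)) (at x)"
      by (rule has_derivative_transform_within_open[where s = "- closure {x. \<phi> x \<noteq> 0}"])
        (use x closure_subset[of "{x. \<phi> x \<noteq> 0}"] in auto)
    then show ?thesis
      unfolding partial_deriv_def by (simp add: frechet_derivative_at[symmetric])
  qed
qed

lemma has_derivative_partial_deriv:
  assumes "\<phi> differentiable (at x)"
  shows "((\<lambda>r. \<phi> (x + r *\<^sub>R axis j 1)) has_real_derivative partial_deriv j \<phi> x) (at 0)"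
proof -
  have "(\<phi> has_derivative frechet_derivative \<phi> (at x)) (at x)"
    using assms frechet_derivative_works by blast
  from has_derivative_imp_directional[OF this, of "axis j 1"] show ?thesis
    unfolding has_field_derivative_iff partial_deriv_def by (simp add: divide_inverse_commute)
qed

lemma partial_deriv_mean_value:
  assumes d: "\<And>x. \<phi> differentiable (at x)" and M: "\<And>x. \<bar>partial_deriv j \<phi> x\<bar> \<le> M" and r: "0 < r"
  shows "\<bar>\<phi> (x + r *\<^sub>R axis j 1) - \<phi> x\<bar> \<le> M * r"
proof -
  have "((\<lambda>r. \<phi> (x + r *\<^sub>R axis j 1)) has_real_derivative partial_deriv j \<phi> (x + s *\<^sub>R axis j 1)) (at s)" for s
  proof -
    have "((\<lambda>r. \<phi> ((x + s *\<^sub>R axis j 1) + r *\<^sub>R axis j 1)) has_real_derivative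
        partial_deriv j \<phi> (x + s *\<^sub>R axis j 1)) (at 0)"
      by (rule has_derivative_partial_deriv[OF d])
    then show ?thesis
      using DERIV_shift[of "\<lambda>r. \<phi> (x + r *\<^sub>R axis j 1)" _ 0 s] by (simp add: algebra_simps)
  qed
  then obtain z where "\<phi> (x + r *\<^sub>R axis j 1) - \<phi> (x + 0 *\<^sub>R axis j 1) = (r - 0) * partial_deriv j \<phi> (x + z *\<^sub>R axis j 1)"
    using MVT2[OF r, of "\<lambda>r. \<phi> (x + r *\<^sub>R axis j 1)" "\<lambda>s. partial_deriv j \<phi> (x + s *\<^sub>R axis j 1)"] by blast
  then show ?thesis using M[of "x + z *\<^sub>R axis j 1"] r by (simp add: abs_mult mult.commute)
qed

text \<open>For a Lipschitz function no singular part can hide in the null set, so the classical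
  derivative off \<open>N\<close> is the weak one. Its entries are limits of difference quotients,
  hence measurable, and the product rule for a component times a test function reduces the defining
  identity to a vanishing integral.\<close>

lemma W1_loc_deriv_locally_lipschitz:
  fixes f :: "real^'n::finite \<Rightarrow> real^'m::finite"
  assumes G: "open G" and lip: "\<And>K. compact K \<Longrightarrow> K \<subseteq> G \<Longrightarrow> \<exists>L. L-lipschitz_on K f"
    and N: "negligible N" and der: "\<And>x. x \<in> G - N \<Longrightarrow> (f has_derivative D x) (at x)"
  shows "W1_loc_deriv p G f (\<lambda>x. if x \<in> G - N then matrix (D x) else 0)"
proof -
  define Df where "Df x = (if x \<in> G - N then matrix (D x) else 0)" for x
  \<comment> \<open>Extending \<open>f\<close> by \<open>0\<close> makes the difference quotients
    Borel functions on the whole space.\<close>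
  define F where "F x = indicat_real G x *\<^sub>R f x" for x
  have N_sets [measurable]: "N \<in> sets lebesgue"
    using N by (auto simp: negligible_iff_null_sets)
  have AEN: "AE x in lebesgue. x \<notin> N"
    using N by (simp add: negligible_iff_null_sets AE_not_in)
  have G_sets [measurable]: "G \<in> sets lebesgue" "G \<in> sets borel" using G by auto
  have GN_sets: "G - N \<in> sets lebesgue" by measurable
  have nbhd: "\<exists>\<epsilon>>0. {x. infdist x K \<le> \<epsilon>} \<subseteq> G" if "compact K" "K \<subseteq> G" "K \<noteq> {}" for K
    using compact_in_open_separated[OF that(3,1) G that(2)] by metis
  have cont: "continuous_on G f" by (rule continuous_on_locally_lipschitz[OF G lip])
  have F_meas [measurable]: "F \<in> borel_measurable borel"
    unfolding F_def by (rule borel_measurable_continuous_on_indicator) (use cont in auto)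
  have Fi_meas [measurable]: "(\<lambda>x. F x $ i) \<in> borel_measurable borel" for i
  proof -
    have "(\<lambda>x. F x \<bullet> axis i 1) \<in> borel_measurable borel" by measurable
    then show ?thesis by (simp add: inner_axis)
  qed
  have entry: "matrix (D x) $ i $ j = D x (axis j 1) $ i" for x i j
    by (simp add: matrix_def)
  have dir: "((\<lambda>r. (F (x + r *\<^sub>R axis j 1) $ i - F x $ i) / r) \<longlongrightarrow> Df x $ i $ j) (at 0)"
    if x: "x \<in> G - N" for x i j
  proof -
    have "((\<lambda>r. ((f (x + r *\<^sub>R axis j 1) - f x) /\<^sub>R r) $ i) \<longlongrightarrow> D x (axis j 1) $ i) (at 0)"
      by (intro tendsto_vec_nth has_derivative_imp_directional der x)
    then have "((\<lambda>r. (F (x + r *\<^sub>R axis j 1) $ i - F x $ i) / r) \<longlongrightarrow> D x (axis j 1) $ i) (at 0)"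
    proof (rule Lim_transform_eventually)
      have "\<forall>\<^sub>F r in at 0. x + r *\<^sub>R axis j 1 \<in> G" using x by (intro eventually_line_in_open G) auto
      then show "\<forall>\<^sub>F r in at 0. ((f (x + r *\<^sub>R axis j 1) - f x) /\<^sub>R r) $ i
          = (F (x + r *\<^sub>R axis j 1) $ i - F x $ i) / r"
        by eventually_elim (use x in \<open>simp add: F_def divide_inverse_commute\<close>)
    qed
    then show ?thesis using x by (simp add: Df_def entry)
  qed
  have Df_entry_meas: "(\<lambda>x. Df x $ i $ j) \<in> borel_measurable lebesgue" for i j
  proof (rule borel_measurable_LIMSEQ_real)
    let ?u = "\<lambda>n x. indicat_real (G - N) x * ((F (x + inverse (real (Suc n)) *\<^sub>R axis j 1) $ i - F x $ i) / inverse (real (Suc n)))"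
    have "(\<lambda>x. (F (x + inverse (real (Suc n)) *\<^sub>R axis j 1) $ i - F x $ i) / inverse (real (Suc n))) \<in> borel_measurable lebesgue" for n
      using measurable_compose[OF _ Fi_meas[of i], of "\<lambda>x. x + inverse (real (Suc n)) *\<^sub>R axis j 1" borel] Fi_meas[of i]
      by (intro measurable_completion) simp
    then show "?u n \<in> borel_measurable lebesgue" for n
      using GN_sets by (intro borel_measurable_times borel_measurable_indicator)
    show "(\<lambda>n. ?u n x) \<longlonglongrightarrow> Df x $ i $ j" for x
    proof (cases "x \<in> G - N")
      case True
      have "filterlim (\<lambda>n. inverse (real (Suc n))) (at 0) sequentially"
        by (intro filterlim_atI LIMSEQ_inverse_real_of_nat) auto
      from filterlim_compose[OF dir[OF True] this] show ?thesis using True by simp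
    qed (auto simp: Df_def)
  qed
  have Df_meas: "Df \<in> borel_measurable lebesgue"
    by (subst borel_measurable_euclidean_space)
      (auto simp: Basis_vec_def inner_axis Df_entry_meas)
  have entry_bound: "\<exists>L. L-lipschitz_on {y. infdist y K \<le> \<epsilon>} f \<and> (\<forall>x i j. x \<in> K \<longrightarrow> \<bar>Df x $ i $ j\<bar> \<le> L)"
    if K: "compact K" "\<epsilon> > 0" "{y. infdist y K \<le> \<epsilon>} \<subseteq> G" "K \<noteq> {}" for K \<epsilon>
  proof -
    have "compact {y. infdist y K \<le> \<epsilon>}" using K by (intro compact_infdist_le) auto
    from lip[OF this K(3)] obtain L where L: "L-lipschitz_on {y. infdist y K \<le> \<epsilon>} f" ..
    have "\<bar>Df x $ i $ j\<bar> \<le> L" if x: "x \<in> K" for x i j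
    proof (cases "x \<in> G - N")
      case True
      have "ball x \<epsilon> \<subseteq> {y. infdist y K \<le> \<epsilon>}"
        by (auto intro!: order_trans[OF infdist_le[OF x]] simp: dist_commute)
      then have "L-lipschitz_on (ball x \<epsilon>) f" by (rule lipschitz_on_subset[OF L])
      then have "norm (D x (axis j 1)) \<le> L * norm (axis j 1 :: real^'n)"
        using K(2) by (intro has_derivative_bound_lipschitz[OF der[OF True] open_ball]) auto
      then show ?thesis
        using True component_le_norm_cart[of "D x (axis j 1)" i] by (simp add: Df_def entry)
    qed (use lipschitz_on_nonneg[OF L] in \<open>auto simp: Df_def\<close>)
    then show ?thesis using L by blast
  qed
  have Lp_f: "Lp_loc p G f"
    unfolding Lp_loc_def
  proof (intro conjI allI impI)
    show "f \<in> borel_measurable (lebesgue_on G)"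
      using cont G_sets by (intro continuous_imp_measurable_on_sets_lebesgue) auto
    fix K assume K: "compact K \<and> K \<subseteq> G"
    have "integrable lborel (\<lambda>x. indicator K x *\<^sub>R norm (f x) ^ p)"
      using K by (intro borel_integrable_compact continuous_intros continuous_on_subset[OF cont]) auto
    then show "set_integrable lebesgue K (\<lambda>x. norm (f x) ^ p)"
      unfolding set_integrable_def by (subst integrable_completion) auto
  qed
  have Lp_Df: "Lp_loc p G Df"
    unfolding Lp_loc_def
  proof (intro conjI allI impI)
    show "Df \<in> borel_measurable (lebesgue_on G)"
      using Df_meas by (rule measurable_restrict_space1)
    fix K assume K: "compact K \<and> K \<subseteq> G"
    show "set_integrable lebesgue K (\<lambda>x. norm (Df x) ^ p)"
    proof (cases "K = {}")
      case False
      obtain \<epsilon> where e: "\<epsilon> > 0" "{y. infdist y K \<le> \<epsilon>} \<subseteq> G" using nbhd K False by blast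
      obtain L where L: "L-lipschitz_on {y. infdist y K \<le> \<epsilon>} f"
        "\<And>x i j. x \<in> K \<Longrightarrow> \<bar>Df x $ i $ j\<bar> \<le> L"
        using entry_bound[OF _ e False] K by blast
      define B where "B = real CARD('m) * (real CARD('n) * L)"
      have B: "norm (Df x) \<le> B" if "x \<in> K" for x
        unfolding B_def by (rule norm_matrix_le_entries) (rule L(2)[OF that])
      show ?thesis
        unfolding set_integrable_def
      proof (rule Bochner_Integration.integrable_bound)
        show "integrable lebesgue (\<lambda>x. indicat_real K x * B ^ p)"
          using K lmeasurable_compact lmeasurable_iff_integrable by (intro integrable_mult_left) blast
        show "(\<lambda>x. indicat_real K x *\<^sub>R norm (Df x) ^ p) \<in> borel_measurable lebesgue"
          using Df_meas fmeasurableD[OF lmeasurable_compact, of K] K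
          by (intro borel_measurable_scaleR borel_measurable_indicator borel_measurable_power) auto
        show "AE x in lebesgue. norm (indicat_real K x *\<^sub>R norm (Df x) ^ p) \<le> norm (indicat_real K x * B ^ p)"
        proof (rule AE_I2)
          fix x
          show "norm (indicat_real K x *\<^sub>R norm (Df x) ^ p) \<le> norm (indicat_real K x * B ^ p)"
            using power_mono[OF B[of x] norm_ge_zero, of p] by (cases "x \<in> K") auto
        qed
      qed
    qed (simp add: set_integrable_def)
  qed
  have "weak_derivative_on G f Df"
    unfolding weak_derivative_on_def
  proof (intro allI ballI)
    fix i j \<phi> assume \<phi>: "\<phi> \<in> test_functions G"
    note \<phi>D = test_functionsD[OF \<phi>]
    define K where "K = closure {x. \<phi> x \<noteq> 0}"
    have K: "compact K" "K \<subseteq> G" using \<phi>D(4,5) by (auto simp: K_def)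
    have \<phi>0: "\<phi> x = 0" "partial_deriv j \<phi> x = 0" if "x \<notin> K" for x
      using \<phi>D(6,7)[of x] that by (auto simp: K_def)
    show "(LINT x:G|lebesgue. f x $ i * partial_deriv j \<phi> x) = - (LINT x:G|lebesgue. Df x $ i $ j * \<phi> x)"
    proof (cases "K = {}")
      case True
      then show ?thesis using \<phi>0 by (simp add: set_lebesgue_integral_def)
    next
      case False
      obtain \<epsilon> where e: "\<epsilon> > 0" "{y. infdist y K \<le> \<epsilon>} \<subseteq> G" using nbhd K False by blast
      \<comment> \<open>Room around the support of \<open>\<phi>\<close>: a step of length at most
        \<open>\<epsilon>\<close> that starts or ends in \<open>K\<close> stays in
        \<open>K'\<close>, where one Lipschitz constant serves.\<close>
      define K' where "K' = {y. infdist y K \<le> \<epsilon>}"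
      have K': "compact K'" "K' \<subseteq> G" unfolding K'_def using K e False by (auto intro: compact_infdist_le)
      have KK': "K \<subseteq> K'" using e(1) by (auto simp: K'_def)
      obtain L where L: "L-lipschitz_on K' f" "\<And>x i j. x \<in> K \<Longrightarrow> \<bar>Df x $ i $ j\<bar> \<le> L"
        using entry_bound[OF K(1) e False] by (auto simp: K'_def)
      have "bounded ((\<lambda>x. f x $ i) ` K')"
        using K' by (intro compact_imp_bounded compact_continuous_image continuous_intros continuous_on_subset[OF cont]) auto
      then obtain Bf where Bf: "\<And>x. x \<in> K' \<Longrightarrow> \<bar>f x $ i\<bar> \<le> Bf" by (auto simp: bounded_iff)
      have "bounded (\<phi> ` K)" "bounded (partial_deriv j \<phi> ` K)"
        using K by (auto intro!: compact_imp_bounded compact_continuous_image intro: continuous_on_subset[OF \<phi>D(2)] continuous_on_subset[OF \<phi>D(3)])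
      then obtain B1 M1 where B1: "\<And>x. x \<in> K \<Longrightarrow> \<bar>\<phi> x\<bar> \<le> B1" and M1: "\<And>x. x \<in> K \<Longrightarrow> \<bar>partial_deriv j \<phi> x\<bar> \<le> M1"
        by (auto simp: bounded_iff)
      define B where "B = max B1 0"
      define M where "M = max M1 0"
      have B: "\<bar>\<phi> x\<bar> \<le> B" for x using B1[of x] \<phi>0[of x] by (cases "x \<in> K") (auto simp: B_def)
      have M: "\<bar>partial_deriv j \<phi> x\<bar> \<le> M" for x using M1[of x] \<phi>0[of x] by (cases "x \<in> K") (auto simp: M_def)
      have Bf0: "Bf \<ge> 0" using Bf KK' False by fastforce
      define v where "v x = F x $ i * \<phi> x" for x
      define v' where "v' x = indicat_real G x * (Df x $ i $ j * \<phi> x) + indicat_real G x * (f x $ i * partial_deriv j \<phi> x)" for x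
      have v_eq: "v = (\<lambda>x. indicator K x *\<^sub>R (f x $ i * \<phi> x))"
        using K \<phi>0 by (auto simp: v_def F_def indicator_def fun_eq_iff)
      have vint: "integrable lborel v"
        unfolding v_eq using K by (intro borel_integrable_compact continuous_intros) (auto intro: continuous_on_subset[OF cont] continuous_on_subset[OF \<phi>D(2)])
      have fp: "integrable lebesgue (\<lambda>x. indicat_real G x * (f x $ i * partial_deriv j \<phi> x))"
      proof -
        have "integrable lborel (\<lambda>x. indicator K x *\<^sub>R (f x $ i * partial_deriv j \<phi> x))"
          using K by (intro borel_integrable_compact continuous_intros) (auto intro: continuous_on_subset[OF cont] continuous_on_subset[OF \<phi>D(3)])
        moreover have "(\<lambda>x. indicator K x *\<^sub>R (f x $ i * partial_deriv j \<phi> x)) = (\<lambda>x. indicat_real G x * (f x $ i * partial_deriv j \<phi> x))"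
          using K \<phi>0 by (auto simp: indicator_def fun_eq_iff)
        ultimately show ?thesis by (subst integrable_completion) (auto dest: borel_measurable_integrable)
      qed
      have \<phi>m: "\<phi> \<in> borel_measurable lebesgue"
        using \<phi>D(2) by (intro measurable_completion) (simp add: borel_measurable_continuous_onI)
      have v'm: "v' \<in> borel_measurable lebesgue"
        unfolding v'_def using G_sets
        by (intro borel_measurable_add[OF _ borel_measurable_integrable[OF fp]] borel_measurable_times
            borel_measurable_indicator Df_entry_meas \<phi>m)
      obtain R where R: "\<And>x. x \<in> K \<Longrightarrow> norm x \<le> R"
        using compact_imp_bounded[OF K(1)] by (auto simp: bounded_iff)
      have lipv: "\<bar>v (x + r *\<^sub>R axis j 1) - v x\<bar> \<le> (L * B + Bf * M) * r" if r: "0 < r" "r \<le> \<epsilon>" for x r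
      proof (cases "x \<in> K \<or> x + r *\<^sub>R axis j 1 \<in> K")
        case False
        then show ?thesis using \<phi>0 r lipschitz_on_nonneg[OF L(1)] Bf0 by (simp add: v_def B_def M_def)
      next
        case True
        let ?y = "x + r *\<^sub>R axis j 1"
        have "dist x ?y = r" using r by (simp add: dist_norm norm_axis_1)
        then have xy: "x \<in> K'" "?y \<in> K'"
          using True r e(1) infdist_le[of x K ?y] infdist_le[of ?y K x] by (auto simp: K'_def dist_commute)
        have "dist (f ?y) (f x) \<le> L * dist ?y x" using xy by (intro lipschitz_onD[OF L(1)])
        then have "norm (f ?y - f x) \<le> L * r"
          using \<open>dist x ?y = r\<close> by (simp add: dist_norm[symmetric] dist_commute[of ?y])
        then have "\<bar>(f ?y - f x) $ i\<bar> \<le> L * r"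
          using component_le_norm_cart[of "f ?y - f x" i] by linarith
        then have 1: "\<bar>f ?y $ i - f x $ i\<bar> \<le> L * r" by simp
        have 2: "\<bar>\<phi> ?y - \<phi> x\<bar> \<le> M * r" by (rule partial_deriv_mean_value[OF \<phi>D(1) M r(1)])
        have "x \<in> G" "?y \<in> G" using xy K' by auto
        then have "v ?y - v x = (f ?y $ i - f x $ i) * \<phi> ?y + f x $ i * (\<phi> ?y - \<phi> x)"
          by (simp add: v_def F_def algebra_simps)
        then have "\<bar>v ?y - v x\<bar> \<le> \<bar>f ?y $ i - f x $ i\<bar> * \<bar>\<phi> ?y\<bar> + \<bar>f x $ i\<bar> * \<bar>\<phi> ?y - \<phi> x\<bar>"
          by (simp only: abs_mult[symmetric] abs_triangle_ineq)
        also have "\<dots> \<le> (L * r) * B + Bf * (M * r)"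
          using Bf0 order_trans[OF abs_ge_zero 1] by (intro add_mono mult_mono 1 2 B Bf[OF xy(1)]) auto
        finally show ?thesis by (simp add: algebra_simps)
      qed
      have dv: "AE x in lebesgue. ((\<lambda>r. (v (x + r *\<^sub>R axis j 1) - v x) / r) \<longlongrightarrow> v' x) (at_right 0)"
        using AEN
      proof eventually_elim
        case (elim x)
        have "((\<lambda>r. (v (x + r *\<^sub>R axis j 1) - v x) / r) \<longlongrightarrow> v' x) (at 0)"
        proof (cases "x \<in> G")
          case True
          let ?y = "\<lambda>r. x + r *\<^sub>R axis j 1"
          have d1: "((\<lambda>r. (F (?y r) $ i - F x $ i) / r) \<longlongrightarrow> Df x $ i $ j) (at 0)"
            using True elim by (intro dir) auto
          have d2: "((\<lambda>r. (\<phi> (?y r) - \<phi> x) / r) \<longlongrightarrow> partial_deriv j \<phi> x) (at 0)"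
            using has_derivative_partial_deriv[OF \<phi>D(1)] by (simp add: has_field_derivative_iff)
          have d3: "((\<lambda>r. \<phi> (?y r)) \<longlongrightarrow> \<phi> (x + 0 *\<^sub>R axis j 1)) (at 0)"
            by (rule isCont_tendsto_compose[where g = \<phi>])
              (use \<phi>D(1) differentiable_imp_continuous_within in \<open>auto intro!: tendsto_eq_intros\<close>)
          have "((\<lambda>r. (F (?y r) $ i - F x $ i) / r * \<phi> (?y r) + F x $ i * ((\<phi> (?y r) - \<phi> x) / r)) \<longlongrightarrow>
              Df x $ i $ j * \<phi> (x + 0 *\<^sub>R axis j 1) + F x $ i * partial_deriv j \<phi> x) (at 0)"
            by (intro tendsto_intros d1 d2 d3)
          moreover have "(F (?y r) $ i - F x $ i) / r * \<phi> (?y r) + F x $ i * ((\<phi> (?y r) - \<phi> x) / r)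
              = (v (?y r) - v x) / r" for r
            unfolding v_def by (cases "r = 0") (auto simp: field_simps)
          moreover have "Df x $ i $ j * \<phi> (x + 0 *\<^sub>R axis j 1) + F x $ i * partial_deriv j \<phi> x = v' x"
            using True by (simp add: v'_def F_def)
          ultimately show ?thesis by simp
        next
          case False
          then have xK: "x \<in> - K" using K by auto
          have ev: "\<forall>\<^sub>F r in at 0. x + r *\<^sub>R axis j 1 \<in> - K"
            using xK K(1) compact_imp_closed by (intro eventually_line_in_open) auto
          have "((\<lambda>r::real. 0::real) \<longlongrightarrow> 0) (at 0)" by simp
          then have "((\<lambda>r. (v (x + r *\<^sub>R axis j 1) - v x) / r) \<longlongrightarrow> 0) (at 0)"
            by (rule Lim_transform_eventually)
              (use ev xK \<phi>0 in \<open>auto elim!: eventually_mono simp: v_def\<close>)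
          then show ?thesis using False by (simp add: v'_def)
        qed
        then show ?case using filterlim_at_split by blast
      qed
      note I = integral_directional_derivative_eq_0[OF vint _ e(1) lipv v'm dv, of R]
      have vR: "v x = 0" if "norm x > R" for x
        using R[of x] that \<phi>0[of x] by (auto simp: v_def)
      have "integrable lebesgue v'" "(LINT x|lebesgue. v' x) = 0" using I vR by auto
      moreover have Dfi: "integrable lebesgue (\<lambda>x. indicat_real G x * (Df x $ i $ j * \<phi> x))"
        using Bochner_Integration.integrable_diff[OF \<open>integrable lebesgue v'\<close> fp] by (simp add: v'_def)
      ultimately have "(LINT x|lebesgue. indicat_real G x * (Df x $ i $ j * \<phi> x)) + (LINT x|lebesgue. indicat_real G x * (f x $ i * partial_deriv j \<phi> x)) = 0"
        unfolding v'_def by (subst (asm) Bochner_Integration.integral_add[OF Dfi fp]) simp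
      then show ?thesis by (simp add: set_lebesgue_integral_def)
    qed
  qed
  then show ?thesis using Lp_f Lp_Df unfolding W1_loc_deriv_def Df_def by blast
qed

text \<open>The derivative enters through a scalar bound \<open>s x\<close> for its operator norm,
  so that the supremum in the dilatation inequality never has to be computed.\<close>

lemma quasiregular_on_lipschitzI:
  fixes f :: "real^'n::finite \<Rightarrow> real^'n"
  assumes G: "open G" "connected G" "G \<noteq> {}"
    and lip: "\<And>K. compact K \<Longrightarrow> K \<subseteq> G \<Longrightarrow> \<exists>L. L-lipschitz_on K f"
    and N: "negligible N" and der: "\<And>x. x \<in> G - N \<Longrightarrow> (f has_derivative D x) (at x)"
    and le: "\<And>x h. x \<in> G - N \<Longrightarrow> norm (D x h) \<le> s x * norm h"
    and det: "\<And>x. x \<in> G - N \<Longrightarrow> s x ^ CARD('n) \<le> K * det (matrix (D x))"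
    and K: "K \<ge> 1"
  shows "quasiregular_on G f"
proof -
  let ?Df = "\<lambda>x. if x \<in> G - N then matrix (D x) else 0"
  have W: "W1_loc_deriv CARD('n) G f ?Df"
    by (rule W1_loc_deriv_locally_lipschitz[OF G(1) lip N der])
  have cont: "continuous_on G f" by (rule continuous_on_locally_lipschitz[OF G(1) lip])
  have ineq: "(SUP h\<in>sphere 0 1. norm (?Df x *v h)) ^ CARD('n) \<le> K * det (?Df x)" if x: "x \<in> G - N" for x
  proof -
    have lin: "matrix (D x) *v h = D x h" for h
      using has_derivative_linear[OF der[OF x]] by (simp add: matrix_works)
    have bd: "norm (?Df x *v h) \<le> s x" if "h \<in> sphere 0 1" for h
      using le[OF x, of h] that x by (simp add: lin)
    have ax: "axis (undefined::'n) 1 \<in> sphere (0::real^'n) 1" by simp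
    have "(SUP h\<in>sphere 0 1. norm (?Df x *v h)) \<le> s x"
      by (rule cSUP_least) (use ax bd in auto)
    moreover have "0 \<le> (SUP h\<in>sphere 0 1. norm (?Df x *v h))"
      by (rule cSUP_upper2[OF _ ax]) (use bd in \<open>auto intro!: bdd_aboveI2\<close>)
    ultimately have "(SUP h\<in>sphere 0 1. norm (?Df x *v h)) ^ CARD('n) \<le> s x ^ CARD('n)"
      by (rule power_mono)
    also have "\<dots> \<le> K * det (?Df x)" using det[OF x] x by simp
    finally show ?thesis .
  qed
  have "AE x in lebesgue. x \<notin> N"
    using N by (simp add: negligible_iff_null_sets AE_not_in)
  then have "AE x in lebesgue_on G. (SUP h\<in>sphere 0 1. norm (?Df x *v h)) ^ CARD('n) \<le> K * det (?Df x)"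
    using G(1) ineq by (subst AE_restrict_space_iff) (auto elim!: eventually_mono)
  then show ?thesis unfolding quasiregular_on_def using G cont W K by blast
qed

section \<open>Conformal capacity\<close>

lemma partial_deriv_eq:
  assumes "(u has_derivative D) (at x)"
  shows "partial_deriv i u x = D (axis i 1)"
  unfolding partial_deriv_def using frechet_derivative_at[OF assms] by simp

section \<open>Smoothness classes and smooth radial cutoffs\<close>

lemma Ck_SucI:
  assumes "\<And>x. (u has_derivative D x) (at x)" "\<And>i. Ck k (\<lambda>x. D x (axis i 1))"
  shows "Ck (Suc k) u"
proof -
  have "partial_deriv i u = (\<lambda>x. D x (axis i 1))" for i
    using partial_deriv_eq[OF assms(1)] by blast
  then show ?thesis using assms by (auto simp: differentiable_def)
qed

lemma Ck_SucD:
  assumes "Ck (Suc k) u"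
  shows "(u has_derivative frechet_derivative u (at x)) (at x)" "Ck k (\<lambda>x. frechet_derivative u (at x) (axis i 1))"
  using assms by (auto simp: frechet_derivative_works partial_deriv_def[abs_def])

lemma Ck_Suc_imp: "Ck (Suc k) u \<Longrightarrow> Ck k u"
proof (induction k arbitrary: u)
  case 0
  then show ?case by (auto intro!: continuous_at_imp_continuous_on differentiable_imp_continuous_within)
next
  case (Suc k)
  then show ?case by (metis Ck.simps(2))
qed

lemma Ck_const: "Ck k (\<lambda>_. c)"
proof (induction k arbitrary: c)
  case (Suc k)
  show ?case by (rule Ck_SucI[of _ "\<lambda>_ _. 0"]) (auto simp: Suc)
qed simp

lemma Ck_nth: "Ck k (\<lambda>x. x $ i)"
proof (cases k)
  case (Suc m)
  show ?thesis unfolding Suc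
    by (rule Ck_SucI[of _ "\<lambda>_ h. h $ i"])
      (auto intro!: bounded_linear_imp_has_derivative bounded_linear_vec_nth Ck_const)
qed (auto intro!: continuous_intros)

lemma Ck_add: "Ck k u \<Longrightarrow> Ck k v \<Longrightarrow> Ck k (\<lambda>x. u x + v x)"
proof (induction k arbitrary: u v)
  case (Suc k)
  show ?case
    by (rule Ck_SucI[OF has_derivative_add[OF Ck_SucD(1)[OF Suc.prems(1)] Ck_SucD(1)[OF Suc.prems(2)]]])
      (intro Suc.IH Ck_SucD(2) Suc.prems)
qed (auto intro: continuous_on_add)

lemma Ck_mult: "Ck k u \<Longrightarrow> Ck k v \<Longrightarrow> Ck k (\<lambda>x. u x * v x)"
proof (induction k arbitrary: u v)
  case (Suc k)
  show ?case
    by (rule Ck_SucI[OF has_derivative_mult[OF Ck_SucD(1)[OF Suc.prems(1)] Ck_SucD(1)[OF Suc.prems(2)]]])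
      (intro Ck_add Suc.IH Ck_SucD(2) Suc.prems Ck_Suc_imp[OF Suc.prems(1)] Ck_Suc_imp[OF Suc.prems(2)])
qed (auto intro: continuous_on_mult)

lemma Ck_sum: "(\<And>i. i \<in> I \<Longrightarrow> Ck k (u i)) \<Longrightarrow> Ck k (\<lambda>x. \<Sum>i\<in>I. u i x)"
  by (induction I rule: infinite_finite_induct) (auto intro: Ck_const Ck_add)

lemma Ck_inner_self: "Ck k (\<lambda>x. x \<bullet> x)"
  unfolding inner_vec_def inner_real_def by (intro Ck_sum Ck_mult Ck_nth)

text \<open>The functions \<open>s\<^sup>-\<^sup>m exp (- 1 / s)\<close>, whose span is closed under differentiation.\<close>
definition flat :: "nat \<Rightarrow> real \<Rightarrow> real" where
  "flat m s = (if s > 0 then inverse s ^ m * exp (- inverse s) else 0)"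

lemma flat_nonneg: "flat m s \<ge> 0" by (simp add: flat_def)

lemma flat_le_0: "s \<le> 0 \<Longrightarrow> flat m s = 0" by (simp add: flat_def)

lemma flat_pos: "s > 0 \<Longrightarrow> flat m s > 0" by (simp add: flat_def)

lemma flat_0_mono: "s \<le> t \<Longrightarrow> flat 0 s \<le> flat 0 t"
  by (auto simp: flat_def intro: le_imp_inverse_le)

lemma tendsto_flat_0: "(flat m \<longlongrightarrow> 0) (at 0)"
proof (rule filterlim_split_at)
  have "((\<lambda>s. inverse s ^ m / exp (inverse s)) \<longlongrightarrow> (0::real)) (at_right 0)"
    by (rule filterlim_compose[OF tendsto_power_div_exp_0 filterlim_inverse_at_top_right])
  then show "(flat m \<longlongrightarrow> 0) (at_right 0)"
    by (rule Lim_transform_eventually)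
      (auto simp: eventually_at_filter flat_def exp_minus field_simps)
  have "((\<lambda>s. 0) \<longlongrightarrow> (0::real)) (at_left 0)" by simp
  then show "(flat m \<longlongrightarrow> 0) (at_left 0)"
    by (rule Lim_transform_eventually) (auto simp: eventually_at_filter flat_def)
qed

lemma DERIV_flat: "(flat m has_real_derivative (- real m * flat (Suc m) s + flat (Suc (Suc m)) s)) (at s)"
proof -
  consider "s > 0" | "s < 0" | "s = 0" by linarith
  then show ?thesis
  proof cases
    case 1
    have "((\<lambda>s. inverse s ^ m * exp (- inverse s)) has_real_derivative
        (- real m * flat (Suc m) s + flat (Suc (Suc m)) s)) (at s)"
    proof -
      have p: "((\<lambda>s. inverse s ^ m) has_real_derivative (- real m * inverse s ^ Suc m)) (at s)"
        by (rule DERIV_cong[OF DERIV_power[OF DERIV_inverse]])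
          (use 1 in simp, cases m, simp_all add: algebra_simps)
      have e: "((\<lambda>s. exp (- inverse s)) has_real_derivative (exp (- inverse s) * inverse s ^ 2)) (at s)"
        using 1 by (intro DERIV_cong[OF DERIV_fun_exp[OF DERIV_minus[OF DERIV_inverse]]]) (simp_all add: power2_eq_square)
      show ?thesis
        by (rule DERIV_cong[OF DERIV_mult[OF p e]])
          (use 1 in \<open>simp add: flat_def power2_eq_square algebra_simps\<close>)
    qed
    then show ?thesis
      by (rule has_field_derivative_transform_within_open[where S = "{0<..}"])
        (use 1 in \<open>auto simp: flat_def\<close>)
  next
    case 2
    have "((\<lambda>_. 0) has_real_derivative (- real m * flat (Suc m) s + flat (Suc (Suc m)) s)) (at s)"
      using 2 by (simp add: flat_def)
    then show ?thesis
      by (rule has_field_derivative_transform_within_open[where S = "{..<0}"])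
        (use 2 in \<open>auto simp: flat_def\<close>)
  next
    case 3
    have "((\<lambda>h. (flat m (0 + h) - flat m 0) / h) \<longlongrightarrow> 0) (at 0)"
      by (rule Lim_transform_eventually[OF tendsto_flat_0[of "Suc m"]])
        (auto simp: eventually_at_filter flat_def field_simps)
    then show ?thesis unfolding 3 DERIV_def by (simp add: flat_le_0)
  qed
qed

lemma continuous_on_flat: "continuous_on UNIV (flat m)"
  using DERIV_flat by (auto intro!: continuous_at_imp_continuous_on DERIV_isCont)

lemma Ck_flat: "Ck k u \<Longrightarrow> Ck k (\<lambda>x. flat m (u x))"
proof (induction k arbitrary: m)
  case 0
  then show ?case using continuous_on_compose2[OF continuous_on_flat] by auto
next
  case (Suc k)
  have "((\<lambda>x. flat m (u x)) has_derivative
     (\<lambda>h. (- real m * flat (Suc m) (u x) + flat (Suc (Suc m)) (u x)) * frechet_derivative u (at x) h)) (at x)" for x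
    using DERIV_compose_FDERIV[OF DERIV_flat Ck_SucD(1)[OF Suc.prems]] by (simp add: mult.commute)
  then show ?case
    by (rule Ck_SucI) (intro Ck_mult Ck_add Ck_const Suc.IH Ck_Suc_imp[OF Suc.prems] Ck_SucD(2)[OF Suc.prems])
qed

text \<open>A smooth cutoff made of the flat function alone: constantly
  \<open>flat 0 (flat 0 1)\<close> where \<open>c * (x \<bullet> x) \<le> 1\<close>, zero where
  \<open>c * (x \<bullet> x) \<ge> 2\<close>. Changing \<open>c\<close> rescales it.\<close>

definition bump :: "real \<Rightarrow> real^'n::finite \<Rightarrow> real" where
  "bump c x = flat 0 (flat 0 1 - flat 0 (c * (x \<bullet> x) - 1))"

lemma Ck_bump: "Ck k (bump c)"
proof -
  have *: "bump c = (\<lambda>x. flat 0 (flat 0 1 + (- 1) * flat 0 (c * (x \<bullet> x) + (- 1))))"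
    by (simp add: bump_def fun_eq_iff)
  show ?thesis
    by (subst *) (intro Ck_flat Ck_add Ck_mult Ck_const Ck_inner_self)
qed

lemma bump_eq_0: "c * (x \<bullet> x) \<ge> 2 \<Longrightarrow> bump c x = 0"
  unfolding bump_def by (intro flat_le_0) (use flat_0_mono[of 1 "c * (x \<bullet> x) - 1"] in auto)

text \<open>The derivative of the profile \<open>flat 0 (flat 0 1 - flat 0 s)\<close> in
  \<open>s\<close>, because \<open>flat 0\<close> has derivative \<open>flat 2\<close>.\<close>

definition bump_slope :: "real \<Rightarrow> real" where
  "bump_slope s = - flat 2 (flat 0 1 - flat 0 s) * flat 2 s"

lemma bump_slope_eq_0: "s \<le> 0 \<or> s \<ge> 1 \<Longrightarrow> bump_slope s = 0"
  using flat_0_mono[of 1 s] by (auto simp: bump_slope_def flat_le_0)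

lemma bump_slope_bounded: "\<exists>M>0. \<forall>s. \<bar>bump_slope s\<bar> \<le> M"
proof -
  have "continuous_on {0..1} bump_slope"
    unfolding bump_slope_def
    by (intro continuous_intros continuous_on_compose2[OF continuous_on_flat]) auto
  then have "bounded (bump_slope ` {0..1})"
    by (intro compact_imp_bounded compact_continuous_image) auto
  then obtain M where M: "M > 0" "\<And>s. s \<in> {0..1} \<Longrightarrow> \<bar>bump_slope s\<bar> \<le> M"
    by (auto simp: bounded_pos)
  have "\<bar>bump_slope s\<bar> \<le> M" for s
    using M(2)[of s] M(1) bump_slope_eq_0[of s] by (cases "s \<in> {0..1}") auto
  then show ?thesis using M(1) by blast
qed

lemma bump_has_derivative:
  "(bump c has_derivative (\<lambda>h. bump_slope (c * (x \<bullet> x) - 1) * (2 * c * (x \<bullet> h)))) (at x)"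
proof -
  have a: "((\<lambda>x. c * (x \<bullet> x) - 1) has_derivative (\<lambda>h. 2 * c * (x \<bullet> h))) (at x)"
    by (auto intro!: derivative_eq_intros simp: inner_commute)
  have d0: "(flat 0 has_real_derivative flat 2 s) (at s)" for s
    using DERIV_flat[of 0 s] by (simp add: numeral_2_eq_2)
  have b: "((\<lambda>x. flat 0 1 - flat 0 (c * (x \<bullet> x) - 1)) has_derivative
      (\<lambda>h. 0 - 2 * c * (x \<bullet> h) * flat 2 (c * (x \<bullet> x) - 1))) (at x)"
    by (intro has_derivative_diff has_derivative_const DERIV_compose_FDERIV[OF d0 a])
  show ?thesis
    unfolding bump_def bump_slope_def
    by (rule has_derivative_eq_rhs[OF DERIV_compose_FDERIV[OF d0 b]]) (simp add: fun_eq_iff algebra_simps)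
qed

lemma gradient_eq:
  assumes "(u has_derivative (\<lambda>h. y \<bullet> h)) (at x)"
  shows "gradient u x = y"
  unfolding gradient_def partial_deriv_eq[OF assms] by (simp add: inner_axis)

lemma has_derivative_gradient:
  assumes "u differentiable (at x)"
  shows "(u has_derivative (\<lambda>h. gradient u x \<bullet> h)) (at x)"
proof -
  let ?D = "frechet_derivative u (at x)"
  have d: "(u has_derivative ?D) (at x)" using assms frechet_derivative_works by blast
  have "?D h = gradient u x \<bullet> h" for h
  proof -
    have "?D h = ?D (\<Sum>i\<in>UNIV. h $ i *\<^sub>R axis i 1)" by (simp add: basis_expansion flip: scalar_mult_eq_scaleR)
    also have "\<dots> = (\<Sum>i\<in>UNIV. h $ i * ?D (axis i 1))"
      using has_derivative_linear[OF d] by (simp add: linear_sum linear_scale)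
    finally show ?thesis by (simp add: inner_vec_def gradient_def partial_deriv_def mult.commute)
  qed
  then show ?thesis using d by (metis ext)
qed

lemma gradient_bump: "gradient (bump c) x = (2 * c * bump_slope (c * (x \<bullet> x) - 1)) *\<^sub>R x"
  by (rule gradient_eq) (use bump_has_derivative[of c x] in \<open>simp add: mult_ac\<close>)

lemma bump_nonneg: "bump c x \<ge> 0"
  by (simp add: bump_def flat_nonneg)

lemma bump_0_pos: "bump c 0 = flat 0 (flat 0 1)" "flat 0 (flat 0 1) > 0"
  by (simp_all add: bump_def flat_le_0 flat_pos)

text \<open>Where the slope is nonzero, \<open>c * norm x \<le> 2\<close> absorbs one of the two
  factors \<open>c\<close> of the chain rule. What remains is of order \<open>c\<close> on a ball of
  radius of order \<open>1 / c\<close>, so its power with the dimension as exponent has an integral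
  independent of the scale.\<close>

lemma gradient_bump_bound:
  assumes M: "\<And>s. \<bar>bump_slope s\<bar> \<le> M" and c: "c > 0"
  shows "norm (gradient (bump (c\<^sup>2)) x) \<le> 4 * M * c * indicat_real (cball 0 (2 / c)) x"
proof (cases "0 < c\<^sup>2 * (x \<bullet> x) - 1 \<and> c\<^sup>2 * (x \<bullet> x) - 1 < 1")
  case True
  have "(c * norm x)\<^sup>2 \<le> 2\<^sup>2" using True by (simp add: power_mult_distrib dot_square_norm)
  then have cx: "c * norm x \<le> 2" by (rule power2_le_imp_le) simp
  have M0: "M \<ge> 0" using M[of 0] by linarith
  have "norm (gradient (bump (c\<^sup>2)) x) = 2 * c * \<bar>bump_slope (c\<^sup>2 * (x \<bullet> x) - 1)\<bar> * (c * norm x)"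
    using c by (simp add: gradient_bump abs_mult power2_eq_square)
  also have "\<dots> \<le> 2 * c * M * 2"
    using c M0 by (intro mult_mono cx mult_left_mono[OF M]) auto
  also have "\<dots> = 4 * M * c * indicat_real (cball 0 (2 / c)) x"
    using cx c by (simp add: field_simps)
  finally show ?thesis .
next
  case False
  then have "bump_slope (c\<^sup>2 * (x \<bullet> x) - 1) = 0" by (intro bump_slope_eq_0) auto
  moreover have "M \<ge> 0" using M[of 0] by linarith
  ultimately show ?thesis using c by (simp add: gradient_bump)
qed

text \<open>
  The bumps at scale \<open>2\<^sup>-\<^sup>k\<close> all have the same conformal energy and their gradients have disjoint
  supports, so the average of \<open>N\<close> of them has energy of order \<open>N powr (1 - n)\<close>.
\<close>
lemma compact_capacity_zero_singleton:
  assumes n: "CARD('n::finite) \<ge> 2" and C: "C \<subseteq> {0 :: real^'n}"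
  shows "compact_capacity_zero C"
proof -
  define n where "n = CARD('n)"
  have n2: "n \<ge> 2" using n by (simp add: n_def)
  obtain M where M: "M > 0" "\<And>s. \<bar>bump_slope s\<bar> \<le> M" using bump_slope_bounded by blast
  define b where "b = flat 0 (flat 0 1)"
  have b: "b > 0" by (simp add: b_def bump_0_pos)
  define V where "V = unit_ball_vol (real n)"
  define E where "E = (8 * M / b) ^ n * V"
  have V: "V \<ge> 0" by (simp add: V_def)
  have E: "E \<ge> 0" using M b V by (simp add: E_def)
  have main: "conformal_capacity (ball 0 2) C \<le> ennreal (E / real N)" if N: "N \<ge> 1" for N
  proof -
    define \<phi> where "\<phi> k = (bump ((2 ^ k)\<^sup>2) :: real^'n \<Rightarrow> real)" for k
    \<comment> \<open>The bumps share the value \<open>b\<close> at the origin, so this average is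
      normalized to \<open>u 0 = 1\<close>.\<close>
    define u where "u x = (\<Sum>k<N. 1 / (real N * b) * \<phi> k x)" for x
    have Cku: "Ck m u" for m
      unfolding u_def \<phi>_def by (intro Ck_sum Ck_mult Ck_const Ck_bump)
    have supp: "{x. u x \<noteq> 0} \<subseteq> cball 0 (3/2)"
    proof
      fix x assume "x \<in> {x. u x \<noteq> 0}"
      then have "\<exists>k. \<phi> k x \<noteq> 0" unfolding u_def by (auto intro: ccontr)
      then obtain k where "\<phi> k x \<noteq> 0" ..
      then have "(2 ^ k)\<^sup>2 * (x \<bullet> x) < 2" unfolding \<phi>_def using bump_eq_0 not_less by blast
      moreover have "1 * (x \<bullet> x) \<le> (2 ^ k)\<^sup>2 * (x \<bullet> x)" by (intro mult_right_mono one_le_power) auto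
      ultimately have "(norm x)\<^sup>2 \<le> (3/2)\<^sup>2" by (simp add: dot_square_norm power2_eq_square)
      then have "norm x \<le> 3/2" by (rule power2_le_imp_le) simp
      then show "x \<in> cball 0 (3/2)" by simp
    qed
    then have cl: "closure {x. u x \<noteq> 0} \<subseteq> cball 0 (3/2)" by (simp add: closure_minimal)
    have "compact (closure {x. u x \<noteq> 0})"
      using bounded_subset[OF bounded_cball supp] by (simp add: compact_closure)
    moreover have "cball 0 (3/2) \<subseteq> ball (0::real^'n) 2" by auto
    ultimately have ut: "u \<in> test_functions (ball 0 2)"
      unfolding test_functions_def using Cku cl by blast
    have u0: "u x \<ge> 0" for x
      unfolding u_def using b by (intro sum_nonneg mult_nonneg_nonneg) (auto simp: \<phi>_def bump_nonneg)
    have "u 0 = 1" using b N by (simp add: u_def \<phi>_def bump_0_pos flip: b_def)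
    then have uC: "1 \<le> u x" if "x \<in> C" for x using C that by auto
    have grad: "gradient u x = (\<Sum>k<N. (1 / (real N * b)) *\<^sub>R gradient (\<phi> k) x)" for x
    proof (rule gradient_eq)
      have "(\<phi> k has_derivative (\<lambda>h. gradient (\<phi> k) x \<bullet> h)) (at x)" for k
        by (rule has_derivative_gradient) (use bump_has_derivative in \<open>auto simp: \<phi>_def differentiable_def\<close>)
      then have "(u has_derivative (\<lambda>h. \<Sum>k<N. 1 / (real N * b) * (gradient (\<phi> k) x \<bullet> h))) (at x)"
        unfolding u_def by (intro has_derivative_sum has_derivative_mult_right)
      then show "(u has_derivative (\<lambda>h. (\<Sum>k<N. (1 / (real N * b)) *\<^sub>R gradient (\<phi> k) x) \<bullet> h)) (at x)"
        by (simp add: inner_sum_left)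
    qed
    \<comment> \<open>The gradient of \<open>\<phi> k\<close> lives where
      \<open>4 ^ k * (x \<bullet> x)\<close> is strictly between \<open>1\<close> and
      \<open>2\<close>, and different scales differ by a factor of at least
      \<open>4\<close>.\<close>
    have disj: "gradient (\<phi> l) x = 0" if "k \<noteq> l" "gradient (\<phi> k) x \<noteq> 0" for k l x
    proof -
      have iv: "1 < (2 ^ i)\<^sup>2 * (x \<bullet> x) \<and> (2 ^ i)\<^sup>2 * (x \<bullet> x) < 2" if "gradient (\<phi> i) x \<noteq> 0" for i
        using that bump_slope_eq_0[of "(2 ^ i)\<^sup>2 * (x \<bullet> x) - 1"]
        by (force simp: \<phi>_def gradient_bump)
      have ord: False if "i < j" "gradient (\<phi> i) x \<noteq> 0" "gradient (\<phi> j) x \<noteq> 0" for i j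
      proof -
        have "(2::real) * 2 ^ i \<le> 2 ^ j" using power_increasing[of "Suc i" j "2::real"] that(1) by simp
        then have "((2::real) * 2 ^ i)\<^sup>2 \<le> (2 ^ j)\<^sup>2" by (intro power_mono) auto
        then have "(2 * 2 ^ i)\<^sup>2 * (x \<bullet> x) \<le> (2 ^ j)\<^sup>2 * (x \<bullet> x)" by (intro mult_right_mono) auto
        then show False using iv[OF that(2)] iv[OF that(3)] by (simp add: power_mult_distrib)
      qed
      show ?thesis using ord[of k l] ord[of l k] that by (metis linorder_neqE_nat)
    qed
    define B where "B k x = (4 * M * 2 ^ k / (real N * b)) ^ n * indicat_real (cball 0 (2 / 2 ^ k)) x" for k and x :: "real^'n"
    have B0: "B k x \<ge> 0" for k x unfolding B_def using M b by (intro mult_nonneg_nonneg) auto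
    have B_meas: "(\<lambda>x. ennreal (B k x)) \<in> borel_measurable lebesgue" for k
    proof (rule measurable_completion)
      have "indicat_real (cball 0 (2 / 2 ^ k)) \<in> borel_measurable (borel :: (real^'n) measure)"
        by (rule borel_measurable_indicator) simp
      then show "(\<lambda>x. ennreal (B k x)) \<in> borel_measurable lborel" by (simp add: B_def)
    qed
    have pw: "norm (gradient u x) ^ n \<le> (\<Sum>k<N. B k x)" for x
    proof (cases "\<exists>k<N. gradient (\<phi> k) x \<noteq> 0")
      case True
      then obtain k where k: "k < N" "gradient (\<phi> k) x \<noteq> 0" by blast
      have "gradient u x = (\<Sum>l\<in>{k}. (1 / (real N * b)) *\<^sub>R gradient (\<phi> l) x)"
        unfolding grad by (rule sum.mono_neutral_right) (use k disj in auto)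
      then have "norm (gradient u x) = 1 / (real N * b) * norm (gradient (\<phi> k) x)"
        using b by simp
      also have "\<dots> \<le> 1 / (real N * b) * (4 * M * 2 ^ k * indicat_real (cball 0 (2 / 2 ^ k)) x)"
        unfolding \<phi>_def using b M(2) by (intro mult_left_mono gradient_bump_bound) auto
      also have "\<dots> = (4 * M * 2 ^ k / (real N * b)) * indicat_real (cball 0 (2 / 2 ^ k)) x" by simp
      finally have "norm (gradient u x) ^ n \<le> ((4 * M * 2 ^ k / (real N * b)) * indicat_real (cball 0 (2 / 2 ^ k)) x) ^ n"
        by (intro power_mono) auto
      also have "\<dots> = B k x" using n2 by (simp add: B_def power_mult_distrib indicator_def)
      also have "\<dots> \<le> (\<Sum>k<N. B k x)" using k B0 by (intro member_le_sum) auto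
      finally show ?thesis .
    next
      case False
      then have "gradient u x = 0" by (simp add: grad)
      then show ?thesis using n2 B0 by (simp add: sum_nonneg power_0_left)
    qed
    have "conformal_capacity (ball 0 2) C \<le> (\<integral>\<^sup>+x\<in>ball 0 2. ennreal (norm (gradient u x) ^ CARD('n)) \<partial>lebesgue)"
      unfolding conformal_capacity_def by (rule INF_lower) (use ut u0 uC in auto)
    also have "\<dots> \<le> (\<integral>\<^sup>+x. (\<Sum>k<N. ennreal (B k x)) \<partial>lebesgue)"
    proof (rule nn_integral_mono)
      fix x :: "real^'n"
      have "ennreal (norm (gradient u x) ^ CARD('n)) \<le> (\<Sum>k<N. ennreal (B k x))"
        using pw[of x] B0 by (subst sum_ennreal) (auto simp: n_def intro: ennreal_leI)
      then show "ennreal (norm (gradient u x) ^ CARD('n)) * indicator (ball 0 2) x \<le> (\<Sum>k<N. ennreal (B k x))"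
        by (simp add: indicator_def)
    qed
    also have "\<dots> = (\<Sum>k<N. \<integral>\<^sup>+x. ennreal (B k x) \<partial>lebesgue)"
      by (rule nn_integral_sum) (rule B_meas)
    also have "\<dots> = (\<Sum>k<N. ennreal (E / real N ^ n))"
    proof (rule sum.cong[OF refl])
      fix k
      have cont: "emeasure lebesgue (cball (0::real^'n) (2 / 2 ^ k)) = ennreal (V * (2 / 2 ^ k) ^ n)"
        using emeasure_cball[of "2 / 2 ^ k" "0::real^'n"] by (simp add: V_def n_def emeasure_completion)
      have "(\<integral>\<^sup>+x. ennreal (B k x) \<partial>lebesgue) =
          (\<integral>\<^sup>+x. ennreal ((4 * M * 2 ^ k / (real N * b)) ^ n) * indicator (cball (0::real^'n) (2 / 2 ^ k)) x \<partial>lebesgue)"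
        by (intro nn_integral_cong) (auto simp: B_def indicator_def)
      also have "\<dots> = ennreal ((4 * M * 2 ^ k / (real N * b)) ^ n) * ennreal (V * (2 / 2 ^ k) ^ n)"
        by (subst nn_integral_cmult_indicator) (auto simp: cont)
      also have "\<dots> = ennreal ((4 * M * 2 ^ k / (real N * b)) ^ n * (V * (2 / 2 ^ k) ^ n))"
        using M b by (intro ennreal_mult''[symmetric]) (auto simp: V)
      also have "(4 * M * 2 ^ k / (real N * b)) ^ n * (V * (2 / 2 ^ k) ^ n) = E / real N ^ n"
      proof -
        have "(4 * M * 2 ^ k / (real N * b)) * (2 / 2 ^ k) = (8 * M / b) / real N" by (simp add: field_simps)
        then have "((4 * M * 2 ^ k / (real N * b)) * (2 / 2 ^ k)) ^ n = (8 * M / b) ^ n / real N ^ n"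
          by (simp only: power_divide)
        then show ?thesis unfolding E_def by (simp only: power_mult_distrib) (simp add: mult_ac)
      qed
      finally show "(\<integral>\<^sup>+x. ennreal (B k x) \<partial>lebesgue) = ennreal (E / real N ^ n)" .
    qed
    also have "\<dots> = ennreal (real N * (E / real N ^ n))"
      using E by (simp add: ennreal_of_nat_eq_real_of_nat flip: ennreal_mult'')
    also have "\<dots> \<le> ennreal (E / real N)"
    \<comment> \<open>Here the dimension being at least two enters: the sum of \<open>N\<close>
      contributions \<open>E / N ^ n\<close> still tends to zero.\<close>
    proof (rule ennreal_leI)
      obtain m where m: "n = Suc (Suc m)" using n2 le_Suc_ex[of 2 n] by auto
      have "E * 1 \<le> E * real N ^ m" using E N by (intro mult_left_mono one_le_power) auto
      then show "real N * (E / real N ^ n) \<le> E / real N"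
        using N by (simp add: m field_simps)
    qed
    finally show ?thesis .
  qed
  have "conformal_capacity (ball 0 2) C \<le> 0"
  proof (rule tendsto_lowerbound)
    have "(\<lambda>N. ennreal (E / real N)) \<longlonglongrightarrow> ennreal 0"
      by (intro tendsto_ennrealI lim_const_over_n)
    then show "(\<lambda>N. ennreal (E / real N)) \<longlonglongrightarrow> 0" by simp
    show "\<forall>\<^sub>F N in sequentially. conformal_capacity (ball 0 2) C \<le> ennreal (E / real N)"
      using eventually_ge_at_top[of 1] by eventually_elim (rule main)
  qed simp
  then show ?thesis
    unfolding compact_capacity_zero_def using C by (intro exI[of _ "ball 0 2"]) auto
qed


section \<open>Positive capacity of compact sets of positive measure\<close>

lemma integral_partial_deriv_eq_0:
  assumes \<phi>: "\<phi> \<in> test_functions A"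
  shows "integrable lebesgue (partial_deriv j \<phi>)" "(LINT x|lebesgue. partial_deriv j \<phi> x) = 0"
    "integrable lborel \<phi>"
proof -
  note \<phi>D = test_functionsD[OF \<phi>]
  define K where "K = closure {x. \<phi> x \<noteq> 0}"
  have K: "compact K" "\<And>x. x \<notin> K \<Longrightarrow> \<phi> x = 0" "\<And>x. x \<notin> K \<Longrightarrow> partial_deriv j \<phi> x = 0"
    unfolding K_def by (rule \<phi>D(4), erule \<phi>D(6), erule \<phi>D(7))
  obtain R where R: "\<And>x. x \<in> K \<Longrightarrow> norm x \<le> R"
    using compact_imp_bounded[OF K(1)] by (auto simp: bounded_iff)
  have "integrable lborel (\<lambda>x. indicator K x *\<^sub>R \<phi> x)"
    by (rule borel_integrable_compact[OF K(1) continuous_on_subset[OF \<phi>D(2)]]) auto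
  moreover have "(\<lambda>x. indicator K x *\<^sub>R \<phi> x) = \<phi>"
    using K(2) by (auto simp: fun_eq_iff indicator_def)
  ultimately show int: "integrable lborel \<phi>" by simp
  have "bounded (partial_deriv j \<phi> ` K)"
    by (intro compact_imp_bounded compact_continuous_image continuous_on_subset[OF \<phi>D(3)] K) auto
  then obtain M where M: "M > 0" "\<And>x. x \<in> K \<Longrightarrow> \<bar>partial_deriv j \<phi> x\<bar> \<le> M"
    by (auto simp: bounded_pos)
  then have M': "\<bar>partial_deriv j \<phi> x\<bar> \<le> M" for x
    using K(3)[of x] by (cases "x \<in> K") auto
  have lip: "\<bar>\<phi> (x + r *\<^sub>R axis j 1) - \<phi> x\<bar> \<le> M * r" if "0 < r" "r \<le> 1" for x r
    by (rule partial_deriv_mean_value[OF \<phi>D(1) M' that(1)])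
  have der: "((\<lambda>r. (\<phi> (x + r *\<^sub>R axis j 1) - \<phi> x) / r) \<longlongrightarrow> partial_deriv j \<phi> x) (at_right 0)" for x
  proof -
    have "((\<lambda>r. (\<phi> (x + r *\<^sub>R axis j 1) - \<phi> x) / r) \<longlongrightarrow> partial_deriv j \<phi> x) (at 0)"
      using has_derivative_partial_deriv[OF \<phi>D(1), of x j] by (simp add: has_field_derivative_iff)
    then show ?thesis using filterlim_at_split by blast
  qed
  have meas: "partial_deriv j \<phi> \<in> borel_measurable lebesgue"
    using \<phi>D(3) by (intro measurable_completion) (simp add: borel_measurable_continuous_onI)
  have supp: "\<phi> x = 0" if "norm x > R" for x
    using R[of x] K(2)[of x] that by auto
  note I = integral_directional_derivative_eq_0[OF int supp zero_less_one lip meas AE_I2[OF der]]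
  show "integrable lebesgue (partial_deriv j \<phi>)" "(LINT x|lebesgue. partial_deriv j \<phi> x) = 0"
    using I by blast+
qed

text \<open>
  Integrating \<open>\<partial>\<^sub>j (x\<^sub>j u) = u + x\<^sub>j \<partial>\<^sub>j u\<close> bounds the integral of \<open>u\<close> by that of its gradient.
\<close>
lemma conformal_capacity_pos:
  fixes A C :: "(real^'n::finite) set"
  assumes A: "open A" "bounded A" "C \<subseteq> A" and C: "compact C" "measure lebesgue C > 0"
  shows "conformal_capacity A C > 0"
proof -
  fix j :: 'n
  define n where "n = CARD('n)"
  have n1: "n \<ge> 1" by (simp add: n_def Suc_leI)
  obtain R where R: "R > 0" "\<And>x. x \<in> A \<Longrightarrow> norm x \<le> R" using A(2) by (auto simp: bounded_pos)
  have Am: "A \<in> lmeasurable" using A by (simp add: bounded_set_imp_lmeasurable)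
  have Cm: "C \<in> lmeasurable" using C by (simp add: lmeasurable_compact)
  define \<alpha> where "\<alpha> = measure lebesgue C"
  define \<beta> where "\<beta> = measure lebesgue A"
  have \<alpha>: "\<alpha> > 0" and \<beta>: "\<beta> \<ge> 0" using C by (auto simp: \<alpha>_def \<beta>_def)
  \<comment> \<open>Together with \<open>\<delta>\<close> below this makes each of the two terms in
    the final estimate at most \<open>\<alpha> / 4\<close>, so they cannot add up to
    \<open>\<alpha>\<close>.\<close>
  define \<epsilon> where "\<epsilon> = \<alpha> / (4 * R * (\<beta> + 1))"
  have \<epsilon>: "\<epsilon> > 0" using \<alpha> \<beta> R by (simp add: \<epsilon>_def)
  have \<epsilon>': "R * \<epsilon> * \<beta> \<le> \<alpha> / 4"
  proof -
    have "R * \<epsilon> = \<alpha> / (4 * (\<beta> + 1))" using R by (simp add: \<epsilon>_def)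
    then have "R * \<epsilon> * \<beta> = \<alpha> * \<beta> / (4 * (\<beta> + 1))" by simp
    also have "\<dots> \<le> \<alpha> / 4"
      using \<alpha> \<beta> by (subst pos_divide_le_eq) (auto simp: algebra_simps)
    finally show ?thesis .
  qed
  define \<delta> where "\<delta> = \<alpha> * \<epsilon> ^ (n - 1) / (4 * R)"
  have \<delta>: "\<delta> > 0" using \<alpha> \<epsilon> R by (simp add: \<delta>_def)
  have enn: "ennreal a + ennreal b * ennreal c = ennreal (a + b * c)" if "a \<ge> 0" "b \<ge> 0" "c \<ge> 0" for a b c
    using that by (simp add: ennreal_mult)
  \<comment> \<open>A crude Young inequality: it trades the first power of the gradient, produced by
    the integration by parts, for the power in the capacity, at the cost of a small multiple of the
    measure of \<open>A\<close>.\<close>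
  have young: "t \<le> \<epsilon> + t ^ n / \<epsilon> ^ (n - 1)" if "t \<ge> 0" for t
  proof (cases "t \<le> \<epsilon>")
    case True
    then show ?thesis using that \<epsilon> by (simp add: add_increasing2)
  next
    case False
    then have "t * \<epsilon> ^ (n - 1) \<le> t * t ^ (n - 1)" using that \<epsilon> by (intro mult_left_mono power_mono) auto
    also have "\<dots> = t ^ n" using n1 by (simp add: power_eq_if)
    finally have "t \<le> t ^ n / \<epsilon> ^ (n - 1)" using \<epsilon> by (simp add: field_simps)
    then show ?thesis using \<epsilon> by linarith
  qed
  have "ennreal \<delta> \<le> conformal_capacity A C"
    unfolding conformal_capacity_def
  proof (rule INF_greatest)
    fix u assume "u \<in> {u \<in> test_functions A. (\<forall>x. 0 \<le> u x) \<and> (\<forall>x\<in>C. 1 \<le> u x)}"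
    then have u: "u \<in> test_functions A" "\<And>x. 0 \<le> u x" "\<And>x. x \<in> C \<Longrightarrow> 1 \<le> u x" by auto
    note uD = test_functionsD[OF u(1)]
    let ?K = "closure {x. u x \<noteq> 0}"
    define v where "v x = x $ j * u x" for x
    have v: "v \<in> test_functions A"
    proof -
      have "{x. v x \<noteq> 0} \<subseteq> {x. u x \<noteq> 0}" by (auto simp: v_def)
      then have cl: "closure {x. v x \<noteq> 0} \<subseteq> ?K" by (rule closure_mono)
      then have "compact (closure {x. v x \<noteq> 0})"
        using compact_imp_bounded[OF uD(4)] bounded_subset by (auto simp: compact_eq_bounded_closed)
      moreover have "Ck k v" for k
        unfolding v_def using u(1) by (intro Ck_mult Ck_nth) (auto simp: test_functions_def)
      ultimately show ?thesis using cl uD(5) by (auto simp: test_functions_def)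
    qed
    have pv: "partial_deriv j v x = u x + x $ j * partial_deriv j u x" for x
    proof -
      have "((\<lambda>x. x $ j) has_derivative (\<lambda>h. h $ j)) (at x)"
        by (simp add: bounded_linear_imp_has_derivative bounded_linear_vec_nth)
      moreover have "(u has_derivative frechet_derivative u (at x)) (at x)"
        using uD(1) frechet_derivative_works by blast
      ultimately show ?thesis
        unfolding v_def by (subst partial_deriv_eq[OF has_derivative_mult]) (auto simp: partial_deriv_def)
    qed
    have iu: "integrable lebesgue u"
      using integral_partial_deriv_eq_0(3)[OF u(1)] by (subst integrable_completion) (auto dest: borel_measurable_integrable)
    have iv: "integrable lebesgue (\<lambda>x. u x + x $ j * partial_deriv j u x)" "(LINT x|lebesgue. u x + x $ j * partial_deriv j u x) = 0"
    proof -
      have "partial_deriv j v = (\<lambda>x. u x + x $ j * partial_deriv j u x)" using pv by (rule ext)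
      then show "integrable lebesgue (\<lambda>x. u x + x $ j * partial_deriv j u x)" "(LINT x|lebesgue. u x + x $ j * partial_deriv j u x) = 0"
        using integral_partial_deriv_eq_0(1,2)[OF v, of j] by simp_all
    qed
    have ip: "integrable lebesgue (\<lambda>x. x $ j * partial_deriv j u x)"
      using Bochner_Integration.integrable_diff[OF iv(1) iu] by simp
    have eq: "(LINT x|lebesgue. u x) = - (LINT x|lebesgue. x $ j * partial_deriv j u x)"
      using iv(2) by (subst (asm) Bochner_Integration.integral_add[OF iu ip]) simp
    have "\<alpha> = (LINT x|lebesgue. indicat_real C x)"
      using Cm by (simp add: \<alpha>_def)
    also have "\<dots> \<le> (LINT x|lebesgue. u x)"
    proof (rule integral_mono[OF _ iu])
      show "integrable lebesgue (indicat_real C)" using Cm by (simp add: lmeasurable_iff_integrable)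
      show "indicat_real C x \<le> u x" for x using u(2,3)[of x] by (cases "x \<in> C") auto
    qed
    also have "\<dots> \<le> (LINT x|lebesgue. \<bar>x $ j * partial_deriv j u x\<bar>)"
      using integral_norm_bound[of lebesgue "\<lambda>x. x $ j * partial_deriv j u x"]
      unfolding eq real_norm_def by linarith
    finally have "ennreal \<alpha> \<le> ennreal (LINT x|lebesgue. \<bar>x $ j * partial_deriv j u x\<bar>)"
      by (rule ennreal_leI)
    also have "\<dots> = (\<integral>\<^sup>+x. ennreal \<bar>x $ j * partial_deriv j u x\<bar> \<partial>lebesgue)"
      using ip by (intro nn_integral_eq_integral[symmetric]) auto
    also have "\<dots> \<le> (\<integral>\<^sup>+x. ennreal (R * \<epsilon>) * indicator A x + ennreal (R / \<epsilon> ^ (n - 1)) * (ennreal (norm (gradient u x) ^ n) * indicator A x) \<partial>lebesgue)"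
    proof (rule nn_integral_mono)
      fix x
      show "ennreal \<bar>x $ j * partial_deriv j u x\<bar> \<le> ennreal (R * \<epsilon>) * indicator A x + ennreal (R / \<epsilon> ^ (n - 1)) * (ennreal (norm (gradient u x) ^ n) * indicator A x)"
      proof (cases "x \<in> A")
        case True
        have "\<bar>x $ j\<bar> \<le> R" using R(2)[OF True] component_le_norm_cart[of x j] by linarith
        moreover have "\<bar>partial_deriv j u x\<bar> \<le> norm (gradient u x)"
          using component_le_norm_cart[of "gradient u x" j] by (simp add: gradient_def)
        ultimately have "\<bar>x $ j * partial_deriv j u x\<bar> \<le> R * norm (gradient u x)"
          using R(1) by (simp add: abs_mult mult_mono)
        also have "\<dots> \<le> R * (\<epsilon> + norm (gradient u x) ^ n / \<epsilon> ^ (n - 1))"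
          using R(1) by (intro mult_left_mono young) auto
        also have "\<dots> = R * \<epsilon> + R / \<epsilon> ^ (n - 1) * norm (gradient u x) ^ n" by (simp add: algebra_simps)
        finally have "ennreal \<bar>x $ j * partial_deriv j u x\<bar> \<le> ennreal (R * \<epsilon> + R / \<epsilon> ^ (n - 1) * norm (gradient u x) ^ n)"
          by (rule ennreal_leI)
        also have "\<dots> = ennreal (R * \<epsilon>) + ennreal (R / \<epsilon> ^ (n - 1)) * ennreal (norm (gradient u x) ^ n)"
          using R(1) \<epsilon> by (intro enn[symmetric]) auto
        finally show ?thesis using True by simp
      next
        case False
        then have "partial_deriv j u x = 0" using uD(5) by (intro uD(7)) auto
        then show ?thesis by simp
      qed
    qed
    also have "\<dots> = ennreal (R * \<epsilon>) * emeasure lebesgue A + ennreal (R / \<epsilon> ^ (n - 1)) * (\<integral>\<^sup>+x\<in>A. ennreal (norm (gradient u x) ^ n) \<partial>lebesgue)"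
    proof -
      have "(\<lambda>x. gradient u x) \<in> borel_measurable borel"
        unfolding gradient_def using uD(3)
        by (intro borel_measurable_continuous_onI) (auto intro!: continuous_intros simp: continuous_on_vec_lambda)
      then have "(\<lambda>x. ennreal (norm (gradient u x) ^ n)) \<in> borel_measurable lebesgue"
        by (intro measurable_completion) simp
      then show ?thesis
        using Am by (subst nn_integral_add) (auto simp: nn_integral_cmult fmeasurableD)
    qed
    also have "emeasure lebesgue A = ennreal \<beta>" using Am by (simp add: \<beta>_def emeasure_eq_measure2)
    finally have le: "ennreal \<alpha> \<le> ennreal (R * \<epsilon>) * ennreal \<beta> + ennreal (R / \<epsilon> ^ (n - 1)) * (\<integral>\<^sup>+x\<in>A. ennreal (norm (gradient u x) ^ n) \<partial>lebesgue)"
      (is "_ \<le> _ + _ * ?I") .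
    have "ennreal \<delta> \<le> ?I"
    proof (rule ccontr)
      assume "\<not> ennreal \<delta> \<le> ?I"
      then have "?I \<le> ennreal \<delta>" by simp
      then have "ennreal \<alpha> \<le> ennreal (R * \<epsilon>) * ennreal \<beta> + ennreal (R / \<epsilon> ^ (n - 1)) * ennreal \<delta>"
        using le by (meson add_left_mono mult_left_mono order_trans zero_le)
      also have "\<dots> = ennreal (R * \<epsilon> * \<beta> + R / \<epsilon> ^ (n - 1) * \<delta>)"
        using R(1) \<epsilon> \<beta> \<delta> by (subst enn[symmetric]) (auto simp: ennreal_mult)
      also have "R * \<epsilon> * \<beta> + R / \<epsilon> ^ (n - 1) * \<delta> \<le> \<alpha> / 4 + \<alpha> / 4"
        using \<epsilon>' R(1) \<epsilon> by (simp add: \<delta>_def)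
      finally have "ennreal \<alpha> \<le> ennreal (\<alpha> / 4 + \<alpha> / 4)" by (simp add: ennreal_leI)
      then show False using \<alpha> by simp
    qed
    then show "ennreal \<delta> \<le> (\<integral>\<^sup>+x\<in>A. ennreal (norm (gradient u x) ^ CARD('n)) \<partial>lebesgue)"
      by (simp add: n_def)
  qed
  then show ?thesis using \<delta> by (metis ennreal_less_zero_iff order_less_le_trans)
qed

text \<open>A unit ball far out lies in the complement, and its positive measure gives it positive
  capacity with respect to every admissible \<open>A\<close>.\<close>

lemma not_capacity_zero_Compl_bounded:
  fixes S :: "(real^'n::finite) set"
  assumes "bounded S"
  shows "\<not> capacity_zero (UNIV - S)"
proof
  assume cap: "capacity_zero (UNIV - S)"
  obtain R where R: "\<And>x. x \<in> S \<Longrightarrow> norm x \<le> R" "R > 0" using assms by (auto simp: bounded_pos)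
  define p :: "real^'n" where "p = (R + 2) *\<^sub>R axis undefined 1"
  have "cball p 1 \<subseteq> UNIV - S"
  proof
    fix x assume "x \<in> cball p 1"
    then have "norm x \<ge> norm p - 1" using norm_triangle_sub[of p x] by (simp add: dist_norm)
    moreover have "norm p = R + 2" using R(2) by (simp add: p_def)
    ultimately show "x \<in> UNIV - S" using R(1)[of x] by auto
  qed
  then have "compact_capacity_zero (cball p 1)" using cap by (auto simp: capacity_zero_def)
  moreover have "measure lebesgue (cball p 1) > 0" by (simp add: content_cball_pos)
  ultimately show False
    unfolding compact_capacity_zero_def using conformal_capacity_pos compact_cball by (metis less_irrefl)
qed

section \<open>A Zorich type map with one zero\<close>

text \<open>The triangle wave of period \<open>4\<close> with \<open>tri x = x\<close> on
  \<open>[- 1, 1]\<close>. Written as a distance it is Lipschitz with constant one without cases;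
  the affine branches are recovered in \<open>tri_cell\<close>.\<close>

definition tri :: "real \<Rightarrow> real" where
  "tri x = infdist x (range (\<lambda>k::int. 4 * of_int k - 1)) - 1"

definition cotri :: "real \<Rightarrow> real" where
  "cotri x = tri (x + 1)"

text \<open>The slope of \<open>tri\<close> on the cell centred at \<open>2 * j\<close>; on beams,
  products of such signs tell the side of the plane \<open>Y $ 2 = 0\<close>.\<close>

definition sg :: "int \<Rightarrow> real" where
  "sg j = (if even j then 1 else - 1)"

lemma sg_simps [simp]: "sg j * sg j = 1" "\<bar>sg j\<bar> = 1" "sg (j + 1) = - sg j" "sg (1 + j) = - sg j" "sg (j - 1) = - sg j"
  "sg 0 = 1" "sg (- 1) = - 1" "sg j * (sg j * r) = r"
  by (auto simp: sg_def)

lemma sg_cases: "sg j = 1 \<or> sg j = - 1" by (simp add: sg_def)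

lemma tri_lipschitz: "\<bar>tri x - tri y\<bar> \<le> \<bar>x - y\<bar>"
  using infdist_triangle_abs[of x _ y] by (simp add: tri_def dist_real_def)

lemma cotri_lipschitz: "\<bar>cotri x - cotri y\<bar> \<le> \<bar>x - y\<bar>"
  using tri_lipschitz[of "x + 1" "y + 1"] by (simp add: cotri_def)

lemma tri_cell:
  assumes "\<bar>x - 2 * of_int j\<bar> \<le> 1"
  shows "tri x = sg j * (x - 2 * of_int j)"
proof -
  let ?A = "range (\<lambda>k::int. 4 * real_of_int k - 1)"
  have lower: "r \<le> infdist x ?A" if "\<And>m::int. r \<le> \<bar>x - (4 * of_int m - 1)\<bar>" for r
    unfolding infdist_def using that by (auto intro!: cINF_greatest simp: dist_real_def)
  have upper: "infdist x ?A \<le> \<bar>x - (4 * of_int m - 1)\<bar>" for m :: int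
    using infdist_le[of "4 * of_int m - 1" ?A x] by (auto simp: dist_real_def)
  show ?thesis
  proof (cases "even j")
    case True
    then obtain k where k: "j = 2 * k" by (auto elim: evenE)
    have "x - 4 * of_int k + 1 \<le> \<bar>x - (4 * of_int m - 1)\<bar>" for m :: int
    proof (cases "m \<le> k")
      case True
      then have "real_of_int m \<le> of_int k" by simp
      then show ?thesis by linarith
    next
      case False
      then have "real_of_int m \<ge> of_int k + 1" by linarith
      then show ?thesis using assms k by (simp; linarith)
    qed
    then have "infdist x ?A = x - 4 * of_int k + 1"
      using lower upper[of k] assms k by (intro antisym) auto
    then show ?thesis using True k by (simp add: tri_def sg_def)
  next
    case False
    then obtain k where k: "j = 2 * k + 1" by (auto elim: oddE)
    have "4 * of_int k + 3 - x \<le> \<bar>x - (4 * of_int m - 1)\<bar>" for m :: int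
    proof (cases "m \<le> k")
      case True
      then have "real_of_int m \<le> of_int k" by simp
      then show ?thesis using assms k by (simp; linarith)
    next
      case False
      then have "real_of_int m \<ge> of_int k + 1" by linarith
      then show ?thesis by linarith
    qed
    then have "infdist x ?A = 4 * of_int k + 3 - x"
      using lower upper[of "k + 1"] assms k by (intro antisym) auto
    then show ?thesis using False k by (simp add: tri_def sg_def)
  qed
qed

lemma ex_cell: "\<exists>j::int. \<bar>(x::real) - 2 * of_int j\<bar> \<le> 1"
proof -
  define j where "j = \<lfloor>(x + 1) / 2\<rfloor>"
  have "of_int j \<le> (x + 1) / 2" "(x + 1) / 2 < of_int j + 1" unfolding j_def by linarith+
  then have "2 * real_of_int j \<le> x + 1" "x + 1 < 2 * real_of_int j + 2" by (simp_all add: field_simps)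
  then have "\<bar>x - 2 * real_of_int j\<bar> \<le> 1" by (simp add: abs_le_iff)
  then show ?thesis ..
qed

lemma cotri_cell:
  assumes "\<bar>x - 2 * of_int j\<bar> \<le> 1"
  shows "cotri x = sg j * (1 - \<bar>x - 2 * of_int j\<bar>)"
proof (cases "x \<ge> 2 * of_int j")
  case True
  then have "cotri x = sg (j + 1) * (x + 1 - 2 * of_int (j + 1))"
    unfolding cotri_def using assms by (intro tri_cell) auto
  then show ?thesis using True by (simp add: algebra_simps)
next
  case False
  then have "cotri x = sg j * (x + 1 - 2 * of_int j)"
    unfolding cotri_def using assms by (intro tri_cell) auto
  then show ?thesis using False by (simp add: algebra_simps)
qed

lemma tri_shifted_cell:
  assumes "\<bar>\<beta>\<bar> \<le> 1"
  shows "tri (2 * of_int k + 1 + \<beta>) = sg k * (1 - \<bar>\<beta>\<bar>)"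
    "cotri (2 * of_int k + 1 + \<beta>) = - sg k * \<beta>"
proof -
  have "cotri (2 * of_int k + \<beta>) = sg k * (1 - \<bar>2 * of_int k + \<beta> - 2 * of_int k\<bar>)"
    using assms by (intro cotri_cell) simp
  then show "tri (2 * of_int k + 1 + \<beta>) = sg k * (1 - \<bar>\<beta>\<bar>)" by (simp add: cotri_def algebra_simps)
  have "tri (2 * of_int k + 1 + \<beta> + 1) = sg (k + 1) * (2 * of_int k + 1 + \<beta> + 1 - 2 * of_int (k + 1))"
    using assms by (intro tri_cell) simp
  then show "cotri (2 * of_int k + 1 + \<beta>) = - sg k * \<beta>" by (simp add: cotri_def)
qed

lemma tri_abs_le_1: "\<bar>tri x\<bar> \<le> 1"
  using ex_cell[of x] by (auto simp: tri_cell abs_mult)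

lemma cotri_abs_le_1: "\<bar>cotri x\<bar> \<le> 1"
  unfolding cotri_def by (rule tri_abs_le_1)

lemma tri_small: "\<bar>x\<bar> \<le> 1 \<Longrightarrow> tri x = x"
  using tri_cell[of x 0] by simp

lemma tri_0 [simp]: "tri 0 = 0" by (simp add: tri_small)

lemma cotri_small: "- 2 \<le> x \<Longrightarrow> x \<le> 0 \<Longrightarrow> cotri x = 1 + x"
  using tri_small[of "x + 1"] by (simp add: cotri_def)

lemma cotri_minus: "cotri (- x) = cotri x"
proof -
  obtain j :: int where j: "\<bar>x - 2 * of_int j\<bar> \<le> 1" using ex_cell by blast
  have "cotri (- x) = sg (- j) * (1 - \<bar>- x - 2 * of_int (- j)\<bar>)"
    using j by (intro cotri_cell) auto
  then show ?thesis using cotri_cell[OF j] by (simp add: sg_def abs_minus_commute)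
qed

text \<open>The smaller absolute value with the product of the signs. This closed form shows that it
  is Lipschitz also across sign changes.\<close>

definition smin :: "real \<Rightarrow> real \<Rightarrow> real" where
  "smin x y = (\<bar>x + y\<bar> - \<bar>x - y\<bar>) / 2"

lemma smin_lipschitz: "\<bar>smin x y - smin x' y'\<bar> \<le> \<bar>x - x'\<bar> + \<bar>y - y'\<bar>"
proof -
  have "smin x y - smin x' y' = ((\<bar>x + y\<bar> - \<bar>x' + y'\<bar>) - (\<bar>x - y\<bar> - \<bar>x' - y'\<bar>)) / 2"
    by (simp add: smin_def field_simps)
  moreover have "\<bar>smin x y - smin x' y'\<bar> \<le> (\<bar>\<bar>x + y\<bar> - \<bar>x' + y'\<bar>\<bar> + \<bar>\<bar>x - y\<bar> - \<bar>x' - y'\<bar>\<bar>) / 2"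
    unfolding calculation abs_divide
    using abs_triangle_ineq4[of "\<bar>x + y\<bar> - \<bar>x' + y'\<bar>" "\<bar>x - y\<bar> - \<bar>x' - y'\<bar>"] by simp
  moreover have "\<bar>\<bar>x + y\<bar> - \<bar>x' + y'\<bar>\<bar> \<le> \<bar>x - x'\<bar> + \<bar>y - y'\<bar>" by linarith
  moreover have "\<bar>\<bar>x - y\<bar> - \<bar>x' - y'\<bar>\<bar> \<le> \<bar>x - x'\<bar> + \<bar>y - y'\<bar>" by linarith
  ultimately show ?thesis by argo
qed

lemma abs_smin: "\<bar>smin x y\<bar> = min \<bar>x\<bar> \<bar>y\<bar>"
  unfolding smin_def by (simp add: min_def abs_if)

lemma smin_0 [simp]: "smin x 0 = 0" by (simp add: smin_def)

lemma smin_sg: "x \<ge> 0 \<Longrightarrow> y \<ge> 0 \<Longrightarrow> smin (sg j * x) (sg k * y) = sg j * sg k * min x y"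
  using sg_cases[of j] sg_cases[of k] by (auto simp: smin_def min_def)

text \<open>For \<open>r \<ge> 0\<close> the projection of \<open>s\<close> to
  \<open>[- r, r]\<close>. The remainder \<open>s - clamp_abs r s\<close> collapses that interval to
  a point: this closes up the inserted piece before the Zorich map is applied.\<close>

definition clamp_abs :: "real \<Rightarrow> real \<Rightarrow> real" where
  "clamp_abs r s = max (- r) (min s r)"

lemma clamp_abs_lipschitz: "\<bar>clamp_abs r s - clamp_abs r' s'\<bar> \<le> \<bar>r - r'\<bar> + \<bar>s - s'\<bar>"
  unfolding clamp_abs_def by (simp add: min_def max_def abs_if)

lemma abs_clamp_abs_le: "r \<ge> 0 \<Longrightarrow> \<bar>clamp_abs r s\<bar> \<le> r"
  unfolding clamp_abs_def by auto

lemma clamp_abs_small: "\<bar>s\<bar> \<le> r \<Longrightarrow> clamp_abs r s = s"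
  unfolding clamp_abs_def by auto

lemma clamp_abs_0 [simp]: "clamp_abs 0 s = 0"
  unfolding clamp_abs_def by auto

text \<open>
  The slit lies in the plane \<open>x $ 2 = 0\<close>, over \<open>2 * \<bar>x $ 1\<bar> \<le> 2 - exp (- x $ 3)\<close>. The inserted
  copy of the space is \<open>\<bar>x $ 2\<bar> \<le> slit_width x\<close>, and the beams on either side are pushed apart by
  \<open>slit_width x\<close>.
\<close>
definition slit_width :: "real^3 \<Rightarrow> real" where
  "slit_width x = max 0 (2 - exp (- x $ 3) - 2 * \<bar>x $ 1\<bar>)"

text \<open>Of the two terms of the second coordinate, the first vanishes outside the inserted piece
  and the second vanishes on it, so one formula serves both regions and is visibly
  continuous.\<close>

definition zdir :: "real^3 \<Rightarrow> real^3" where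
  "zdir x = vector [tri (x $ 1),
     clamp_abs (max 0 (slit_width x - \<bar>x $ 2\<bar>)) (x $ 2)
       - smin (cotri (x $ 1)) (tri (x $ 2 - clamp_abs (slit_width x) (x $ 2))),
     - cotri (\<bar>x $ 2\<bar> - slit_width x)]"

definition zmap :: "real^3 \<Rightarrow> real^3" where
  "zmap x = exp (x $ 3) *\<^sub>R zdir x"

lemma slit_width_bounds: "0 \<le> slit_width x" "slit_width x \<le> 2"
  by (auto simp: slit_width_def intro: order_trans[of _ 0])

lemma norm_le_l1_3: "norm (x :: real^3) \<le> \<bar>x $ 1\<bar> + \<bar>x $ 2\<bar> + \<bar>x $ 3\<bar>"
  using norm_le_l1_cart[of x] by (simp add: sum_3)

text \<open>The exponential is not Lipschitz towards low heights, but the width is zero as soon as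
  \<open>exp (- x $ 3) \<ge> 2\<close>. Hence the exponential may be capped at \<open>2\<close>, and
  so may its slope.\<close>

lemma slit_width_lipschitz: "\<bar>slit_width x - slit_width y\<bar> \<le> 2 * \<bar>x $ 1 - y $ 1\<bar> + 2 * \<bar>x $ 3 - y $ 3\<bar>"
proof -
  have aux: "min 2 (exp (- s)) - min 2 (exp (- t)) \<le> 2 * (t - s)" if "s \<le> t" for s t :: real
  proof -
    have *: "exp (- u) - exp (- t) \<le> 2 * (t - u)" if "exp (- u) \<le> 2" "u \<le> t" for u
    proof -
      have "exp (- u) - exp (- t) = exp (- u) * (1 - exp (u - t))" by (simp add: algebra_simps flip: exp_add)
      also have "1 - exp (u - t) \<le> t - u" using exp_ge_add_one_self[of "u - t"] by linarith
      then have "exp (- u) * (1 - exp (u - t)) \<le> exp (- u) * (t - u)" by (intro mult_left_mono) auto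
      also have "\<dots> \<le> 2 * (t - u)" using that by (intro mult_right_mono) auto
      finally show ?thesis .
    qed
    show ?thesis
    proof (cases "exp (- s) \<le> 2")
      case True
      moreover have "exp (- t) \<le> exp (- s)" using that by simp
      ultimately show ?thesis using *[OF True that] by simp
    next
      case s: False
      show ?thesis
      proof (cases "exp (- t) \<le> 2")
        case True
        have "ln 2 < - s" using s by (simp add: not_le ln_less_cancel_iff[symmetric] del: ln_less_cancel_iff)
        moreover have "- t \<le> ln 2" using True by (simp add: ln_ge_iff)
        ultimately show ?thesis using *[of "- ln 2"] True s by simp
      next
        case False
        then show ?thesis using s that by simp
      qed
    qed
  qed
  have m: "\<bar>min 2 (exp (- s)) - min 2 (exp (- t))\<bar> \<le> 2 * \<bar>s - t\<bar>" for s t :: real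
  proof -
    have *: "\<bar>min 2 (exp (- s)) - min 2 (exp (- t))\<bar> \<le> 2 * \<bar>s - t\<bar>" if "s \<le> t" for s t :: real
    proof -
      have "min 2 (exp (- t)) \<le> min 2 (exp (- s))" using that by (intro min.mono) auto
      then have "\<bar>min 2 (exp (- s)) - min 2 (exp (- t))\<bar> = min 2 (exp (- s)) - min 2 (exp (- t))" by simp
      moreover have "\<bar>s - t\<bar> = t - s" using that by simp
      ultimately show ?thesis using aux[OF that] by argo
    qed
    show ?thesis using *[of s t] *[of t s] by (cases "s \<le> t") (simp_all add: abs_minus_commute)
  qed
  have eq: "slit_width x = max 0 (2 - min 2 (exp (- x $ 3)) - 2 * \<bar>x $ 1\<bar>)" for x
    by (auto simp: slit_width_def)
  have mx: "\<bar>max 0 (2 - p - 2 * a) - max 0 (2 - q - 2 * b)\<bar> \<le> \<bar>p - q\<bar> + 2 * \<bar>a - b\<bar>" for p q a b :: real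
    by (simp add: max_def abs_if)
  have "\<bar>slit_width x - slit_width y\<bar> \<le> \<bar>min 2 (exp (- x $ 3)) - min 2 (exp (- y $ 3))\<bar> + 2 * \<bar>\<bar>x $ 1\<bar> - \<bar>y $ 1\<bar>\<bar>"
    unfolding eq by (rule mx)
  moreover have "\<bar>\<bar>x $ 1\<bar> - \<bar>y $ 1\<bar>\<bar> \<le> \<bar>x $ 1 - y $ 1\<bar>" by (rule abs_triangle_ineq3)
  ultimately show ?thesis using m[of "x $ 3" "y $ 3"] by argo
qed

lemma zdir_nth: "zdir x $ 1 = tri (x $ 1)"
  "zdir x $ 2 = clamp_abs (max 0 (slit_width x - \<bar>x $ 2\<bar>)) (x $ 2)
       - smin (cotri (x $ 1)) (tri (x $ 2 - clamp_abs (slit_width x) (x $ 2)))"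
  "zdir x $ 3 = - cotri (\<bar>x $ 2\<bar> - slit_width x)"
  by (simp_all add: zdir_def)

lemma norm_zdir: "norm (zdir x) \<le> 5"
proof -
  define p where "p = clamp_abs (max 0 (slit_width x - \<bar>x $ 2\<bar>)) (x $ 2)"
  define q where "q = smin (cotri (x $ 1)) (tri (x $ 2 - clamp_abs (slit_width x) (x $ 2)))"
  have "\<bar>p\<bar> \<le> max 0 (slit_width x - \<bar>x $ 2\<bar>)" unfolding p_def by (rule abs_clamp_abs_le) simp
  also have "\<dots> \<le> 2" using slit_width_bounds[of x] by simp
  finally have "\<bar>p\<bar> \<le> 2" .
  moreover have "\<bar>q\<bar> \<le> 1"
    unfolding q_def abs_smin using cotri_abs_le_1 by (simp add: min_le_iff_disj)
  moreover have "\<bar>p - q\<bar> \<le> \<bar>p\<bar> + \<bar>q\<bar>" by (rule abs_triangle_ineq4)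
  ultimately have "\<bar>zdir x $ 2\<bar> \<le> 3" unfolding zdir_nth(2) p_def[symmetric] q_def[symmetric] by argo
  moreover have "\<bar>zdir x $ 1\<bar> \<le> 1" "\<bar>zdir x $ 3\<bar> \<le> 1"
    using tri_abs_le_1 cotri_abs_le_1 by (simp_all add: zdir_nth)
  ultimately show ?thesis using norm_le_l1_3[of "zdir x"] by argo
qed

lemma norm_zmap: "norm (zmap x) \<le> 5 * exp (x $ 3)"
  unfolding zmap_def using norm_zdir[of x] by simp

lemma zdir_lipschitz: "norm (zdir x - zdir y) \<le> 19 * norm (x - y)"
proof -
  let ?d = "norm (x - y)"
  have d: "\<bar>x $ i - y $ i\<bar> \<le> ?d" for i using component_le_norm_cart[of "x - y" i] by simp
  have w: "\<bar>slit_width x - slit_width y\<bar> \<le> 4 * ?d"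
    using slit_width_lipschitz[of x y] d[of 1] d[of 3] by argo
  have a: "\<bar>\<bar>x $ 2\<bar> - \<bar>y $ 2\<bar>\<bar> \<le> ?d" using abs_triangle_ineq3 d[of 2] by (rule order_trans)
  have diff: "\<bar>(a - b) - (a' - b')\<bar> \<le> \<bar>a - a'\<bar> + \<bar>b - b'\<bar>" for a b a' b' :: real
    by (simp add: abs_if)
  have n0: "\<bar>(slit_width x - \<bar>x $ 2\<bar>) - (slit_width y - \<bar>y $ 2\<bar>)\<bar> \<le> 5 * ?d"
    using diff[of "slit_width x" "\<bar>x $ 2\<bar>" "slit_width y" "\<bar>y $ 2\<bar>"] w a by argo
  have "\<bar>max 0 p - max 0 q\<bar> \<le> \<bar>p - q\<bar>" for p q :: real by (simp add: max_def)
  from order_trans[OF this n0]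
  have n: "\<bar>max 0 (slit_width x - \<bar>x $ 2\<bar>) - max 0 (slit_width y - \<bar>y $ 2\<bar>)\<bar> \<le> 5 * ?d" .
  have c1: "\<bar>clamp_abs (max 0 (slit_width x - \<bar>x $ 2\<bar>)) (x $ 2) - clamp_abs (max 0 (slit_width y - \<bar>y $ 2\<bar>)) (y $ 2)\<bar> \<le> 6 * ?d"
    using clamp_abs_lipschitz[of "max 0 (slit_width x - \<bar>x $ 2\<bar>)" "x $ 2" "max 0 (slit_width y - \<bar>y $ 2\<bar>)" "y $ 2"]
      n d[of 2] by argo
  have c2: "\<bar>clamp_abs (slit_width x) (x $ 2) - clamp_abs (slit_width y) (y $ 2)\<bar> \<le> 5 * ?d"
    using clamp_abs_lipschitz[of "slit_width x" "x $ 2" "slit_width y" "y $ 2"] w d[of 2] by argo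
  have t: "\<bar>tri (x $ 2 - clamp_abs (slit_width x) (x $ 2)) - tri (y $ 2 - clamp_abs (slit_width y) (y $ 2))\<bar> \<le> 6 * ?d"
    using tri_lipschitz[of "x $ 2 - clamp_abs (slit_width x) (x $ 2)" "y $ 2 - clamp_abs (slit_width y) (y $ 2)"]
      diff[of "x $ 2" "clamp_abs (slit_width x) (x $ 2)" "y $ 2" "clamp_abs (slit_width y) (y $ 2)"] c2 d[of 2] by argo
  have s: "\<bar>smin (cotri (x $ 1)) (tri (x $ 2 - clamp_abs (slit_width x) (x $ 2)))
      - smin (cotri (y $ 1)) (tri (y $ 2 - clamp_abs (slit_width y) (y $ 2)))\<bar> \<le> 7 * ?d"
    using smin_lipschitz[of "cotri (x $ 1)" "tri (x $ 2 - clamp_abs (slit_width x) (x $ 2))" "cotri (y $ 1)" "tri (y $ 2 - clamp_abs (slit_width y) (y $ 2))"]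
      cotri_lipschitz[of "x $ 1" "y $ 1"] t d[of 1] by argo
  have "\<bar>(zdir x - zdir y) $ 1\<bar> \<le> ?d"
    using order_trans[OF tri_lipschitz d[of 1]] by (simp add: zdir_nth)
  moreover have "\<bar>(zdir x - zdir y) $ 2\<bar> \<le> 13 * ?d"
    unfolding vector_minus_component zdir_nth(2) by (rule order_trans[OF diff]) (use c1 s in argo)
  moreover have "\<bar>(zdir x - zdir y) $ 3\<bar> \<le> 5 * ?d"
  proof -
    have "\<bar>(zdir x - zdir y) $ 3\<bar> = \<bar>cotri (\<bar>x $ 2\<bar> - slit_width x) - cotri (\<bar>y $ 2\<bar> - slit_width y)\<bar>"
      by (simp add: zdir_nth abs_minus_commute)
    also have "\<dots> \<le> \<bar>(\<bar>x $ 2\<bar> - slit_width x) - (\<bar>y $ 2\<bar> - slit_width y)\<bar>" by (rule cotri_lipschitz)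
    also have "\<dots> \<le> 5 * ?d" using n0 by (simp add: abs_minus_commute algebra_simps)
    finally show ?thesis .
  qed
  ultimately show ?thesis using norm_le_l1_3[of "zdir x - zdir y"] by argo
qed

lemma abs_exp_minus_1: "\<bar>u\<bar> \<le> 1 \<Longrightarrow> \<bar>exp u - 1\<bar> \<le> 2 * \<bar>u :: real\<bar>"
proof (cases "u \<ge> 0")
  case True
  assume "\<bar>u\<bar> \<le> 1"
  then have "exp u \<le> 1 + u + u\<^sup>2" using True by (intro exp_bound) auto
  also have "u\<^sup>2 \<le> u" using True \<open>\<bar>u\<bar> \<le> 1\<close> by (simp add: power2_eq_square mult_left_le)
  finally show ?thesis using True by simp
next
  case False
  then show ?thesis using exp_ge_add_one_self[of u] by (simp add: abs_if; linarith)
qed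

lemma zmap_lipschitz:
  assumes "norm (x - y) \<le> 1"
  shows "norm (zmap x - zmap y) \<le> 30 * exp (x $ 3) * norm (x - y)"
proof -
  let ?d = "norm (x - y)"
  have d: "\<bar>y $ 3 - x $ 3\<bar> \<le> ?d" using component_le_norm_cart[of "x - y" 3] by (simp add: abs_minus_commute)
  have "exp (y $ 3) - exp (x $ 3) = exp (x $ 3) * (exp (y $ 3 - x $ 3) - 1)" by (simp add: exp_diff field_simps)
  then have "\<bar>exp (y $ 3) - exp (x $ 3)\<bar> = exp (x $ 3) * \<bar>exp (y $ 3 - x $ 3) - 1\<bar>" by (simp add: abs_mult)
  also have "\<dots> \<le> exp (x $ 3) * (2 * ?d)"
    using abs_exp_minus_1[of "y $ 3 - x $ 3"] d assms by (intro mult_left_mono) auto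
  finally have e: "\<bar>exp (x $ 3) - exp (y $ 3)\<bar> \<le> exp (x $ 3) * (2 * ?d)" by (simp add: abs_minus_commute)
  have "zmap x - zmap y = exp (x $ 3) *\<^sub>R (zdir x - zdir y) + (exp (x $ 3) - exp (y $ 3)) *\<^sub>R zdir y"
    by (simp add: zmap_def algebra_simps)
  then have "norm (zmap x - zmap y) \<le> norm (exp (x $ 3) *\<^sub>R (zdir x - zdir y)) + norm ((exp (x $ 3) - exp (y $ 3)) *\<^sub>R zdir y)"
    by (simp only: norm_triangle_ineq)
  also have "\<dots> \<le> exp (x $ 3) * (19 * ?d) + (exp (x $ 3) * (2 * ?d)) * 5"
    unfolding norm_scaleR using e norm_zdir[of y] zdir_lipschitz[of x y]
    by (intro add_mono mult_mono) auto
  also have "\<dots> \<le> 30 * exp (x $ 3) * ?d" by simp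
  finally show ?thesis .
qed

text \<open>
  \<open>outer_pt j k\<close> parametrizes the beam with cell \<open>(j, k)\<close> and \<open>inner_pt \<sigma>\<close>, for \<open>\<sigma> = 1\<close> and
  \<open>\<sigma> = - 1\<close>, the two halves of the inserted piece. Each of these is mapped onto a half space
  \<open>0 \<le> \<sigma> * Y $ 2\<close>, with an explicit inverse.
\<close>
definition outer_pt :: "int \<Rightarrow> int \<Rightarrow> real \<Rightarrow> real \<Rightarrow> real \<Rightarrow> real^3" where
  "outer_pt j k \<alpha> \<beta> t = vector [2 * of_int j + \<alpha>,
     2 * of_int k + 1 + \<beta> + (if k \<ge> 0 then 1 else - 1) * max 0 (2 - exp (- t) - 2 * \<bar>2 * of_int j + \<alpha>\<bar>), t]"

definition inner_pt :: "real \<Rightarrow> real \<Rightarrow> real \<Rightarrow> real \<Rightarrow> real^3" where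
  "inner_pt \<sigma> a q t = vector [a, \<sigma> * q, t]"

lemma outer_pt_nth: "outer_pt j k \<alpha> \<beta> t $ 1 = 2 * of_int j + \<alpha>" "outer_pt j k \<alpha> \<beta> t $ 3 = t"
  "outer_pt j k \<alpha> \<beta> t $ 2 = 2 * of_int k + 1 + \<beta> + (if k \<ge> 0 then 1 else - 1) * slit_width (outer_pt j k \<alpha> \<beta> t)"
  by (simp_all add: outer_pt_def slit_width_def)

lemma vec3_eqI: "x $ 1 = y $ 1 \<Longrightarrow> x $ 2 = y $ 2 \<Longrightarrow> x $ 3 = y $ 3 \<Longrightarrow> x = (y :: 'a ^ 3)"
  by (simp add: vec_eq_iff forall_3)

lemma zmap_nth: "zmap x $ i = exp (x $ 3) * zdir x $ i"
  by (simp add: zmap_def)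

text \<open>The shift built into \<open>outer_pt\<close> is what \<open>clamp_abs\<close> undoes, so
  a displaced beam behaves as in the Zorich map: the square of all
  \<open>(\<alpha>, \<beta>)\<close> is raised to a pyramid of height
  \<open>1 - max \<bar>\<alpha>\<bar> \<bar>\<beta>\<bar>\<close>, and the parity of the cell
  decides on which side of the plane.\<close>

lemma zmap_outer:
  assumes "\<bar>\<alpha>\<bar> \<le> 1" "\<bar>\<beta>\<bar> \<le> 1"
  shows "zmap (outer_pt j k \<alpha> \<beta> t) =
    exp t *\<^sub>R vector [sg j * \<alpha>, - sg j * sg k * (1 - max \<bar>\<alpha>\<bar> \<bar>\<beta>\<bar>), sg k * \<beta>]"
proof -
  define x where "x = outer_pt j k \<alpha> \<beta> t"
  define c where "c = slit_width x"
  define s where "s = 2 * real_of_int k + 1 + \<beta>"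
  have c: "c \<ge> 0" by (simp add: c_def slit_width_bounds)
  have x: "x $ 1 = 2 * of_int j + \<alpha>" "x $ 3 = t" "x $ 2 = s + (if k \<ge> 0 then 1 else - 1) * c"
    by (simp_all add: x_def c_def s_def outer_pt_nth)
  have ts: "tri s = sg k * (1 - \<bar>\<beta>\<bar>)" "cotri s = - sg k * \<beta>"
    unfolding s_def using assms by (intro tri_shifted_cell; simp)+
  have ta: "tri (x $ 1) = sg j * \<alpha>" "cotri (x $ 1) = sg j * (1 - \<bar>\<alpha>\<bar>)"
    using tri_cell[of "x $ 1" j] cotri_cell[of "x $ 1" j] assms by (simp_all add: x)
  have sm: "smin (sg j * (1 - \<bar>\<alpha>\<bar>)) (sg k * (1 - \<bar>\<beta>\<bar>)) = sg j * sg k * (1 - max \<bar>\<alpha>\<bar> \<bar>\<beta>\<bar>)"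
    using assms by (subst smin_sg) auto
  have *: "zdir x $ 2 = - smin (cotri (x $ 1)) (tri s)" "zdir x $ 3 = - cotri s"
  proof -
    have "clamp_abs (max 0 (c - \<bar>x $ 2\<bar>)) (x $ 2) = 0 \<and> x $ 2 - clamp_abs c (x $ 2) = s \<and> cotri (\<bar>x $ 2\<bar> - c) = cotri s"
    proof (cases "k \<ge> 0")
      case True
      then have "s \<ge> 0" using assms by (simp add: s_def)
      then show ?thesis using True c by (simp add: x(3) clamp_abs_def)
    next
      case False
      then have "real_of_int k \<le> - 1" by simp
      then have "s \<le> 0" using assms unfolding s_def by linarith
      then show ?thesis using False c cotri_minus[of s] by (simp add: x(3) clamp_abs_def)
    qed
    then show "zdir x $ 2 = - smin (cotri (x $ 1)) (tri s)" "zdir x $ 3 = - cotri s"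
      by (simp_all add: zdir_nth c_def)
  qed
  have zd: "zdir x $ 1 = sg j * \<alpha>" "zdir x $ 2 = - (sg j * sg k * (1 - max \<bar>\<alpha>\<bar> \<bar>\<beta>\<bar>))" "zdir x $ 3 = sg k * \<beta>"
    using * ta ts sm by (simp_all add: zdir_nth(1))
  show ?thesis
    unfolding x_def[symmetric]
    by (rule vec3_eqI) (simp_all add: zmap_nth x(2) zd)
qed

text \<open>Let \<open>c\<close> be the slit width. At \<open>q = 0\<close> the image is in the
  plane \<open>Y $ 2 = 0\<close>, off the interior of the wedge, and the two halves join there. At
  \<open>q = c\<close> the third coordinate is \<open>- exp t\<close>, as for the Zorich map on the
  slit face, so the piece closes up with the adjacent beams. The \<open>min\<close> makes the second
  coordinate vanish at both ends.\<close>

lemma zmap_inner: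
  assumes \<sigma>: "\<sigma> = 1 \<or> \<sigma> = - 1" and q: "0 \<le> q" "q \<le> 2 - exp (- t) - 2 * \<bar>a\<bar>"
  shows "zmap (inner_pt \<sigma> a q t) = vector [exp t * a,
     \<sigma> * (exp t * min q (2 - exp (- t) - 2 * \<bar>a\<bar> - q)), exp t * (1 - q - 2 * \<bar>a\<bar>) - 1]"
proof -
  define c where "c = 2 - exp (- t) - 2 * \<bar>a\<bar>"
  define x where "x = inner_pt \<sigma> a q t"
  have x: "x $ 1 = a" "x $ 2 = \<sigma> * q" "x $ 3 = t" by (simp_all add: x_def inner_pt_def)
  have qc: "0 \<le> c" "q \<le> c" using q by (simp_all add: c_def)
  have sw: "slit_width x = c" using qc(1) by (simp add: slit_width_def x c_def max_def)
  then have "c \<le> 2" using slit_width_bounds(2)[of x] by simp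
  with sw qc have c: "slit_width x = c" "c \<le> 2" "0 \<le> c" "q \<le> c" by simp_all
  have a: "\<bar>a\<bar> \<le> 1" using q exp_gt_zero[of "- t"] by linarith
  have s: "\<bar>\<sigma> * q\<bar> = q" using \<sigma> q by auto
  have 1: "clamp_abs (max 0 (c - q)) (\<sigma> * q) = \<sigma> * min q (c - q)"
    using \<sigma> q c by (auto simp: clamp_abs_def min_def max_def)
  then have c1: "clamp_abs (c - q) (\<sigma> * q) = \<sigma> * min q (c - q)" using qc by simp
  have 2: "clamp_abs c (\<sigma> * q) = \<sigma> * q" using s c by (intro clamp_abs_small) simp
  have 3: "cotri (q - c) = 1 + (q - c)" using q c by (intro cotri_small) auto
  have e: "exp t * exp (- t) = 1" by (simp add: exp_minus)
  have "exp t * (c - 1 - q) = exp t * (1 - q - 2 * \<bar>a\<bar>) - exp t * exp (- t)" by (simp add: c_def algebra_simps)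
  then have z3: "exp t * (c - 1 - q) = exp t * (1 - q - 2 * \<bar>a\<bar>) - 1" by (simp only: e)
  show ?thesis
    unfolding x_def[symmetric] c_def[symmetric]
  proof (rule vec3_eqI)
    show "zmap x $ 3 = (vector [exp t * a, \<sigma> * (exp t * min q (c - q)), exp t * (1 - q - 2 * \<bar>a\<bar>) - 1] :: real^3) $ 3"
      using z3 by (simp add: zmap_nth zdir_nth x c s 3 algebra_simps)
  qed (simp_all add: zmap_nth zdir_nth x c s 1 c1 2 tri_small[OF a])
qed

section \<open>Explicit inverses of the pieces and their stability\<close>

text \<open>The error is split as \<open>(p - P) / E + (P / N) * ((N - E) / E)\<close>. Because
  \<open>P / N\<close> is bounded by \<open>B\<close>, only \<open>E\<close> appears in the
  resulting denominator.\<close>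

lemma quotient_diff_bound:
  fixes E N P p :: real
  assumes "E > 0" "N > 0" "\<bar>P\<bar> \<le> B * N" "\<bar>P - p\<bar> \<le> d" "\<bar>N - E\<bar> \<le> e"
  shows "\<bar>p / E - P / N\<bar> \<le> (d + B * e) / E"
proof -
  have B: "B \<ge> 0" using assms(2,3) by (metis abs_ge_zero order_trans zero_le_mult_iff linorder_not_le)
  have "p / E - P / N = (p - P) / E + (P / N) * ((N - E) / E)"
    using assms(1,2) by (simp add: field_simps)
  also have "\<bar>\<dots>\<bar> \<le> \<bar>(p - P) / E\<bar> + \<bar>(P / N) * ((N - E) / E)\<bar>" by (rule abs_triangle_ineq)
  also have "\<dots> = \<bar>P - p\<bar> / E + (\<bar>P\<bar> / N) * (\<bar>N - E\<bar> / E)"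
    using assms(1,2) by (simp add: abs_mult abs_minus_commute)
  also have "\<dots> \<le> d / E + B * (e / E)"
    using assms B by (intro add_mono mult_mono divide_right_mono) (auto simp: pos_divide_le_eq)
  finally show ?thesis by (simp add: add_divide_distrib)
qed

lemma ln_diff_bound:
  fixes E N :: real
  assumes "E > 0" "\<bar>N - E\<bar> \<le> e" "e \<le> E / 2"
  shows "\<bar>ln E - ln N\<bar> \<le> 2 * e / E" "N > 0"
proof -
  have N2: "N \<ge> E / 2" using assms by linarith
  then show N: "N > 0" using assms(1) by linarith
  have "ln N - ln E \<le> (N - E) / E" using ln_diff_le[OF N assms(1)] .
  also have "\<dots> \<le> e / E" using assms by (intro divide_right_mono) auto
  finally have 1: "ln N - ln E \<le> e / E" .
  have e0: "0 \<le> e" using assms(2) by linarith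
  have "ln E - ln N \<le> (E - N) / N" using ln_diff_le[OF assms(1) N] .
  also have "\<dots> \<le> e / N" using assms N by (intro divide_right_mono) auto
  also have "\<dots> \<le> e / (E / 2)" using N2 assms(1) e0 by (intro divide_left_mono) auto
  finally have 2: "ln E - ln N \<le> 2 * e / E" by (simp add: mult.commute)
  have "e / E \<le> 2 * e / E" using e0 assms(1) by (intro divide_right_mono) auto
  then show "\<bar>ln E - ln N\<bar> \<le> 2 * e / E" using 1 2 by linarith
qed

text \<open>The gauge whose unit sphere is the double pyramid onto which the Zorich map folds the
  plane of cells; on a beam it recovers \<open>exp t\<close>.\<close>

definition znorm :: "real^3 \<Rightarrow> real" where
  "znorm Y = \<bar>Y $ 2\<bar> + max \<bar>Y $ 1\<bar> \<bar>Y $ 3\<bar>"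

lemma znorm_pos: "Y \<noteq> 0 \<Longrightarrow> znorm Y > 0"
proof -
  assume "Y \<noteq> 0"
  then obtain i where "Y $ i \<noteq> 0" by (auto simp: vec_eq_iff)
  then show ?thesis unfolding znorm_def using exhaust_3[of i] by (auto simp: less_max_iff_disj add_nonneg_pos add_pos_nonneg)
qed

lemma zmap_outer_ln:
  assumes Y: "znorm Y > 0" and sgn: "0 \<le> - sg j * sg k * Y $ 2"
  shows "zmap (outer_pt j k (sg j * Y $ 1 / znorm Y) (sg k * Y $ 3 / znorm Y) (ln (znorm Y))) = Y"
    "\<bar>sg j * Y $ 1 / znorm Y\<bar> \<le> 1" "\<bar>sg k * Y $ 3 / znorm Y\<bar> \<le> 1"
proof -
  let ?N = "znorm Y"
  show a: "\<bar>sg j * Y $ 1 / ?N\<bar> \<le> 1" "\<bar>sg k * Y $ 3 / ?N\<bar> \<le> 1"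
    using Y by (simp_all add: abs_mult pos_divide_le_eq) (simp_all add: znorm_def)
  define m where "m = max \<bar>sg j * Y $ 1 / ?N\<bar> \<bar>sg k * Y $ 3 / ?N\<bar>"
  have "m = max \<bar>Y $ 1\<bar> \<bar>Y $ 3\<bar> / ?N"
    using Y unfolding m_def by (simp add: abs_mult max_divide_distrib_right)
  then have "?N * (1 - m) = ?N - max \<bar>Y $ 1\<bar> \<bar>Y $ 3\<bar>"
    using Y by (simp add: right_diff_distrib)
  also have "\<dots> = \<bar>Y $ 2\<bar>" unfolding znorm_def by simp
  finally have m: "?N * (1 - m) = \<bar>Y $ 2\<bar>" .
  have s: "- sg j * sg k * \<bar>Y $ 2\<bar> = Y $ 2"
    using sgn sg_cases[of j] sg_cases[of k] by auto
  have z: "zmap (outer_pt j k (sg j * Y $ 1 / ?N) (sg k * Y $ 3 / ?N) (ln ?N))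
      = ?N *\<^sub>R vector [sg j * (sg j * Y $ 1 / ?N), - sg j * sg k * (1 - m), sg k * (sg k * Y $ 3 / ?N)]"
    using Y unfolding zmap_outer[OF a] m_def by simp
  have "?N * (- sg j * sg k * (1 - m)) = - sg j * sg k * (?N * (1 - m))" by (simp only: mult.left_commute)
  then have "?N * (- sg j * sg k * (1 - m)) = Y $ 2" unfolding m s .
  then show "zmap (outer_pt j k (sg j * Y $ 1 / ?N) (sg k * Y $ 3 / ?N) (ln ?N)) = Y"
    unfolding z by (intro vec3_eqI) (use Y in simp_all)
qed

lemma znorm_zmap_outer:
  assumes "\<bar>\<alpha>\<bar> \<le> 1" "\<bar>\<beta>\<bar> \<le> 1"
  shows "znorm (zmap (outer_pt j k \<alpha> \<beta> t)) = exp t"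
proof -
  have m: "max (exp t * \<bar>\<alpha>\<bar>) (exp t * \<bar>\<beta>\<bar>) = exp t * max \<bar>\<alpha>\<bar> \<bar>\<beta>\<bar>" by (simp add: max_def)
  have "1 - max \<bar>\<alpha>\<bar> \<bar>\<beta>\<bar> \<ge> 0" using assms by simp
  then have "\<bar>exp t * (- sg j * sg k * (1 - max \<bar>\<alpha>\<bar> \<bar>\<beta>\<bar>))\<bar> = exp t * (1 - max \<bar>\<alpha>\<bar> \<bar>\<beta>\<bar>)"
    by (simp add: abs_mult)
  then show ?thesis
    by (simp add: znorm_def zmap_outer[OF assms] abs_mult m del: max_mult_distrib_left) (simp add: algebra_simps)
qed

lemma max_lipschitz: "\<bar>p - p'\<bar> \<le> d \<Longrightarrow> \<bar>q - q'\<bar> \<le> d \<Longrightarrow> \<bar>max p q - max p' q'\<bar> \<le> (d::real)"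
  by (simp add: max_def abs_if split: if_splits)

lemma znorm_diff: "\<bar>znorm Y - znorm y\<bar> \<le> 2 * norm (Y - y)"
proof -
  have "\<bar>Y $ i - y $ i\<bar> \<le> norm (Y - y)" for i using component_le_norm_cart[of "Y - y" i] by simp
  note d = this[of 1] this[of 2] this[of 3]
  have 2: "\<bar>max \<bar>Y $ 1\<bar> \<bar>Y $ 3\<bar> - max \<bar>y $ 1\<bar> \<bar>y $ 3\<bar>\<bar> \<le> norm (Y - y)"
    by (intro max_lipschitz order_trans[OF abs_triangle_ineq3] d)
  have 3: "\<bar>\<bar>Y $ 2\<bar> - \<bar>y $ 2\<bar>\<bar> \<le> norm (Y - y)" by (intro order_trans[OF abs_triangle_ineq3] d)
  have "\<bar>(a + b) - (c + e)\<bar> \<le> \<bar>a - c\<bar> + \<bar>b - e\<bar>" for a b c e :: real by (simp add: abs_if)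
  from this[of "\<bar>Y $ 2\<bar>" "max \<bar>Y $ 1\<bar> \<bar>Y $ 3\<bar>" "\<bar>y $ 2\<bar>" "max \<bar>y $ 1\<bar> \<bar>y $ 3\<bar>"]
  show ?thesis unfolding znorm_def using 2 3 by argo
qed

lemma outer_pt_lipschitz:
  "norm (outer_pt j k \<alpha> \<beta> t - outer_pt j k \<alpha>' \<beta>' t') \<le> 3 * \<bar>\<alpha> - \<alpha>'\<bar> + \<bar>\<beta> - \<beta>'\<bar> + 3 * \<bar>t - t'\<bar>"
proof -
  let ?x = "outer_pt j k \<alpha> \<beta> t" and ?y = "outer_pt j k \<alpha>' \<beta>' t'"
  have w: "\<bar>slit_width ?x - slit_width ?y\<bar> \<le> 2 * \<bar>\<alpha> - \<alpha>'\<bar> + 2 * \<bar>t - t'\<bar>"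
    using slit_width_lipschitz[of ?x ?y] by (simp add: outer_pt_nth(1,2))
  have "(?x - ?y) $ 2 = (\<beta> - \<beta>') + (if k \<ge> 0 then 1 else - 1) * (slit_width ?x - slit_width ?y)"
    by (simp add: outer_pt_nth(3))
  then have "\<bar>(?x - ?y) $ 2\<bar> \<le> \<bar>\<beta> - \<beta>'\<bar> + \<bar>slit_width ?x - slit_width ?y\<bar>"
    by (auto simp: abs_if split: if_splits)
  moreover have "\<bar>(?x - ?y) $ 1\<bar> = \<bar>\<alpha> - \<alpha>'\<bar>" "\<bar>(?x - ?y) $ 3\<bar> = \<bar>t - t'\<bar>"
    by (simp_all add: outer_pt_nth(1,2))
  ultimately show ?thesis using norm_le_l1_3[of "?x - ?y"] w by argo
qed

text \<open>The lift is the closed-form preimage of \<open>Y\<close> in the same beam. As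
  \<open>x\<close> is the same expression at \<open>zmap x\<close>, it suffices to compare
  \<open>\<alpha>\<close>, \<open>\<beta>\<close> and \<open>t\<close>, each off by a multiple of
  \<open>\<delta> / E\<close>.\<close>

lemma colip_outer:
  assumes x: "x = outer_pt j k \<alpha> \<beta> t" "\<bar>\<alpha>\<bar> \<le> 1" "\<bar>\<beta>\<bar> \<le> 1"
    and Y: "0 \<le> - sg j * sg k * Y $ 2" "norm (Y - zmap x) \<le> exp t / 8"
  shows "\<exists>x'. zmap x' = Y \<and> norm (x - x') \<le> 26 * norm (Y - zmap x) / exp t"
proof -
  define E where "E = exp t"
  define \<delta> where "\<delta> = norm (Y - zmap x)"
  have E: "E > 0" by (simp add: E_def)
  have N: "\<bar>znorm Y - E\<bar> \<le> 2 * \<delta>"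
    using znorm_diff[of Y "zmap x"] by (simp add: x(1) znorm_zmap_outer[OF x(2,3)] E_def \<delta>_def)
  have \<delta>: "2 * \<delta> \<le> E / 2" using Y(2) norm_ge_zero[of "Y - zmap x"] unfolding \<delta>_def E_def by argo
  note ln = ln_diff_bound[OF E N \<delta>]
  have comp: "\<bar>Y $ i - zmap x $ i\<bar> \<le> \<delta>" for i
    using component_le_norm_cart[of "Y - zmap x" i] by (simp add: \<delta>_def)
  have le: "\<bar>Y $ 1\<bar> \<le> 1 * znorm Y" "\<bar>Y $ 3\<bar> \<le> 1 * znorm Y" by (simp_all add: znorm_def)
  have z: "zmap x $ 1 / E = sg j * \<alpha>" "zmap x $ 3 / E = sg k * \<beta>"
    by (simp_all add: x(1) zmap_outer[OF x(2,3)] E_def)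
  let ?\<alpha> = "sg j * Y $ 1 / znorm Y" and ?\<beta> = "sg k * Y $ 3 / znorm Y"
  have sgd: "\<bar>u - sg i * v\<bar> = \<bar>sg i * u - v\<bar>" for u v i
    using sg_cases[of i] by auto
  have 1: "\<bar>\<alpha> - ?\<alpha>\<bar> \<le> 3 * \<delta> / E"
    using quotient_diff_bound[OF E ln(2) le(1) comp[of 1] N] sgd[of \<alpha> j "Y $ 1 / znorm Y"] by (simp add: z)
  have 2: "\<bar>\<beta> - ?\<beta>\<bar> \<le> 3 * \<delta> / E"
    using quotient_diff_bound[OF E ln(2) le(2) comp[of 3] N] sgd[of \<beta> k "Y $ 3 / znorm Y"] by (simp add: z)
  have 3: "\<bar>t - ln (znorm Y)\<bar> \<le> 4 * \<delta> / E" using ln(1) by (simp add: E_def)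
  let ?x' = "outer_pt j k ?\<alpha> ?\<beta> (ln (znorm Y))"
  have "norm (x - ?x') \<le> 3 * \<bar>\<alpha> - ?\<alpha>\<bar> + \<bar>\<beta> - ?\<beta>\<bar> + 3 * \<bar>t - ln (znorm Y)\<bar>"
    unfolding x(1) by (rule outer_pt_lipschitz)
  also have "\<dots> \<le> 3 * (3 * \<delta> / E) + 3 * \<delta> / E + 3 * (4 * \<delta> / E)" using 1 2 3 by argo
  also have "\<dots> \<le> 26 * \<delta> / E" using E by (simp add: \<delta>_def add_divide_distrib[symmetric] divide_right_mono)
  finally have "norm (x - ?x') \<le> 26 * \<delta> / E" .
  moreover have "zmap ?x' = Y" by (rule zmap_outer_ln(1)[OF ln(2) Y(1)])
  ultimately show ?thesis unfolding \<delta>_def E_def by blast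
qed

lemma inner_pt_lipschitz:
  assumes "\<bar>\<sigma>\<bar> = 1"
  shows "norm (inner_pt \<sigma> a q t - inner_pt \<sigma> a' q' t') \<le> \<bar>a - a'\<bar> + \<bar>q - q'\<bar> + \<bar>t - t'\<bar>"
proof -
  have "\<bar>\<sigma> * q - \<sigma> * q'\<bar> = \<bar>q - q'\<bar>" using assms by (simp add: abs_mult flip: right_diff_distrib)
  then show ?thesis
    using norm_le_l1_3[of "inner_pt \<sigma> a q t - inner_pt \<sigma> a' q' t'"] by (simp add: inner_pt_def)
qed

text \<open>On the inserted piece these two functions of \<open>zmap x\<close> recover \<open>exp (x $ 3)\<close> and
  \<open>exp (x $ 3) * \<bar>x $ 2\<bar>\<close>.\<close>
definition inner_exp :: "real^3 \<Rightarrow> real" where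
  "inner_exp Y = \<bar>Y $ 2\<bar> + max (Y $ 3 + 1 + 2 * \<bar>Y $ 1\<bar>) (- Y $ 3)"

definition inner_off :: "real^3 \<Rightarrow> real" where
  "inner_off Y = \<bar>Y $ 2\<bar> + max 0 (- (2 * Y $ 3 + 1 + 2 * \<bar>Y $ 1\<bar>))"

lemma inner_exp_off_zmap:
  assumes \<sigma>: "\<sigma> = 1 \<or> \<sigma> = - 1" and q: "0 \<le> q" "q \<le> 2 - exp (- t) - 2 * \<bar>a\<bar>"
  shows "inner_exp (zmap (inner_pt \<sigma> a q t)) = exp t" "inner_off (zmap (inner_pt \<sigma> a q t)) = exp t * q"
proof -
  define E where "E = exp t"
  define A where "A = E * \<bar>a\<bar>"
  define Q where "Q = E * q"
  define C where "C = 2 * E - 1 - 2 * A"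
  let ?Y = "zmap (inner_pt \<sigma> a q t)"
  have E: "E > 0" by (simp add: E_def)
  have e: "E * exp (- t) = 1" by (simp add: exp_minus E_def)
  have C: "E * (2 - exp (- t) - 2 * \<bar>a\<bar>) = C" by (simp add: C_def A_def algebra_simps e)
  have Q: "0 \<le> Q" "Q \<le> C"
    using q E by (simp_all add: Q_def flip: C)
  have "E * min q (2 - exp (- t) - 2 * \<bar>a\<bar> - q) = min Q (C - Q)"
    using E by (simp add: Q_def min_mult_distrib_left right_diff_distrib flip: C)
  then have Y2: "\<bar>?Y $ 2\<bar> = min Q (C - Q)"
    using \<sigma> Q by (auto simp: zmap_inner[OF \<sigma> q] E_def[symmetric])
  have Y1: "\<bar>?Y $ 1\<bar> = A" using E by (simp add: zmap_inner[OF \<sigma> q] A_def abs_mult flip: E_def)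
  have Y3: "?Y $ 3 = E - Q - 2 * A - 1"
    by (simp add: zmap_inner[OF \<sigma> q] A_def Q_def algebra_simps flip: E_def)
  show "inner_exp ?Y = exp t"
    unfolding inner_exp_def Y1 Y2 Y3 E_def[symmetric] by (auto simp: C_def min_def max_def)
  show "inner_off ?Y = exp t * q"
    unfolding inner_off_def Y1 Y2 Y3 E_def[symmetric] Q_def[symmetric] by (auto simp: C_def min_def max_def)
qed

lemma inner_exp_pos: "inner_exp Y > 0" "\<bar>Y $ 1\<bar> \<le> 1 * inner_exp Y" "\<bar>inner_off Y\<bar> \<le> 2 * inner_exp Y"
  unfolding inner_exp_def inner_off_def by (auto simp: max_def abs_if)

lemma zmap_inner_ln:
  assumes \<sigma>: "\<sigma> = 1 \<or> \<sigma> = - 1" and Y: "0 \<le> \<sigma> * Y $ 2"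
  shows "zmap (inner_pt \<sigma> (Y $ 1 / inner_exp Y) (inner_off Y / inner_exp Y) (ln (inner_exp Y))) = Y"
proof -
  define E where "E = inner_exp Y"
  define Q where "Q = inner_off Y"
  have E: "E > 0" by (simp add: E_def inner_exp_pos)
  define A where "A = \<bar>Y $ 1\<bar>"
  have Q0: "Q \<ge> 0" by (simp add: Q_def inner_off_def)
  have a: "E * \<bar>Y $ 1 / E\<bar> = A" using E by (simp add: A_def)
  have e: "exp (- ln E) = 1 / E" using E by (simp add: exp_minus field_simps)
  have C: "2 - exp (- ln E) - 2 * \<bar>Y $ 1 / E\<bar> = (2 * E - 1 - 2 * A) / E"
    using E by (simp add: e A_def field_simps)
  have QC: "Q \<le> 2 * E - 1 - 2 * A"
    by (auto simp: Q_def E_def A_def inner_off_def inner_exp_def max_def)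
  have q: "0 \<le> Q / E" "Q / E \<le> 2 - exp (- ln E) - 2 * \<bar>Y $ 1 / E\<bar>"
    unfolding C using E Q0 QC by (simp_all add: divide_right_mono)
  have "E * min (Q / E) ((2 * E - 1 - 2 * A) / E - Q / E) = min Q (2 * E - 1 - 2 * A - Q)"
    using E by (simp add: min_def divide_le_cancel diff_divide_distrib[symmetric])
  also have "\<dots> = \<bar>Y $ 2\<bar>"
    by (auto simp: Q_def E_def A_def inner_off_def inner_exp_def max_def min_def)
  finally have m: "E * min (Q / E) ((2 * E - 1 - 2 * A) / E - Q / E) = \<bar>Y $ 2\<bar>" .
  have "E * (1 - Q / E - 2 * \<bar>Y $ 1 / E\<bar>) - 1 = E - Q - 2 * A - 1"
    using E by (simp add: right_diff_distrib A_def)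
  also have "\<dots> = Y $ 3"
    by (auto simp: Q_def E_def A_def inner_off_def inner_exp_def max_def min_def)
  finally have z3: "E * (1 - Q / E - 2 * \<bar>Y $ 1 / E\<bar>) - 1 = Y $ 3" .
  have s: "\<sigma> * \<bar>Y $ 2\<bar> = Y $ 2" using \<sigma> Y by auto
  show ?thesis
    unfolding E_def[symmetric] Q_def[symmetric] zmap_inner[OF \<sigma> q] C exp_ln[OF E] m z3
    by (rule vec3_eqI) (use E s in simp_all)
qed

lemma inner_exp_off_diff:
  "\<bar>inner_exp Y - inner_exp y\<bar> \<le> 4 * norm (Y - y)" "\<bar>inner_off Y - inner_off y\<bar> \<le> 5 * norm (Y - y)"
proof -
  let ?d = "norm (Y - y)"
  have "\<bar>Y $ i - y $ i\<bar> \<le> ?d" for i using component_le_norm_cart[of "Y - y" i] by simp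
  note d = this[of 3] order_trans[OF abs_triangle_ineq3 this[of 1]] order_trans[OF abs_triangle_ineq3 this[of 2]]
  have sum: "\<bar>(a + b) - (c + e)\<bar> \<le> \<bar>a - c\<bar> + \<bar>b - e\<bar>" for a b c e :: real by (simp add: abs_if)
  have "\<bar>max (Y $ 3 + 1 + 2 * \<bar>Y $ 1\<bar>) (- Y $ 3) - max (y $ 3 + 1 + 2 * \<bar>y $ 1\<bar>) (- y $ 3)\<bar> \<le> 3 * ?d"
  proof (rule max_lipschitz)
    show "\<bar>(Y $ 3 + 1 + 2 * \<bar>Y $ 1\<bar>) - (y $ 3 + 1 + 2 * \<bar>y $ 1\<bar>)\<bar> \<le> 3 * ?d"
      using d(1,2) by argo
    show "\<bar>- Y $ 3 - - y $ 3\<bar> \<le> 3 * ?d" using d(1) norm_ge_zero[of "Y - y"] by argo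
  qed
  then show "\<bar>inner_exp Y - inner_exp y\<bar> \<le> 4 * norm (Y - y)"
    unfolding inner_exp_def by (intro order_trans[OF sum]) (use d(3) in argo)
  have "\<bar>max 0 (- (2 * Y $ 3 + 1 + 2 * \<bar>Y $ 1\<bar>)) - max 0 (- (2 * y $ 3 + 1 + 2 * \<bar>y $ 1\<bar>))\<bar> \<le> 4 * ?d"
  proof (rule max_lipschitz)
    show "\<bar>- (2 * Y $ 3 + 1 + 2 * \<bar>Y $ 1\<bar>) - - (2 * y $ 3 + 1 + 2 * \<bar>y $ 1\<bar>)\<bar> \<le> 4 * ?d"
      using d(1,2) by argo
  qed simp
  then show "\<bar>inner_off Y - inner_off y\<bar> \<le> 5 * norm (Y - y)"
    unfolding inner_off_def by (intro order_trans[OF sum]) (use d(3) in argo)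
qed

text \<open>As for the beams, with \<open>inner_exp\<close> and \<open>inner_off\<close> as inverse.
  The constant \<open>26 = 5 + 13 + 8\<close> originates here, from the errors of \<open>a\<close>,
  \<open>q\<close> and \<open>t\<close>; a beam gives \<open>24\<close>.\<close>

lemma colip_inner:
  assumes x: "x = inner_pt \<sigma> a q t" "\<sigma> = 1 \<or> \<sigma> = - 1" "0 \<le> q" "q \<le> 2 - exp (- t) - 2 * \<bar>a\<bar>"
    and Y: "0 \<le> \<sigma> * Y $ 2" "norm (Y - zmap x) \<le> exp t / 8"
  shows "\<exists>x'. zmap x' = Y \<and> norm (x - x') \<le> 26 * norm (Y - zmap x) / exp t"
proof -
  define E where "E = exp t"
  define \<delta> where "\<delta> = norm (Y - zmap x)"
  have E: "E > 0" by (simp add: E_def)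
  have N: "\<bar>inner_exp Y - E\<bar> \<le> 4 * \<delta>"
    using inner_exp_off_diff(1)[of Y "zmap x"] by (simp add: x(1) inner_exp_off_zmap[OF x(2-4)] E_def \<delta>_def)
  have Q: "\<bar>inner_off Y - E * q\<bar> \<le> 5 * \<delta>"
    using inner_exp_off_diff(2)[of Y "zmap x"] by (simp add: x(1) inner_exp_off_zmap[OF x(2-4)] E_def \<delta>_def)
  have \<delta>: "4 * \<delta> \<le> E / 2" using Y(2) unfolding \<delta>_def E_def by argo
  have ln: "\<bar>t - ln (inner_exp Y)\<bar> \<le> 2 * (4 * \<delta>) / E"
    using ln_diff_bound(1)[OF E N \<delta>] by (simp add: E_def)
  have "\<bar>Y $ 1 - zmap x $ 1\<bar> \<le> \<delta>"
    using component_le_norm_cart[of "Y - zmap x" 1] by (simp add: \<delta>_def)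
  then have A: "\<bar>Y $ 1 - E * a\<bar> \<le> \<delta>" by (simp add: x(1) zmap_inner[OF x(2-4)] E_def)
  have 1: "\<bar>a - Y $ 1 / inner_exp Y\<bar> \<le> 5 * \<delta> / E"
    using quotient_diff_bound[OF E inner_exp_pos(1,2) A N] E by simp
  have 2: "\<bar>q - inner_off Y / inner_exp Y\<bar> \<le> 13 * \<delta> / E"
    using quotient_diff_bound[OF E inner_exp_pos(1,3) Q N] E by simp
  let ?x' = "inner_pt \<sigma> (Y $ 1 / inner_exp Y) (inner_off Y / inner_exp Y) (ln (inner_exp Y))"
  have "norm (x - ?x') \<le> \<bar>a - Y $ 1 / inner_exp Y\<bar> + \<bar>q - inner_off Y / inner_exp Y\<bar> + \<bar>t - ln (inner_exp Y)\<bar>"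
    unfolding x(1) using x(2) by (intro inner_pt_lipschitz) auto
  also have "\<dots> \<le> 5 * \<delta> / E + 13 * \<delta> / E + 2 * (4 * \<delta>) / E" using 1 2 ln by argo
  also have "\<dots> = 26 * \<delta> / E" by (simp add: add_divide_distrib[symmetric])
  finally show ?thesis using zmap_inner_ln[OF x(2) Y(1)] unfolding \<delta>_def E_def by blast
qed

section \<open>Decomposition into pieces and lifting across the plane\<close>

text \<open>If the first cell found has the wrong sign, the hypothesis forces the signed minimum to
  vanish. The point is then on an edge, and the neighbour across it has the opposite sign. The
  change of cell must not cross \<open>s = 0\<close>, where the slit may separate the beams; this
  explains \<open>s \<noteq> 0\<close> and the last conjunct.\<close>

lemma cell_of_sign:
  assumes \<sigma>: "\<sigma> = 1 \<or> \<sigma> = - 1" and s: "s \<noteq> 0" and le: "0 \<le> \<sigma> * - smin (cotri a) (tri s)"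
  shows "\<exists>j k. \<bar>a - 2 * of_int j\<bar> \<le> 1 \<and> \<bar>s - (2 * of_int k + 1)\<bar> \<le> 1 \<and> - sg j * sg k = \<sigma> \<and> (0 \<le> k \<longleftrightarrow> 0 < s)"
proof -
  obtain j where j: "\<bar>a - 2 * of_int j\<bar> \<le> 1" using ex_cell by blast
  define k where "k = \<lfloor>s / 2\<rfloor>"
  have "of_int k \<le> s / 2" "s / 2 < of_int k + 1" unfolding k_def by linarith+
  then have k: "2 * of_int k \<le> s" "s < 2 * of_int k + 2" by (simp_all add: field_simps)
  have k0: "0 \<le> k \<longleftrightarrow> 0 < s"
    using s by (auto simp: k_def zero_le_floor)
  have ks: "\<bar>s - (2 * of_int k + 1)\<bar> \<le> 1" using k by (simp add: abs_le_iff)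
  show ?thesis
  proof (cases "- sg j * sg k = \<sigma>")
    case True
    then show ?thesis using j ks k0 by blast
  next
    case False
    then have \<sigma>': "\<sigma> = sg j * sg k" using \<sigma> sg_cases[of j] sg_cases[of k] by auto
    have ca: "cotri a = sg j * (1 - \<bar>a - 2 * of_int j\<bar>)" by (rule cotri_cell[OF j])
    have ts: "tri s = sg k * (1 - \<bar>s - (2 * of_int k + 1)\<bar>)"
      using tri_shifted_cell(1)[OF ks, of k] by simp
    have "smin (cotri a) (tri s) = \<sigma> * min (1 - \<bar>a - 2 * of_int j\<bar>) (1 - \<bar>s - (2 * of_int k + 1)\<bar>)"
      unfolding ca ts \<sigma>' using j ks by (intro smin_sg) auto
    then have "min (1 - \<bar>a - 2 * of_int j\<bar>) (1 - \<bar>s - (2 * of_int k + 1)\<bar>) \<le> 0"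
      using le \<sigma> by auto
    then consider "a = 2 * of_int j + 1" | "a = 2 * of_int j - 1" | "s = 2 * of_int k"
      using j ks k by (simp add: min_le_iff_disj abs_if split: if_splits; linarith)
    then show ?thesis
    proof cases
      case 1
      then show ?thesis using ks k0 \<sigma>' by (intro exI[of _ "j + 1"] exI[of _ k]) auto
    next
      case 2
      then show ?thesis using ks k0 \<sigma>' by (intro exI[of _ "j - 1"] exI[of _ k]) auto
    next
      case 3
      then have "k \<noteq> 0" using s by auto
      then have "0 \<le> k - 1 \<longleftrightarrow> 0 < s" using k0 by auto
      then show ?thesis using j 3 \<sigma>' by (intro exI[of _ j] exI[of _ "k - 1"]) auto
    qed
  qed
qed

lemma clamp_abs_sign:
  assumes "r > 0"
  shows "0 \<le> clamp_abs r s \<longleftrightarrow> 0 \<le> s" "clamp_abs r s \<le> 0 \<longleftrightarrow> s \<le> 0"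
  using assms by (auto simp: clamp_abs_def)

text \<open>The closed pieces share their faces, so a point whose image lies in the plane
  \<open>Y $ 2 = 0\<close> can be assigned to a piece on either side. This freedom is what a lift
  across the plane needs.\<close>

lemma zmap_pieces:
  assumes \<sigma>: "\<sigma> = 1 \<or> \<sigma> = - 1" and x: "0 \<le> \<sigma> * zmap x $ 2"
  shows "(\<exists>j k \<alpha> \<beta>. x = outer_pt j k \<alpha> \<beta> (x $ 3) \<and> \<bar>\<alpha>\<bar> \<le> 1 \<and> \<bar>\<beta>\<bar> \<le> 1 \<and> - sg j * sg k = \<sigma>) \<or>
    (\<exists>a q. x = inner_pt \<sigma> a q (x $ 3) \<and> 0 \<le> q \<and> q \<le> 2 - exp (- x $ 3) - 2 * \<bar>a\<bar>)"
    (is "?outer \<or> ?inner")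
proof -
  define c where "c = slit_width x"
  define s where "s = x $ 2 - clamp_abs c (x $ 2)"
  have c0: "c \<ge> 0" by (simp add: c_def slit_width_bounds)
  have outerI: ?outer if "\<bar>x $ 1 - 2 * of_int j\<bar> \<le> 1" "\<bar>s - (2 * of_int k + 1)\<bar> \<le> 1" "- sg j * sg k = \<sigma>"
    "x $ 2 = s + (if k \<ge> 0 then 1 else - 1) * c" for j k
    using that
    by (intro exI[of _ j] exI[of _ k] exI[of _ "x $ 1 - 2 * of_int j"] exI[of _ "s - (2 * of_int k + 1)"] conjI vec3_eqI)
      (simp_all add: outer_pt_def c_def slit_width_def)
  have innerI: ?inner if "\<bar>x $ 2\<bar> \<le> c" "0 \<le> \<sigma> * x $ 2" "c = 2 - exp (- x $ 3) - 2 * \<bar>x $ 1\<bar>"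
    using that \<sigma>
    by (intro exI[of _ "x $ 1"] exI[of _ "\<bar>x $ 2\<bar>"] conjI vec3_eqI) (auto simp: inner_pt_def)
  have c_eq: "c = 2 - exp (- x $ 3) - 2 * \<bar>x $ 1\<bar>" if "c > 0"
    using that by (simp add: c_def slit_width_def max_def split: if_splits)
  have z2: "zmap x $ 2 = exp (x $ 3) * (clamp_abs (max 0 (c - \<bar>x $ 2\<bar>)) (x $ 2) - smin (cotri (x $ 1)) (tri s))"
    by (simp add: zmap_nth zdir_nth s_def c_def)
  have le: "0 \<le> \<sigma> * (clamp_abs (max 0 (c - \<bar>x $ 2\<bar>)) (x $ 2) - smin (cotri (x $ 1)) (tri s))"
    using x unfolding z2 by (simp add: mult.left_commute[of \<sigma>] zero_le_mult_iff)
  \<comment> \<open>In order: outside the collapsed slab; on the face \<open>s = 0\<close> where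
    nothing is inserted; inside the inserted piece; on its boundary.\<close>
  consider "s \<noteq> 0" | "s = 0" "c = 0" | "s = 0" "c > 0" "\<bar>x $ 2\<bar> < c" | "s = 0" "c > 0" "\<bar>x $ 2\<bar> = c"
    using c0 by (force simp: s_def clamp_abs_def)
  then show ?thesis
  proof cases
    case 1
    then have "c - \<bar>x $ 2\<bar> < 0" by (auto simp: s_def clamp_abs_def split: if_splits)
    then have "0 \<le> \<sigma> * - smin (cotri (x $ 1)) (tri s)" using le by simp
    from cell_of_sign[OF \<sigma> 1 this] obtain j k where jk:
      "\<bar>x $ 1 - 2 * of_int j\<bar> \<le> 1" "\<bar>s - (2 * of_int k + 1)\<bar> \<le> 1" "- sg j * sg k = \<sigma>" "0 \<le> k \<longleftrightarrow> 0 < s" by blast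
    have "x $ 2 = s + (if k \<ge> 0 then 1 else - 1) * c"
      using jk(4) 1 c0 by (auto simp: s_def clamp_abs_def min_def max_def split: if_splits)
    then show ?thesis using outerI jk by blast
  next
    case 2
    obtain j where j: "\<bar>x $ 1 - 2 * of_int j\<bar> \<le> 1" using ex_cell by blast
    define k :: int where "k = (if sg j = \<sigma> then - 1 else 0)"
    have "- sg j * sg k = \<sigma>" using \<sigma> sg_cases[of j] by (auto simp: k_def)
    moreover have "\<bar>s - (2 * of_int k + 1)\<bar> \<le> 1" using 2 by (simp add: k_def)
    moreover have "x $ 2 = s + (if k \<ge> 0 then 1 else - 1) * c" using 2 by (simp add: s_def)
    ultimately show ?thesis using outerI[OF j] by blast
  next
    case 3
    have "0 \<le> \<sigma> * clamp_abs (c - \<bar>x $ 2\<bar>) (x $ 2)" using le 3 by (simp add: s_def)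
    then have "0 \<le> \<sigma> * x $ 2"
      using \<sigma> clamp_abs_sign[of "c - \<bar>x $ 2\<bar>" "x $ 2"] 3(3) by auto
    then show ?thesis using innerI[OF _ _ c_eq[OF 3(2)]] 3(3) by simp
  next
    case 4
    show ?thesis
    proof (cases "0 \<le> \<sigma> * x $ 2")
      case True
      then show ?thesis using innerI[OF _ _ c_eq[OF 4(2)]] 4(3) by simp
    next
      case False
      \<comment> \<open>On the boundary of the inserted piece the half with the wrong sign is
        exchanged for the adjacent beam. The slit lies over
        \<open>\<bar>x $ 1\<bar> \<le> 1\<close>, so that beam has \<open>j = 0\<close>.\<close>
      define k :: int where "k = (if x $ 2 > 0 then 0 else - 1)"
      have "\<bar>x $ 1\<bar> \<le> 1" using c_eq[OF 4(2)] 4(2) exp_gt_zero[of "- x $ 3"] by linarith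
      then have "\<bar>x $ 1 - 2 * of_int 0\<bar> \<le> 1" by simp
      moreover have "\<bar>s - (2 * of_int k + 1)\<bar> \<le> 1" using 4 by (simp add: k_def)
      moreover have "- sg 0 * sg k = \<sigma>" using False \<sigma> by (auto simp: k_def)
      moreover have "x $ 2 = s + (if k \<ge> 0 then 1 else - 1) * c" using 4 by (auto simp: k_def)
      ultimately show ?thesis using outerI by blast
    qed
  qed
qed

lemma colip_one_sided:
  assumes \<sigma>: "\<sigma> = 1 \<or> \<sigma> = - 1" and x: "0 \<le> \<sigma> * zmap x $ 2" and Y: "0 \<le> \<sigma> * Y $ 2"
    and d: "norm (Y - zmap x) \<le> exp (x $ 3) / 8"
  shows "\<exists>x'. zmap x' = Y \<and> norm (x - x') \<le> 26 * norm (Y - zmap x) / exp (x $ 3)"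
  using zmap_pieces[OF \<sigma> x]
proof (elim disjE exE conjE)
  fix j k \<alpha> \<beta> assume "x = outer_pt j k \<alpha> \<beta> (x $ 3)" "\<bar>\<alpha>\<bar> \<le> 1" "\<bar>\<beta>\<bar> \<le> 1" "- sg j * sg k = \<sigma>"
  then show ?thesis using colip_outer[of x j k \<alpha> \<beta> "x $ 3" Y] Y d by simp
next
  fix a q assume "x = inner_pt \<sigma> a q (x $ 3)" "0 \<le> q" "q \<le> 2 - exp (- x $ 3) - 2 * \<bar>a\<bar>"
  then show ?thesis using colip_inner[of x \<sigma> a q "x $ 3" Y] \<sigma> Y d by simp
qed

text \<open>If \<open>Y\<close> and \<open>zmap x\<close> lie on opposite sides of the plane, the segment between them is
  lifted in two steps.\<close>
lemma zmap_colipschitz: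
  assumes d: "norm (Y - zmap x) \<le> exp (x $ 3) / 100"
  shows "\<exists>x'. zmap x' = Y \<and> norm (x - x') \<le> 52 * norm (Y - zmap x) / exp (x $ 3)"
proof -
  define E where "E = exp (x $ 3)"
  define y where "y = zmap x"
  define \<delta> where "\<delta> = norm (Y - y)"
  have E: "E > 0" by (simp add: E_def)
  have \<delta>: "0 \<le> \<delta>" "\<delta> \<le> E / 100" using d by (simp_all add: \<delta>_def E_def y_def)
  define \<sigma> :: real where "\<sigma> = (if y $ 2 \<ge> 0 then 1 else - 1)"
  have \<sigma>: "\<sigma> = 1 \<or> \<sigma> = - 1" "- \<sigma> = 1 \<or> - \<sigma> = - 1" "0 \<le> \<sigma> * y $ 2" by (auto simp: \<sigma>_def)
  show ?thesis
  proof (cases "0 \<le> \<sigma> * Y $ 2")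
    case True
    have "norm (Y - zmap x) \<le> exp (x $ 3) / 8"
      using \<delta> E unfolding \<delta>_def E_def y_def by argo
    from colip_one_sided[OF \<sigma>(1) \<sigma>(3)[unfolded y_def] True this]
    obtain x' where x': "zmap x' = Y" "norm (x - x') \<le> 26 * \<delta> / E"
      unfolding \<delta>_def E_def y_def by blast
    have "26 * \<delta> / E \<le> 52 * \<delta> / E" using E \<delta> by (intro divide_right_mono) auto
    then show ?thesis using x' by (auto simp: \<delta>_def E_def y_def)
  next
    case False
    have ne: "y $ 2 - Y $ 2 \<noteq> 0" and opp: "0 \<le> - \<sigma> * Y $ 2" using False \<sigma> by auto
    \<comment> \<open>The parameter at which the segment from \<open>y\<close> to \<open>Y\<close>
      meets the plane.\<close>
    define r where "r = y $ 2 / (y $ 2 - Y $ 2)"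
    have r: "0 \<le> r" "r \<le> 1" using False \<sigma> ne by (auto simp: r_def \<sigma>_def divide_simps split: if_splits)
    define z where "z = y + r *\<^sub>R (Y - y)"
    have z2: "z $ 2 = 0" using ne by (simp add: z_def r_def field_simps)
    have zy: "norm (z - y) = r * \<delta>" using r by (simp add: z_def \<delta>_def)
    have "Y - z = (1 - r) *\<^sub>R (Y - y)" by (simp add: z_def algebra_simps)
    then have Yz: "norm (Y - z) = (1 - r) * \<delta>" using r by (simp add: \<delta>_def)
    have rd: "r * \<delta> \<le> \<delta>" "(1 - r) * \<delta> \<le> \<delta>" using r \<delta> by (simp_all add: mult_left_le_one_le)
    have "norm (z - zmap x) \<le> exp (x $ 3) / 8"
      using rd \<delta> E zy unfolding E_def y_def by argo
    moreover have "0 \<le> \<sigma> * z $ 2" using z2 by simp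
    ultimately obtain x1 where x1: "zmap x1 = z" "norm (x - x1) \<le> 26 * (r * \<delta>) / E"
      using colip_one_sided[OF \<sigma>(1) \<sigma>(3)[unfolded y_def], of z] unfolding zy[symmetric] E_def y_def by blast
    \<comment> \<open>The first lift lowers the height by at most \<open>1 / 2\<close>, so the scale
      \<open>exp\<close> of the height loses at most a factor of two. This turns \<open>26\<close>
      into \<open>52\<close>.\<close>
    have "26 * (r * \<delta>) / E \<le> 1 / 2" using rd \<delta> E by (simp add: divide_le_eq)
    then have "x1 $ 3 \<ge> x $ 3 - 1 / 2"
      using x1(2) component_le_norm_cart[of "x - x1" 3] by simp
    moreover have "exp (1 / 2 :: real) \<le> 2"
    proof -
      have "exp (1 / 2 :: real) \<le> 1 + 2 * (1 / 2)" using abs_exp_minus_1[of "1 / 2"] by simp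
      then show ?thesis by simp
    qed
    ultimately have E1: "exp (x1 $ 3) \<ge> E / 2"
    proof -
      assume a: "x $ 3 - 1 / 2 \<le> x1 $ 3" and h: "exp (1 / 2 :: real) \<le> 2"
      have "E / 2 \<le> E / exp (1 / 2)" using h E by (intro divide_left_mono) auto
      also have "\<dots> = exp (x $ 3 - 1 / 2)" by (simp add: E_def exp_diff)
      also have "\<dots> \<le> exp (x1 $ 3)" using a by simp
      finally show ?thesis .
    qed
    have "norm (Y - zmap x1) \<le> exp (x1 $ 3) / 8" using rd \<delta> E1 E unfolding x1(1) Yz by linarith
    moreover have "0 \<le> - \<sigma> * zmap x1 $ 2" using z2 x1(1) by simp
    ultimately obtain x2 where x2: "zmap x2 = Y" "norm (x1 - x2) \<le> 26 * ((1 - r) * \<delta>) / exp (x1 $ 3)"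
      using colip_one_sided[OF \<sigma>(2) _ opp, of x1] unfolding Yz[symmetric] x1(1) by blast
    have "26 * ((1 - r) * \<delta>) / exp (x1 $ 3) \<le> 26 * ((1 - r) * \<delta>) / (E / 2)"
      using E1 E r \<delta> by (intro divide_left_mono) auto
    then have "norm (x1 - x2) \<le> 52 * ((1 - r) * \<delta>) / E" using x2(2) by simp
    moreover have "26 * (r * \<delta>) / E \<le> 52 * (r * \<delta>) / E" using r \<delta> E by (intro divide_right_mono) auto
    moreover have "norm (x - x2) \<le> norm (x - x1) + norm (x1 - x2)"
      using norm_triangle_ineq[of "x - x1" "x1 - x2"] by simp
    ultimately have "norm (x - x2) \<le> 52 * (r * \<delta>) / E + 52 * ((1 - r) * \<delta>) / E"
      using x1(2) by (meson add_mono order_trans)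
    also have "\<dots> = 52 * \<delta> / E" by (simp add: add_divide_distrib[symmetric] algebra_simps)
    finally show ?thesis using x2(1) by (auto simp: \<delta>_def E_def y_def)
  qed
qed

lemma zmap_axis: "- ln 2 \<le> t \<Longrightarrow> zmap (t *\<^sub>R axis 3 1) = (exp t - 1) *\<^sub>R axis 3 1"
proof -
  assume t: "- ln 2 \<le> t"
  have "exp (- t) \<le> exp (ln 2)" using t by (subst exp_le_cancel_iff) simp
  then have q: "0 \<le> 2 - exp (- t) - 2 * \<bar>0\<bar>" by simp
  have "t *\<^sub>R axis 3 1 = inner_pt 1 0 0 t" by (rule vec3_eqI) (simp_all add: inner_pt_def axis_def)
  then show ?thesis
    using zmap_inner[of 1 0 t 0] q by (intro vec3_eqI) (simp_all add: axis_def)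
qed

lemma zmap_0: "zmap 0 = 0"
  using zmap_axis[of 0] by simp

text \<open>On a beam \<open>znorm\<close> of the image is \<open>exp t\<close>, hence positive. On
  the inserted piece the inverse functions, evaluated at \<open>0\<close>, give
  \<open>exp t = 1\<close> and \<open>q = 0\<close>, and the first coordinate gives
  \<open>a = 0\<close>.\<close>

lemma zmap_eq_0_iff: "zmap x = 0 \<longleftrightarrow> x = 0"
proof
  assume z: "zmap x = 0"
  then have "0 \<le> 1 * zmap x $ 2" by simp
  have "(1::real) = 1 \<or> (1::real) = - 1" by simp
  from zmap_pieces[OF this \<open>0 \<le> 1 * zmap x $ 2\<close>] show "x = 0"
  proof (elim disjE exE conjE)
    fix j k \<alpha> \<beta> assume *: "x = outer_pt j k \<alpha> \<beta> (x $ 3)" "\<bar>\<alpha>\<bar> \<le> 1" "\<bar>\<beta>\<bar> \<le> 1"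
    then have "znorm (zmap x) = exp (x $ 3)" using znorm_zmap_outer[of \<alpha> \<beta> j k "x $ 3"] by simp
    then show ?thesis using z by (simp add: znorm_def)
  next
    fix a q assume *: "x = inner_pt 1 a q (x $ 3)" "0 \<le> q" "q \<le> 2 - exp (- x $ 3) - 2 * \<bar>a\<bar>"
    have o: "(1::real) = 1 \<or> (1::real) = - 1" by simp
    have zx: "zmap (inner_pt 1 a q (x $ 3)) = 0" using z *(1) by simp
    have "exp (x $ 3) = 1" "exp (x $ 3) * q = 0"
      using inner_exp_off_zmap[OF o *(2,3)] unfolding zx by (simp_all add: inner_exp_def inner_off_def)
    moreover have "exp (x $ 3) * a = 0"
      using arg_cong[OF zmap_inner[OF o *(2,3)], of "\<lambda>v. v $ 1"] unfolding zx by simp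
    ultimately have "exp (x $ 3) = 1" "exp (x $ 3) * q = 0" "exp (x $ 3) * a = 0" by blast+
    then have "x $ 3 = 0" "q = 0" "a = 0" by auto
    then show ?thesis using *(1) by (auto intro!: vec3_eqI simp: inner_pt_def)
  qed
qed (simp add: zmap_0)

text \<open>Of two neighbouring beams one has the sign required by \<open>Y $ 2\<close>, so a beam
  close to the prescribed \<open>p\<close> reaches \<open>Y\<close>. The horizontal bounds depend on
  neither \<open>Y\<close> nor the height, which is why a large ball covers a whole shell.\<close>

lemma zmap_covers:
  fixes Y p :: "real^3"
  assumes "Y \<noteq> 0"
  shows "\<exists>x'. zmap x' = Y \<and> x' $ 3 = ln (znorm Y) \<and> \<bar>x' $ 1 - p $ 1\<bar> \<le> 2 \<and> \<bar>x' $ 2 - p $ 2\<bar> \<le> 8"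
proof -
  have N: "znorm Y > 0" using assms by (rule znorm_pos)
  obtain j where j: "\<bar>p $ 1 - 2 * of_int j\<bar> \<le> 1" using ex_cell by blast
  obtain k0 where k0: "\<bar>p $ 2 - 2 * of_int k0\<bar> \<le> 1" using ex_cell by blast
  define k where "k = (if 0 \<le> - sg j * sg k0 * Y $ 2 then k0 else k0 + 1)"
  have k: "0 \<le> - sg j * sg k * Y $ 2" "\<bar>p $ 2 - 2 * of_int k\<bar> \<le> 3"
    using k0 by (auto simp: k_def)
  define x' where "x' = outer_pt j k (sg j * Y $ 1 / znorm Y) (sg k * Y $ 3 / znorm Y) (ln (znorm Y))"
  note zo = zmap_outer_ln[OF N k(1)]
  have nth: "x' $ 1 = 2 * of_int j + sg j * Y $ 1 / znorm Y" "x' $ 3 = ln (znorm Y)"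
    "x' $ 2 = 2 * of_int k + 1 + sg k * Y $ 3 / znorm Y + (if k \<ge> 0 then 1 else - 1) * slit_width x'"
    by (simp_all add: x'_def outer_pt_nth)
  have "\<bar>x' $ 1 - p $ 1\<bar> \<le> 2" using zo(2) j unfolding nth by linarith
  moreover have "\<bar>x' $ 2 - p $ 2\<bar> \<le> 8"
    using zo(3) k(2) slit_width_bounds[of x'] unfolding nth by (simp split: if_splits; linarith)
  ultimately show ?thesis using nth(2) zo(1) by (auto simp: x'_def)
qed

section \<open>Jacobian\<close>

lemma continuous_on_slit_width: "continuous_on A slit_width"
  unfolding slit_width_def[abs_def] by (intro continuous_intros)

lemma continuous_on_tri: "continuous_on A tri"
  unfolding tri_def[abs_def] by (intro continuous_intros)

lemma continuous_on_cotri: "continuous_on A cotri"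
  unfolding cotri_def[abs_def] by (rule continuous_on_compose2[OF continuous_on_tri[of UNIV]]) (auto intro!: continuous_intros)

text \<open>The loci where some branch changes: the breaks of the waves in \<open>x $ 1\<close>, the
  edge of the slit, its plane, the breaks of the waves in the collapsed variable together with the
  boundary of the inserted piece, the fold of \<open>min\<close> inside it, and the ridges of the
  pyramids.\<close>

definition kinks :: "(real^3) set" where
  "kinks = {x. x $ 1 \<in> \<int>} \<union> {x. 2 - exp (- x $ 3) - 2 * \<bar>x $ 1\<bar> = 0} \<union>
    {x. x $ 2 = 0} \<union> {x. \<bar>x $ 2\<bar> - slit_width x \<in> \<int>} \<union> {x. 2 * \<bar>x $ 2\<bar> = slit_width x} \<union>
    {x. \<bar>cotri (x $ 1)\<bar> = \<bar>tri (\<bar>x $ 2\<bar> - slit_width x)\<bar>}"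

lemma countable_abs_tri_eq: "countable {y. \<bar>tri y\<bar> = v}"
proof (rule countable_subset)
  show "{y. \<bar>tri y\<bar> = v} \<subseteq> (\<lambda>j::int. 2 * of_int j + v) ` UNIV \<union> (\<lambda>j::int. 2 * of_int j - v) ` UNIV"
  proof
    fix y assume "y \<in> {y. \<bar>tri y\<bar> = v}"
    moreover obtain j where j: "\<bar>y - 2 * of_int j\<bar> \<le> 1" using ex_cell by blast
    ultimately have "\<bar>y - 2 * of_int j\<bar> = v" by (simp add: tri_cell[OF j] abs_mult)
    then have "y = 2 * of_int j + v \<or> y = 2 * of_int j - v" by linarith
    then show "y \<in> (\<lambda>j::int. 2 * of_int j + v) ` UNIV \<union> (\<lambda>j::int. 2 * of_int j - v) ` UNIV" by blast
  qed
qed auto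

lemma countable_shifted_abs:
  assumes "countable S"
  shows "countable {r. \<bar>p + r\<bar> - c \<in> (S :: real set)}"
proof (rule countable_subset)
  show "{r. \<bar>p + r\<bar> - c \<in> S} \<subseteq> (\<lambda>y. y + c - p) ` S \<union> (\<lambda>y. - (y + c) - p) ` S"
  proof
    fix r assume r: "r \<in> {r. \<bar>p + r\<bar> - c \<in> S}"
    have "r = (\<bar>p + r\<bar> - c) + c - p \<or> r = - ((\<bar>p + r\<bar> - c) + c) - p" by linarith
    then show "r \<in> (\<lambda>y. y + c - p) ` S \<union> (\<lambda>y. - (y + c) - p) ` S" using r by blast
  qed
qed (use assms in auto)

text \<open>The slit width does not depend on \<open>x $ 2\<close>, so lines in that direction meet
  each of the last four loci in a countable set; for the first two, lines in the direction of
  \<open>x $ 1\<close> do.\<close>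

lemma negligible_kinks: "negligible kinks"
proof -
  have cl: "closed {x::real^3. x $ 1 \<in> \<int>}" "closed {x::real^3. 2 - exp (- x $ 3) - 2 * \<bar>x $ 1\<bar> = 0}"
    "closed {x::real^3. x $ 2 = 0}" "closed {x. \<bar>x $ 2\<bar> - slit_width x \<in> \<int>}" "closed {x. 2 * \<bar>x $ 2\<bar> = slit_width x}"
    "closed {x. \<bar>cotri (x $ 1)\<bar> = \<bar>tri (\<bar>x $ 2\<bar> - slit_width x)\<bar>}"
  proof -
    have "closed ((\<lambda>x::real^3. x $ 1) -` (\<int> :: real set))"
      by (intro closed_vimage closed_Ints continuous_intros)
    then show "closed {x::real^3. x $ 1 \<in> \<int>}" by (simp add: vimage_def)
    have "closed ((\<lambda>x. \<bar>x $ 2\<bar> - slit_width x) -` (\<int> :: real set))"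
      by (intro closed_vimage closed_Ints continuous_intros continuous_on_slit_width)
    then show "closed {x. \<bar>x $ 2\<bar> - slit_width x \<in> \<int>}" by (simp add: vimage_def)
    show "closed {x. \<bar>cotri (x $ 1)\<bar> = \<bar>tri (\<bar>x $ 2\<bar> - slit_width x)\<bar>}"
      by (intro closed_Collect_eq continuous_intros continuous_on_slit_width
          continuous_on_compose2[OF continuous_on_tri[of UNIV]] continuous_on_compose2[OF continuous_on_cotri[of UNIV]]) auto
  qed (intro closed_Collect_eq continuous_intros continuous_on_slit_width)+
  have sw: "slit_width (x + r *\<^sub>R axis 2 1) = slit_width x" for x r
    by (simp add: slit_width_def axis_def)
  have ax: "(axis 2 1 :: real^3) $ 1 = 0" by (simp add: axis_def)
  have "negligible {x::real^3. x $ 1 \<in> \<int>}"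
  proof (rule negligible_countable_fibres[of _ "axis 1 1"])
    fix x :: "real^3"
    have "{r. x + r *\<^sub>R axis 1 1 \<in> {x. x $ 1 \<in> \<int>}} \<subseteq> (\<lambda>z. z - x $ 1) ` \<int>"
    proof
      fix r assume "r \<in> {r. x + r *\<^sub>R axis 1 1 \<in> {x. x $ 1 \<in> \<int>}}"
      then have "x $ 1 + r \<in> \<int>" by simp
      then show "r \<in> (\<lambda>z. z - x $ 1) ` \<int>" by (intro image_eqI[of _ _ "x $ 1 + r"]) auto
    qed
    then show "countable {r. x + r *\<^sub>R axis 1 1 \<in> {x. x $ 1 \<in> \<int>}}"
      using countable_int by (meson countable_image countable_subset)
  qed (use cl in simp)
  moreover have "negligible {x::real^3. 2 - exp (- x $ 3) - 2 * \<bar>x $ 1\<bar> = 0}"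
  proof (rule negligible_countable_fibres[of _ "axis 1 1"])
    fix x :: "real^3"
    have "countable {r. \<bar>x $ 1 + r\<bar> - (1 - exp (- x $ 3) / 2) \<in> {0}}"
      by (rule countable_shifted_abs) simp
    moreover have "{r. x + r *\<^sub>R axis 1 1 \<in> {x. 2 - exp (- x $ 3) - 2 * \<bar>x $ 1\<bar> = 0}}
        = {r. \<bar>x $ 1 + r\<bar> - (1 - exp (- x $ 3) / 2) \<in> {0}}"
      by (auto simp: axis_def)
    ultimately show "countable {r. x + r *\<^sub>R axis 1 1 \<in> {x. 2 - exp (- x $ 3) - 2 * \<bar>x $ 1\<bar> = 0}}" by simp
  qed (use cl in simp)
  moreover have "negligible {x::real^3. x $ 2 = 0}"
  proof (rule negligible_countable_fibres[of _ "axis 2 1"])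
    fix x :: "real^3"
    have "{r. x + r *\<^sub>R axis 2 1 \<in> {x. x $ 2 = 0}} \<subseteq> {- x $ 2}" by (auto simp: eq_neg_iff_add_eq_0 add.commute)
    then show "countable {r. x + r *\<^sub>R axis 2 1 \<in> {x. x $ 2 = 0}}" by (rule countable_subset) simp
  qed (use cl in simp)
  moreover have "negligible {x. \<bar>x $ 2\<bar> - slit_width x \<in> \<int>}"
  proof (rule negligible_countable_fibres[of _ "axis 2 1"])
    fix x :: "real^3"
    show "countable {r. x + r *\<^sub>R axis 2 1 \<in> {x. \<bar>x $ 2\<bar> - slit_width x \<in> \<int>}}"
      using countable_shifted_abs[OF countable_int, of "x $ 2" "slit_width x"] by (simp add: sw)
  qed (use cl in simp)
  moreover have "negligible {x. 2 * \<bar>x $ 2\<bar> = slit_width x}"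
  proof (rule negligible_countable_fibres[of _ "axis 2 1"])
    fix x :: "real^3"
    have "{r. x + r *\<^sub>R axis 2 1 \<in> {x. 2 * \<bar>x $ 2\<bar> = slit_width x}} = {r. \<bar>x $ 2 + r\<bar> - slit_width x / 2 \<in> {0}}"
      by (auto simp: sw)
    then show "countable {r. x + r *\<^sub>R axis 2 1 \<in> {x. 2 * \<bar>x $ 2\<bar> = slit_width x}}"
      using countable_shifted_abs[of "{0}" "x $ 2" "slit_width x / 2"] by simp
  qed (use cl in simp)
  moreover have "negligible {x. \<bar>cotri (x $ 1)\<bar> = \<bar>tri (\<bar>x $ 2\<bar> - slit_width x)\<bar>}"
  proof (rule negligible_countable_fibres[of _ "axis 2 1"])
    fix x :: "real^3"
    have "{r. x + r *\<^sub>R axis 2 1 \<in> {x. \<bar>cotri (x $ 1)\<bar> = \<bar>tri (\<bar>x $ 2\<bar> - slit_width x)\<bar>}}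
        = {r. \<bar>x $ 2 + r\<bar> - slit_width x \<in> {y. \<bar>tri y\<bar> = \<bar>cotri (x $ 1)\<bar>}}"
      by (auto simp: sw ax)
    then show "countable {r. x + r *\<^sub>R axis 2 1 \<in> {x. \<bar>cotri (x $ 1)\<bar> = \<bar>tri (\<bar>x $ 2\<bar> - slit_width x)\<bar>}}"
      using countable_shifted_abs[OF countable_abs_tri_eq] by simp
  qed (use cl in simp)
  ultimately show ?thesis unfolding kinks_def by (intro negligible_Un)
qed

text \<open>On each of its pieces the map has the following form. The Jacobian does not see the
  \<open>y $ 1\<close> and \<open>y $ 2\<close> terms of the last column, hence is constant up to \<open>exp (x $ 3) ^ 3\<close>.\<close>
lemma zmap_has_derivative_local:
  fixes p1 p2 p3 q1 q2 q3 r1 r2 r3 u1 u2 u3 :: real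
  assumes ev: "\<forall>\<^sub>F y in nhds x. zmap y $ 1 = exp (y $ 3) * (p1 + q1 * y $ 1 + r1 * y $ 2) + u1 \<and>
      zmap y $ 2 = exp (y $ 3) * (p2 + q2 * y $ 1 + r2 * y $ 2) + u2 \<and>
      zmap y $ 3 = exp (y $ 3) * (p3 + q3 * y $ 1 + r3 * y $ 2) + u3"
    and det: "q1 * (r2 * p3 - r3 * p2) - r1 * (q2 * p3 - q3 * p2) + p1 * (q2 * r3 - q3 * r2) = 1"
  shows "\<exists>D. (zmap has_derivative D) (at x) \<and> det (matrix D) = exp (x $ 3) ^ 3"
proof -
  define p q r u :: "real^3" where pqru: "p = vector [p1, p2, p3]" "q = vector [q1, q2, q3]" "r = vector [r1, r2, r3]" "u = vector [u1, u2, u3]"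
  define E where "E = exp (x $ 3)"
  define D where "D h = E *\<^sub>R (h $ 3 *\<^sub>R (p + x $ 1 *\<^sub>R q + x $ 2 *\<^sub>R r) + h $ 1 *\<^sub>R q + h $ 2 *\<^sub>R r)" for h :: "real^3"
  have ev': "\<forall>\<^sub>F y in nhds x. exp (y $ 3) *\<^sub>R (p + y $ 1 *\<^sub>R q + y $ 2 *\<^sub>R r) + u = zmap y"
    using ev by eventually_elim (rule vec3_eqI; simp add: pqru algebra_simps)
  have nth: "((\<lambda>y::real^3. y $ i) has_derivative (\<lambda>h. h $ i)) (at x)" for i
    by (simp add: bounded_linear_imp_has_derivative bounded_linear_vec_nth)
  have e: "((\<lambda>y::real^3. exp (y $ 3)) has_derivative (\<lambda>h. E * h $ 3)) (at x)"
    unfolding E_def by (rule has_derivative_eq_rhs[OF DERIV_compose_FDERIV[OF DERIV_exp nth]]) (simp add: mult.commute)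
  have "((\<lambda>y. exp (y $ 3) *\<^sub>R (p + y $ 1 *\<^sub>R q + y $ 2 *\<^sub>R r) + u) has_derivative
     (\<lambda>h. (exp (x $ 3) *\<^sub>R ((0 + h $ 1 *\<^sub>R q) + h $ 2 *\<^sub>R r) + (E * h $ 3) *\<^sub>R (p + x $ 1 *\<^sub>R q + x $ 2 *\<^sub>R r)) + 0)) (at x)"
    by (intro has_derivative_add has_derivative_scaleR has_derivative_scaleR_left has_derivative_const nth e)
  moreover have "(\<lambda>h. (exp (x $ 3) *\<^sub>R ((0 + h $ 1 *\<^sub>R q) + h $ 2 *\<^sub>R r) + (E * h $ 3) *\<^sub>R (p + x $ 1 *\<^sub>R q + x $ 2 *\<^sub>R r)) + 0) = D"
    by (simp add: fun_eq_iff D_def algebra_simps flip: E_def)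
  ultimately have "((\<lambda>y. exp (y $ 3) *\<^sub>R (p + y $ 1 *\<^sub>R q + y $ 2 *\<^sub>R r) + u) has_derivative D) (at x)" by simp
  moreover have "\<forall>\<^sub>F y in at x. exp (y $ 3) *\<^sub>R (p + y $ 1 *\<^sub>R q + y $ 2 *\<^sub>R r) + u = zmap y"
    using ev' by (auto simp: eventually_at_filter elim: eventually_mono)
  ultimately have "(zmap has_derivative D) (at x)"
    by (rule has_derivative_transform_eventually) (use eventually_nhds_x_imp_x[OF ev'] in auto)
  moreover have "det (matrix D) = E ^ 3 * (q1 * (r2 * p3 - r3 * p2) - r1 * (q2 * p3 - q3 * p2) + p1 * (q2 * r3 - q3 * r2))"
    by (simp add: det_3 matrix_def D_def axis_def pqru) algebra
  ultimately show ?thesis unfolding det E_def by auto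
qed

lemma eventually_pos:
  fixes g :: "'a::topological_space \<Rightarrow> real"
  assumes "continuous_on UNIV g" "g x > 0"
  shows "\<forall>\<^sub>F y in nhds x. g y > 0"
proof -
  have "open {y. 0 < g y}" using assms(1) by (intro open_Collect_less continuous_intros)
  then show ?thesis using assms(2) by (auto simp: eventually_nhds)
qed

lemma tri_minus: "tri (- x) = - tri x"
proof -
  obtain j :: int where j: "\<bar>x - 2 * of_int j\<bar> \<le> 1" using ex_cell by blast
  have "tri (- x) = sg (- j) * (- x - 2 * of_int (- j))"
    using j by (intro tri_cell) auto
  then show ?thesis using tri_cell[OF j] by (simp add: sg_def)
qed

lemma smin_left: "\<bar>x\<bar> \<le> \<bar>y\<bar> \<Longrightarrow> smin x y = sgn y * x"
  by (auto simp: smin_def sgn_if abs_if split: if_splits)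

lemma smin_right: "\<bar>y\<bar> \<le> \<bar>x\<bar> \<Longrightarrow> smin x y = sgn x * y"
  by (auto simp: smin_def sgn_if abs_if split: if_splits)

text \<open>Here \<open>\<beta>\<close> tells the half of the cell; on an open half cell both waves
  are affine.\<close>

lemma cell_interior:
  assumes "x \<notin> \<int>"
  obtains j :: int and \<beta> :: real where "\<beta> = 1 \<or> \<beta> = - 1" "0 < \<beta> * (x - 2 * of_int j)" "\<beta> * (x - 2 * of_int j) < 1"
proof -
  obtain j :: int where j: "\<bar>x - 2 * of_int j\<bar> \<le> 1" using ex_cell by blast
  have "x \<noteq> of_int (2 * j)" "x \<noteq> of_int (2 * j + 1)" "x \<noteq> of_int (2 * j - 1)" using assms Ints_of_int by metis+
  then have ne: "x - 2 * of_int j \<noteq> 0" "x - 2 * of_int j \<noteq> 1" "x - 2 * of_int j \<noteq> - 1" by auto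
  define \<beta> :: real where "\<beta> = (if x - 2 * of_int j > 0 then 1 else - 1)"
  have "\<beta> = 1 \<or> \<beta> = - 1" "0 < \<beta> * (x - 2 * of_int j)" "\<beta> * (x - 2 * of_int j) < 1"
    using j ne by (auto simp: \<beta>_def abs_if split: if_splits)
  then show thesis by (rule that)
qed

lemma cell_interior_values:
  fixes j :: int
  assumes "\<beta> = 1 \<or> \<beta> = - 1" "0 < \<beta> * (x - 2 * of_int j)" "\<beta> * (x - 2 * of_int j) < 1"
  shows "tri x = sg j * (x - 2 * of_int j)" "cotri x = sg j * (1 - \<beta> * (x - 2 * of_int j))"
    "sgn (tri x) = sg j * \<beta>" "sgn (cotri x) = sg j"
proof -
  have a: "\<bar>x - 2 * of_int j\<bar> = \<beta> * (x - 2 * of_int j)" using assms by auto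
  show t: "tri x = sg j * (x - 2 * of_int j)" "cotri x = sg j * (1 - \<beta> * (x - 2 * of_int j))"
    using tri_cell[of x j] cotri_cell[of x j] a assms by auto
  show "sgn (tri x) = sg j * \<beta>" "sgn (cotri x) = sg j"
    unfolding t using assms sg_cases[of j] by (auto simp: sgn_if)
qed

text \<open>Off the kinks every absolute value, \<open>min\<close> and \<open>max\<close> keeps its
  branch nearby, so \<open>zmap\<close> has the local normal form. Four cases remain: the two sides
  of the fold in the inserted piece, and the two kinds of sides of the pyramids.\<close>

lemma zmap_has_derivative:
  assumes x: "x \<notin> kinks"
  shows "\<exists>D. (zmap has_derivative D) (at x) \<and> det (matrix D) = exp (x $ 3) ^ 3"
proof -
  define wd where "wd y = 2 - exp (- y $ 3) - 2 * \<bar>y $ 1\<bar>" for y :: "real^3"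
  have ne: "x $ 1 \<notin> \<int>" "wd x \<noteq> 0" "x $ 2 \<noteq> 0" "\<bar>x $ 2\<bar> - slit_width x \<notin> \<int>"
    "2 * \<bar>x $ 2\<bar> \<noteq> slit_width x" "\<bar>cotri (x $ 1)\<bar> \<noteq> \<bar>tri (\<bar>x $ 2\<bar> - slit_width x)\<bar>"
    using x by (auto simp: kinks_def wd_def)
  define \<sigma> :: real where "\<sigma> = (if x $ 2 > 0 then 1 else - 1)"
  define \<alpha> :: real where "\<alpha> = (if x $ 1 > 0 then 1 else - 1)"
  have \<sigma>: "\<sigma> = 1 \<or> \<sigma> = - 1" "\<alpha> = 1 \<or> \<alpha> = - 1" by (auto simp: \<sigma>_def \<alpha>_def)
  have "x $ 1 \<noteq> 0" using ne(1) by auto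
  then have pos: "\<sigma> * x $ 2 > 0" "\<alpha> * x $ 1 > 0" using ne(3) by (auto simp: \<sigma>_def \<alpha>_def)
  have "\<forall>\<^sub>F y in nhds x. \<sigma> * y $ 2 > 0" "\<forall>\<^sub>F y in nhds x. \<alpha> * y $ 1 > 0"
    by (rule eventually_pos; use pos in \<open>auto intro!: continuous_intros\<close>)+
  then have ev1: "\<forall>\<^sub>F y in nhds x. \<sigma> * y $ 2 > 0 \<and> \<bar>y $ 2\<bar> = \<sigma> * y $ 2 \<and> \<bar>y $ 1\<bar> = \<alpha> * y $ 1"
    by eventually_elim (use \<sigma> in auto)
  have e: "exp t * exp (- t) = 1" for t :: real by (simp add: exp_minus)
  have cont_dp: "continuous_on UNIV (\<lambda>y. \<bar>y $ 2\<bar> - slit_width y)"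
    by (intro continuous_intros continuous_on_slit_width)
  show ?thesis
  proof (cases "\<bar>x $ 2\<bar> < slit_width x")
    case True
    then have "slit_width x > 0" by linarith
    then have wx: "wd x > 0" by (simp add: slit_width_def wd_def max_def split: if_splits)
    have "\<forall>\<^sub>F y in nhds x. wd y > 0"
      by (rule eventually_pos) (use wx in \<open>auto simp: wd_def intro!: continuous_intros\<close>)
    moreover have "\<forall>\<^sub>F y in nhds x. 0 < slit_width y - \<bar>y $ 2\<bar>"
      by (rule eventually_pos) (use True in \<open>auto intro!: continuous_intros continuous_on_slit_width\<close>)
    ultimately have ev2: "\<forall>\<^sub>F y in nhds x. zmap y = vector [exp (y $ 3) * y $ 1,
       \<sigma> * (exp (y $ 3) * min (\<sigma> * y $ 2) (wd y - \<sigma> * y $ 2)), exp (y $ 3) * (1 - \<sigma> * y $ 2 - 2 * \<alpha> * y $ 1) - 1]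
       \<and> slit_width y = wd y \<and> wd y = 2 - exp (- y $ 3) - 2 * \<alpha> * y $ 1"
      using ev1
    proof eventually_elim
      case (elim y)
      have sw: "slit_width y = wd y" using elim by (simp add: slit_width_def wd_def)
      have "y = inner_pt \<sigma> (y $ 1) (\<sigma> * y $ 2) (y $ 3)"
        using \<sigma>(1) by (intro vec3_eqI) (auto simp: inner_pt_def)
      moreover have "0 \<le> \<sigma> * y $ 2" "\<sigma> * y $ 2 \<le> 2 - exp (- y $ 3) - 2 * \<bar>y $ 1\<bar>"
        using elim sw by (simp_all add: wd_def)
      ultimately have "zmap y = vector [exp (y $ 3) * y $ 1,
          \<sigma> * (exp (y $ 3) * min (\<sigma> * y $ 2) (2 - exp (- y $ 3) - 2 * \<bar>y $ 1\<bar> - \<sigma> * y $ 2)),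
          exp (y $ 3) * (1 - \<sigma> * y $ 2 - 2 * \<bar>y $ 1\<bar>) - 1]"
        using zmap_inner[OF \<sigma>(1)] by metis
      then show ?case using sw elim by (simp add: wd_def mult.assoc)
    qed
    show ?thesis
    proof (cases "2 * \<bar>x $ 2\<bar> < slit_width x")
      case True
      have "\<forall>\<^sub>F y in nhds x. 0 < slit_width y - 2 * \<bar>y $ 2\<bar>"
        by (rule eventually_pos) (use True in \<open>auto intro!: continuous_intros continuous_on_slit_width\<close>)
      with ev1 ev2 have "\<forall>\<^sub>F y in nhds x. zmap y $ 1 = exp (y $ 3) * (0 + 1 * y $ 1 + 0 * y $ 2) + 0 \<and>
          zmap y $ 2 = exp (y $ 3) * (0 + 0 * y $ 1 + 1 * y $ 2) + 0 \<and>
          zmap y $ 3 = exp (y $ 3) * (1 + - 2 * \<alpha> * y $ 1 + - \<sigma> * y $ 2) + - 1"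
      proof eventually_elim
        case (elim y)
        then have "min (\<sigma> * y $ 2) (wd y - \<sigma> * y $ 2) = \<sigma> * y $ 2" by simp
        moreover have "\<sigma> * (exp (y $ 3) * (\<sigma> * y $ 2)) = exp (y $ 3) * y $ 2" using \<sigma>(1) by auto
        ultimately show ?case using elim by (simp add: algebra_simps)
      qed
      then show ?thesis by (rule zmap_has_derivative_local) simp
    next
      case False
      then have "2 * \<bar>x $ 2\<bar> - slit_width x > 0" using ne(5) by simp
      then have "\<forall>\<^sub>F y in nhds x. 0 < 2 * \<bar>y $ 2\<bar> - slit_width y"
        by (intro eventually_pos continuous_intros continuous_on_slit_width)
      with ev1 ev2 have "\<forall>\<^sub>F y in nhds x. zmap y $ 1 = exp (y $ 3) * (0 + 1 * y $ 1 + 0 * y $ 2) + 0 \<and>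
          zmap y $ 2 = exp (y $ 3) * (2 * \<sigma> + (- 2 * \<sigma> * \<alpha>) * y $ 1 + (- 1) * y $ 2) + - \<sigma> \<and>
          zmap y $ 3 = exp (y $ 3) * (1 + - 2 * \<alpha> * y $ 1 + - \<sigma> * y $ 2) + - 1"
      proof eventually_elim
        case (elim y)
        then have m: "min (\<sigma> * y $ 2) (wd y - \<sigma> * y $ 2) = 2 - exp (- y $ 3) - 2 * \<alpha> * y $ 1 - \<sigma> * y $ 2" by simp
        have "\<sigma> * (exp (y $ 3) * (2 - exp (- y $ 3) - 2 * \<alpha> * y $ 1 - \<sigma> * y $ 2))
            = \<sigma> * (2 * exp (y $ 3) - exp (y $ 3) * exp (- y $ 3) - exp (y $ 3) * (2 * \<alpha> * y $ 1)) - (\<sigma> * \<sigma>) * (exp (y $ 3) * y $ 2)"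
          by (simp add: algebra_simps)
        also have "\<dots> = \<sigma> * (2 * exp (y $ 3) - 1 - exp (y $ 3) * (2 * \<alpha> * y $ 1)) - exp (y $ 3) * y $ 2"
          using \<sigma>(1) by (auto simp: e)
        finally show ?case
          using elim m by (simp add: algebra_simps)
      qed
      then show ?thesis by (rule zmap_has_derivative_local) (use \<sigma> in auto)
    qed
  next
    case False
    define dp where "dp y = \<bar>y $ 2\<bar> - slit_width y" for y
    have dpx: "dp x > 0" using False ne(4) by (cases "\<bar>x $ 2\<bar> = slit_width x") (auto simp: dp_def)
    have cdp: "continuous_on A dp" for A
      unfolding dp_def[abs_def] by (intro continuous_intros continuous_on_slit_width)
    \<comment> \<open>Displaced and undisplaced beams are treated in one computation;
      \<open>\<gamma>\<close> tells which kind is present near \<open>x\<close>.\<close>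
    define \<gamma> :: real where "\<gamma> = (if wd x > 0 then 1 else 0)"
    have sw_ev: "\<forall>\<^sub>F y in nhds x. slit_width y = \<gamma> * wd y"
    proof (cases "wd x > 0")
      case True
      have "\<forall>\<^sub>F y in nhds x. wd y > 0"
        by (rule eventually_pos) (use True in \<open>auto simp: wd_def intro!: continuous_intros\<close>)
      then show ?thesis by eventually_elim (use True in \<open>simp add: \<gamma>_def slit_width_def wd_def\<close>)
    next
      case F: False
      have "\<forall>\<^sub>F y in nhds x. - wd y > 0"
        by (rule eventually_pos) (use F ne(2) in \<open>auto simp: wd_def intro!: continuous_intros\<close>)
      then show ?thesis by eventually_elim (use F in \<open>simp add: \<gamma>_def slit_width_def wd_def\<close>)
    qed
    obtain j \<alpha>' where j: "\<alpha>' = 1 \<or> \<alpha>' = - 1" "0 < \<alpha>' * (x $ 1 - 2 * of_int j)" "\<alpha>' * (x $ 1 - 2 * of_int j) < 1"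
      using cell_interior[OF ne(1)] by blast
    obtain k \<beta> where k: "\<beta> = 1 \<or> \<beta> = - 1" "0 < \<beta> * (dp x - 2 * of_int k)" "\<beta> * (dp x - 2 * of_int k) < 1"
      using cell_interior[OF ne(4)] unfolding dp_def by blast
    have "\<forall>\<^sub>F y in nhds x. 0 < \<alpha>' * (y $ 1 - 2 * of_int j)" "\<forall>\<^sub>F y in nhds x. 0 < 1 - \<alpha>' * (y $ 1 - 2 * of_int j)"
      "\<forall>\<^sub>F y in nhds x. 0 < \<beta> * (dp y - 2 * of_int k)" "\<forall>\<^sub>F y in nhds x. 0 < 1 - \<beta> * (dp y - 2 * of_int k)" "\<forall>\<^sub>F y in nhds x. 0 < dp y"
      by (rule eventually_pos; use j k dpx in \<open>auto intro!: continuous_intros cdp\<close>)+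
    with ev1 sw_ev have ev3: "\<forall>\<^sub>F y in nhds x. zmap y = exp (y $ 3) *\<^sub>R vector [tri (y $ 1), - \<sigma> * smin (cotri (y $ 1)) (tri (dp y)), - cotri (dp y)] \<and>
       tri (y $ 1) = sg j * (y $ 1 - 2 * of_int j) \<and> cotri (y $ 1) = sg j * (1 - \<alpha>' * (y $ 1 - 2 * of_int j)) \<and>
       sgn (tri (dp y)) = sg k * \<beta> \<and> sgn (cotri (y $ 1)) = sg j \<and>
       tri (dp y) = sg k * (dp y - 2 * of_int k) \<and> cotri (dp y) = sg k * (1 - \<beta> * (dp y - 2 * of_int k)) \<and>
       dp y = \<sigma> * y $ 2 - \<gamma> * (2 - exp (- y $ 3) - 2 * \<alpha> * y $ 1)"
    proof eventually_elim
      case (elim y)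
      have v1: "0 < \<alpha>' * (y $ 1 - 2 * of_int j)" "\<alpha>' * (y $ 1 - 2 * of_int j) < 1"
        and v2: "0 < \<beta> * (dp y - 2 * of_int k)" "\<beta> * (dp y - 2 * of_int k) < 1" using elim by simp_all
      have c0: "slit_width y \<ge> 0" by (rule slit_width_bounds)
      have "\<bar>y $ 2\<bar> > slit_width y" using elim by (simp add: dp_def)
      then have "clamp_abs (slit_width y) (y $ 2) = \<sigma> * slit_width y"
        using elim \<sigma>(1) c0 by (auto simp: clamp_abs_def)
      then have s': "y $ 2 - clamp_abs (slit_width y) (y $ 2) = \<sigma> * dp y"
        using elim \<sigma>(1) by (auto simp: dp_def)
      have ts: "tri (\<sigma> * dp y) = \<sigma> * tri (dp y)" using \<sigma>(1) tri_minus by auto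
      have sm: "smin a (\<sigma> * b) = \<sigma> * smin a b" for a b using \<sigma>(1) by (auto simp: smin_def)
      have m0: "max 0 (slit_width y - \<bar>y $ 2\<bar>) = 0" using \<open>\<bar>y $ 2\<bar> > slit_width y\<close> by simp
      have "zdir y = vector [tri (y $ 1), - \<sigma> * smin (cotri (y $ 1)) (tri (dp y)), - cotri (dp y)]"
        by (rule vec3_eqI) (simp_all add: zdir_nth m0 s' ts sm flip: dp_def)
      then have "zmap y = exp (y $ 3) *\<^sub>R vector [tri (y $ 1), - \<sigma> * smin (cotri (y $ 1)) (tri (dp y)), - cotri (dp y)]"
        by (simp add: zmap_def)
      moreover have "dp y = \<sigma> * y $ 2 - \<gamma> * (2 - exp (- y $ 3) - 2 * \<alpha> * y $ 1)"
        using elim by (simp add: dp_def wd_def)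
      ultimately show ?case
        using cell_interior_values[OF j(1) v1] cell_interior_values[OF k(1) v2] by blast
    qed
    have q: "sg i * sg i = 1" "\<sigma> * \<sigma> = 1" "\<beta> * \<beta> = 1" for i using \<sigma> k by auto
    \<comment> \<open>The exponential hidden in the slit width cancels against the factor
      \<open>exp (y $ 3)\<close> and becomes an additive constant. This is the origin of the terms
      \<open>u1\<close>, \<open>u2\<close>, \<open>u3\<close> in the normal form.\<close>
    have third: "exp (y $ 3) * - (sg k * (1 - \<beta> * (d - 2 * of_int k))) =
      exp (y $ 3) * (sg k * (- 2 * \<gamma> * \<beta> - 1 - 2 * \<beta> * of_int k) + (2 * sg k * \<beta> * \<gamma> * \<alpha>) * y $ 1 + (sg k * \<beta> * \<sigma>) * y $ 2) + sg k * \<beta> * \<gamma>"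
      if d: "d = \<sigma> * y $ 2 - \<gamma> * (2 - exp (- y $ 3) - 2 * \<alpha> * y $ 1)" for y :: "real^3" and d
      using d e[of "y $ 3"] by simp algebra
    show ?thesis
    proof (cases "\<bar>cotri (x $ 1)\<bar> < \<bar>tri (dp x)\<bar>")
      case True
      have "\<forall>\<^sub>F y in nhds x. 0 < \<bar>tri (dp y)\<bar> - \<bar>cotri (y $ 1)\<bar>"
        using True by (intro eventually_pos continuous_intros continuous_on_compose2[OF continuous_on_tri[of UNIV] cdp]
          continuous_on_compose2[OF continuous_on_cotri[of UNIV]]) auto
      with ev3 have "\<forall>\<^sub>F y in nhds x. zmap y $ 1 = exp (y $ 3) * ((- 2 * sg j * of_int j) + sg j * y $ 1 + 0 * y $ 2) + 0 \<and>
         zmap y $ 2 = exp (y $ 3) * ((- \<sigma> * sg k * \<beta> * sg j * (1 + 2 * \<alpha>' * of_int j)) + (\<sigma> * sg k * \<beta> * sg j * \<alpha>') * y $ 1 + 0 * y $ 2) + 0 \<and>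
         zmap y $ 3 = exp (y $ 3) * (sg k * (- 2 * \<gamma> * \<beta> - 1 - 2 * \<beta> * of_int k) + (2 * sg k * \<beta> * \<gamma> * \<alpha>) * y $ 1 + (sg k * \<beta> * \<sigma>) * y $ 2) + sg k * \<beta> * \<gamma>"
      proof eventually_elim
        case (elim y)
        have zv: "zmap y = exp (y $ 3) *\<^sub>R vector [tri (y $ 1), - \<sigma> * smin (cotri (y $ 1)) (tri (dp y)), - cotri (dp y)]"
          and t1: "tri (y $ 1) = sg j * (y $ 1 - 2 * of_int j)"
          and cd: "cotri (dp y) = sg k * (1 - \<beta> * (dp y - 2 * of_int k))"
          using elim by blast+
        have "smin (cotri (y $ 1)) (tri (dp y)) = sgn (tri (dp y)) * cotri (y $ 1)"
          using elim by (intro smin_left) linarith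
        moreover have "sgn (tri (dp y)) = sg k * \<beta>" "cotri (y $ 1) = sg j * (1 - \<alpha>' * (y $ 1 - 2 * of_int j))"
          using elim by blast+
        ultimately have sm: "smin (cotri (y $ 1)) (tri (dp y)) = sg k * \<beta> * (sg j * (1 - \<alpha>' * (y $ 1 - 2 * of_int j)))"
          by (simp only:)
        have d: "dp y = \<sigma> * y $ 2 - \<gamma> * (2 - exp (- y $ 3) - 2 * \<alpha> * y $ 1)" using elim by blast
        have "zmap y $ 1 = exp (y $ 3) * (sg j * (y $ 1 - 2 * of_int j))"
          "zmap y $ 2 = exp (y $ 3) * (- \<sigma> * (sg k * \<beta> * (sg j * (1 - \<alpha>' * (y $ 1 - 2 * of_int j)))))"
          "zmap y $ 3 = exp (y $ 3) * - (sg k * (1 - \<beta> * (dp y - 2 * of_int k)))"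
          unfolding sm[symmetric] t1[symmetric] cd[symmetric] by (simp_all add: zv)
        note z = this(1,2) this(3)[unfolded third[OF d]]
        show ?case unfolding z by (simp add: algebra_simps)
      qed
      then show ?thesis
        by (rule zmap_has_derivative_local) (use q(1)[of j] q(1)[of k] q(2,3) in algebra)
    next
      case False
      then have "0 < \<bar>cotri (x $ 1)\<bar> - \<bar>tri (dp x)\<bar>" using ne(6) by (simp add: dp_def)
      then have "\<forall>\<^sub>F y in nhds x. 0 < \<bar>cotri (y $ 1)\<bar> - \<bar>tri (dp y)\<bar>"
        by (intro eventually_pos continuous_intros continuous_on_compose2[OF continuous_on_tri[of UNIV] cdp]
          continuous_on_compose2[OF continuous_on_cotri[of UNIV]]) auto
      with ev3 have "\<forall>\<^sub>F y in nhds x. zmap y $ 1 = exp (y $ 3) * ((- 2 * sg j * of_int j) + sg j * y $ 1 + 0 * y $ 2) + 0 \<and>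
         zmap y $ 2 = exp (y $ 3) * ((\<sigma> * sg j * sg k * (2 * \<gamma> + 2 * of_int k)) + (- 2 * \<sigma> * sg j * sg k * \<gamma> * \<alpha>) * y $ 1 + (- sg j * sg k) * y $ 2) + (- \<sigma> * sg j * sg k * \<gamma>) \<and>
         zmap y $ 3 = exp (y $ 3) * (sg k * (- 2 * \<gamma> * \<beta> - 1 - 2 * \<beta> * of_int k) + (2 * sg k * \<beta> * \<gamma> * \<alpha>) * y $ 1 + (sg k * \<beta> * \<sigma>) * y $ 2) + sg k * \<beta> * \<gamma>"
      proof eventually_elim
        case (elim y)
        have zv: "zmap y = exp (y $ 3) *\<^sub>R vector [tri (y $ 1), - \<sigma> * smin (cotri (y $ 1)) (tri (dp y)), - cotri (dp y)]"
          and t1: "tri (y $ 1) = sg j * (y $ 1 - 2 * of_int j)"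
          and cd: "cotri (dp y) = sg k * (1 - \<beta> * (dp y - 2 * of_int k))"
          using elim by blast+
        have "smin (cotri (y $ 1)) (tri (dp y)) = sgn (cotri (y $ 1)) * tri (dp y)"
          using elim by (intro smin_right) linarith
        moreover have "sgn (cotri (y $ 1)) = sg j" "tri (dp y) = sg k * (dp y - 2 * of_int k)"
          using elim by blast+
        ultimately have sm: "smin (cotri (y $ 1)) (tri (dp y)) = sg j * (sg k * (dp y - 2 * of_int k))"
          by (simp only:)
        have d: "dp y = \<sigma> * y $ 2 - \<gamma> * (2 - exp (- y $ 3) - 2 * \<alpha> * y $ 1)" using elim by blast
        have "zmap y $ 1 = exp (y $ 3) * (sg j * (y $ 1 - 2 * of_int j))"
          "zmap y $ 2 = exp (y $ 3) * (- \<sigma> * (sg j * (sg k * (dp y - 2 * of_int k))))"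
          "zmap y $ 3 = exp (y $ 3) * - (sg k * (1 - \<beta> * (dp y - 2 * of_int k)))"
          unfolding sm[symmetric] t1[symmetric] cd[symmetric] by (simp_all add: zv)
        note z = this(1,2) this(3)[unfolded third[OF d]]
        have z2: "exp (y $ 3) * (- \<sigma> * (sg j * (sg k * (dp y - 2 * of_int k)))) =
            exp (y $ 3) * ((\<sigma> * sg j * sg k * (2 * \<gamma> + 2 * of_int k)) + (- 2 * \<sigma> * sg j * sg k * \<gamma> * \<alpha>) * y $ 1 + (- sg j * sg k) * y $ 2) + (- \<sigma> * sg j * sg k * \<gamma>)"
          using d e[of "y $ 3"] q(2) by simp algebra
        show ?case unfolding z z2 by (simp add: algebra_simps)
      qed
      then show ?thesis
        by (rule zmap_has_derivative_local) (use q(1)[of j] q(1)[of k] q(2,3) in algebra)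
    qed
  qed
qed

lemma zmap_derivative_bound:
  assumes "(zmap has_derivative D) (at x)"
  shows "norm (D h) \<le> 60 * exp (x $ 3) * norm h"
proof (rule has_derivative_bound_lipschitz[OF assms open_ball])
  show "x \<in> ball x (1 / 2)" by simp
  show "(60 * exp (x $ 3))-lipschitz_on (ball x (1 / 2)) zmap"
  proof (rule lipschitz_onI)
    fix y z assume yz: "y \<in> ball x (1 / 2)" "z \<in> ball x (1 / 2)"
    then have "norm (y - z) \<le> 1"
      using norm_triangle_ineq4[of "x - z" "x - y"] by (simp add: dist_norm)
    then have "norm (zmap y - zmap z) \<le> 30 * exp (y $ 3) * norm (y - z)" by (rule zmap_lipschitz)
    also have "exp (y $ 3) \<le> exp (x $ 3 + 1 / 2)"
      using yz(1) component_le_norm_cart[of "x - y" 3] by (simp add: dist_norm)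
    also have "\<dots> \<le> exp (x $ 3) * 2"
      unfolding exp_add using abs_exp_minus_1[of "1 / 2"] by (intro mult_left_mono) auto
    finally show "dist (zmap y) (zmap z) \<le> 60 * exp (x $ 3) * dist y z"
      by (simp add: dist_norm mult_right_mono)
  qed simp
qed

lemma zmap_lipschitz_on_compact:
  assumes "compact K"
  shows "\<exists>L. L-lipschitz_on K zmap"
proof -
  obtain R where R: "\<And>x. x \<in> K \<Longrightarrow> norm x \<le> R" using compact_imp_bounded[OF assms] by (auto simp: bounded_iff)
  have E: "exp (x $ 3) \<le> exp R" if "x \<in> K" for x
    using R[OF that] component_le_norm_cart[of x 3] by simp
  have "(30 * exp R)-lipschitz_on K zmap"
  proof (rule lipschitz_onI)
    fix x y assume xy: "x \<in> K" "y \<in> K"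
    show "dist (zmap x) (zmap y) \<le> 30 * exp R * dist x y"
    proof (cases "norm (x - y) \<le> 1")
      case True
      then have "norm (zmap x - zmap y) \<le> 30 * exp (x $ 3) * norm (x - y)" by (rule zmap_lipschitz)
      also have "\<dots> \<le> 30 * exp R * norm (x - y)" using E[OF xy(1)] by (intro mult_right_mono) auto
      finally show ?thesis by (simp add: dist_norm)
    next
      case False
      have "norm (zmap x - zmap y) \<le> norm (zmap x) + norm (zmap y)" by (rule norm_triangle_ineq4)
      also have "\<dots> \<le> 5 * exp R + 5 * exp R"
        using norm_zmap[of x] norm_zmap[of y] E[OF xy(1)] E[OF xy(2)] by linarith
      also have "\<dots> \<le> 30 * exp R * norm (x - y)"
        using mult_left_mono[of 1 "norm (x - y)" "30 * exp R"] False exp_ge_zero[of R] by linarith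
      finally show ?thesis by (simp add: dist_norm)
    qed
  qed simp
  then show ?thesis ..
qed

lemma continuous_on_zmap: "continuous_on A zmap"
  by (rule continuous_on_subset[OF continuous_on_locally_lipschitz[OF open_UNIV zmap_lipschitz_on_compact] subset_UNIV])

section \<open>Dynamics\<close>

text \<open>The half space below height \<open>\<tau>\<close> lies in the basin, and above it the scaled map expands.\<close>
definition \<tau> :: real where "\<tau> = 20000"

text \<open>Normalized by \<open>\<kappa> * exp \<tau> = \<tau> / 8\<close>. As
  \<open>norm (zmap x) \<le> 5 * exp (x $ 3)\<close>, the lower half-space goes into the ball of
  radius \<open>5 * \<tau> / 8\<close>, whereas the expansion factor above it is at least
  \<open>\<tau> / (8 * 52)\<close>.\<close>

definition \<kappa> :: real where "\<kappa> = \<tau> * exp (- \<tau>) / 8"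

definition zero_map :: "real^3 \<Rightarrow> real^3" where
  "zero_map x = \<kappa> *\<^sub>R zmap x"

lemma tau_ge: "\<tau> \<ge> 20000" by (simp add: \<tau>_def)

lemma kappa_pos: "\<kappa> > 0" by (simp add: \<kappa>_def \<tau>_def)

lemma kappa_exp: "\<kappa> * exp t = \<tau> / 8 * exp (t - \<tau>)"
  by (simp add: \<kappa>_def exp_diff exp_minus field_simps)

lemma kappa_exp_ge: "t \<ge> \<tau> \<Longrightarrow> \<kappa> * exp t \<ge> \<tau> / 8"
  unfolding kappa_exp using tau_ge by simp

lemma kappa_le: "\<kappa> \<le> 1 / 8"
proof -
  have "\<tau> \<le> exp \<tau>" using exp_ge_add_one_self[of \<tau>] by linarith
  then have "\<tau> * exp (- \<tau>) \<le> 1" by (simp add: exp_minus field_simps)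
  then show ?thesis by (simp add: \<kappa>_def)
qed

lemma continuous_on_zero_map: "continuous_on A zero_map"
  unfolding zero_map_def[abs_def] by (intro continuous_intros continuous_on_zmap)

lemma zero_map_eq_0_iff: "zero_map x = 0 \<longleftrightarrow> x = 0"
  using kappa_pos by (simp add: zero_map_def zmap_eq_0_iff)

lemma norm_zero_map: "norm (zero_map x) \<le> 5 * (\<kappa> * exp (x $ 3))"
  unfolding zero_map_def using mult_left_mono[OF norm_zmap[of x], of \<kappa>] kappa_pos by (simp add: mult_ac)

lemma zero_map_lower_half:
  assumes "x $ 3 < \<tau>"
  shows "norm (zero_map x) < \<tau>" "zero_map x $ 3 < \<tau>"
proof -
  have "\<kappa> * exp (x $ 3) \<le> \<tau> / 8"
    unfolding kappa_exp using assms tau_ge by (simp add: mult_left_le)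
  then show n: "norm (zero_map x) < \<tau>" using norm_zero_map[of x] tau_ge by linarith
  then show "zero_map x $ 3 < \<tau>" using component_le_norm_cart[of "zero_map x" 3] by linarith
qed

lemma zero_map_lipschitz:
  "norm (x - y) \<le> 1 \<Longrightarrow> norm (zero_map x - zero_map y) \<le> 30 * (\<kappa> * exp (x $ 3)) * norm (x - y)"
  unfolding zero_map_def using mult_left_mono[OF zmap_lipschitz[of x y], of \<kappa>] kappa_pos
  by (simp add: mult_ac flip: scaleR_diff_right)

lemma zero_map_colipschitz:
  assumes "norm (Y - zero_map x) \<le> \<kappa> * exp (x $ 3) / 100"
  shows "\<exists>x'. zero_map x' = Y \<and> norm (x - x') \<le> 52 * norm (Y - zero_map x) / (\<kappa> * exp (x $ 3))"
proof -
  have eq: "Y - zero_map x = \<kappa> *\<^sub>R (Y /\<^sub>R \<kappa> - zmap x)"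
    using kappa_pos by (simp add: zero_map_def algebra_simps)
  have n: "norm (Y - zero_map x) = \<kappa> * norm (Y /\<^sub>R \<kappa> - zmap x)"
    unfolding eq using kappa_pos by simp
  then have "norm (Y /\<^sub>R \<kappa> - zmap x) \<le> exp (x $ 3) / 100"
    using assms kappa_pos by (simp add: mult_le_cancel_left_pos flip: times_divide_eq_right)
  from zmap_colipschitz[OF this] obtain x' where x': "zmap x' = Y /\<^sub>R \<kappa>"
    "norm (x - x') \<le> 52 * norm (Y /\<^sub>R \<kappa> - zmap x) / exp (x $ 3)" by blast
  have "zero_map x' = Y" using x'(1) kappa_pos by (simp add: zero_map_def)
  moreover have "norm (x - x') \<le> 52 * norm (Y - zero_map x) / (\<kappa> * exp (x $ 3))"
    unfolding n using x'(2) kappa_pos by simp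
  ultimately show ?thesis by blast
qed

section \<open>Expansion of balls and covering of shells\<close>

text \<open>The constant is \<open>416 = 8 * 52\<close>. The restriction on \<open>r\<close> keeps
  the target within \<open>E / 104\<close> of the image of \<open>x\<close>, in the range of the
  co-Lipschitz estimate.\<close>

lemma zero_map_expands:
  assumes x: "x $ 3 \<ge> \<tau>" and r: "0 < r" "r \<le> 1 / 2"
  shows "ball (zero_map x) (\<tau> / 416 * r) \<subseteq> zero_map ` ball x r"
proof
  fix Y assume "Y \<in> ball (zero_map x) (\<tau> / 416 * r)"
  then have d: "norm (Y - zero_map x) < \<tau> / 416 * r" by (simp add: dist_norm norm_minus_commute)
  define E where "E = \<kappa> * exp (x $ 3)"
  have E: "E \<ge> \<tau> / 8" unfolding E_def by (rule kappa_exp_ge[OF x])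
  then have E0: "E > 0" using tau_ge by linarith
  have "\<tau> / 8 / 52 * r \<le> E / 52 * r" using E r by (intro mult_right_mono divide_right_mono) auto
  then have d2: "norm (Y - zero_map x) < E / 52 * r" using d by simp
  also have "\<dots> \<le> E / 52 * (1 / 2)" using E0 r by (intro mult_left_mono) auto
  also have "\<dots> \<le> E / 100" using E0 by simp
  finally obtain x' where x': "zero_map x' = Y" "norm (x - x') \<le> 52 * norm (Y - zero_map x) / E"
    using zero_map_colipschitz[of Y x] unfolding E_def by (meson less_imp_le)
  have "52 * norm (Y - zero_map x) / E < r" using d2 E0 by (simp add: field_simps)
  then have "x' \<in> ball x r" using x'(2) by (simp add: dist_norm)
  then show "Y \<in> zero_map ` ball x r" using x'(1) by blast
qed

lemma znorm_scaleR: "znorm (c *\<^sub>R Y) = \<bar>c\<bar> * znorm Y"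
  by (simp add: znorm_def abs_mult max_mult_distrib_left distrib_left)

lemma zero_map_covers:
  fixes y p :: "real^3"
  assumes "y \<noteq> 0"
  shows "\<exists>x. zero_map x = y \<and> x $ 3 = ln (znorm y / \<kappa>) \<and> \<bar>x $ 1 - p $ 1\<bar> \<le> 2 \<and> \<bar>x $ 2 - p $ 2\<bar> \<le> 8"
proof -
  have "y /\<^sub>R \<kappa> \<noteq> 0" using assms kappa_pos by simp
  from zmap_covers[OF this, of p] obtain x where "zmap x = y /\<^sub>R \<kappa>" "x $ 3 = ln (znorm (y /\<^sub>R \<kappa>))"
    "\<bar>x $ 1 - p $ 1\<bar> \<le> 2" "\<bar>x $ 2 - p $ 2\<bar> \<le> 8" by blast
  then show ?thesis
    using kappa_pos by (intro exI[of _ x]) (simp add: zero_map_def znorm_scaleR divide_inverse_commute)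
qed

text \<open>Some preimage lies within \<open>2 + 8 + 10 = 20\<close> of \<open>p\<close>: two
  horizontal bounds and the height window allowed by the hypotheses on \<open>y\<close>.\<close>

lemma zero_map_ball_covers_shell:
  assumes R: "R \<ge> 21" and y: "\<kappa> * exp (p $ 3) \<le> znorm y" "znorm y \<le> \<kappa> * exp (p $ 3 + 10)"
  shows "y \<in> zero_map ` ball p R"
proof -
  have N: "znorm y > 0" using y(1) kappa_pos by (smt (verit) exp_gt_zero mult_pos_pos)
  then have "y \<noteq> 0" by (auto simp: znorm_def)
  from zero_map_covers[OF this, of p] obtain x where x: "zero_map x = y" "x $ 3 = ln (znorm y / \<kappa>)"
    "\<bar>x $ 1 - p $ 1\<bar> \<le> 2" "\<bar>x $ 2 - p $ 2\<bar> \<le> 8" by blast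
  have z: "znorm y / \<kappa> > 0" using N kappa_pos by simp
  have "exp (x $ 3) = znorm y / \<kappa>" using z by (simp add: x(2))
  then have "exp (p $ 3) \<le> exp (x $ 3)" "exp (x $ 3) \<le> exp (p $ 3 + 10)"
    using y kappa_pos by (simp_all add: pos_le_divide_eq pos_divide_le_eq mult.commute)
  then have "p $ 3 \<le> x $ 3" "x $ 3 \<le> p $ 3 + 10" by simp_all
  then have "norm (x - p) \<le> 20" using norm_le_l1_3[of "x - p"] x(3,4) by simp
  then have "x \<in> ball p R" using R by (simp add: dist_norm norm_minus_commute)
  then show ?thesis using x(1) by blast
qed

definition shell :: "real \<Rightarrow> (real^3) set" where
  "shell M = {y. M / 2 \<le> znorm y \<and> znorm y \<le> M}"

text \<open>The shell contains a column around first coordinate \<open>3 * M / 4\<close> with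
  heights in \<open>[- M / 2, M / 2]\<close>: there
  \<open>znorm x = \<bar>x $ 1\<bar> + \<bar>x $ 2\<bar>\<close>, and the horizontal errors
  \<open>2\<close> and \<open>8\<close> fit inside the shell once \<open>M \<ge> 40\<close>.\<close>

lemma zero_map_shell_covers:
  assumes M: "M \<ge> 40" and y: "\<kappa> * exp (- M / 2) \<le> znorm y" "znorm y \<le> \<kappa> * exp (M / 2)"
  shows "y \<in> zero_map ` shell M"
proof -
  have N: "znorm y > 0" using y(1) kappa_pos by (smt (verit) exp_gt_zero mult_pos_pos)
  then have "y \<noteq> 0" by (auto simp: znorm_def)
  from zero_map_covers[OF this, of "vector [3 * M / 4, 0, 0]"] obtain x where x: "zero_map x = y" "x $ 3 = ln (znorm y / \<kappa>)"
    "\<bar>x $ 1 - 3 * M / 4\<bar> \<le> 2" "\<bar>x $ 2\<bar> \<le> 8" by auto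
  have z: "znorm y / \<kappa> > 0" using N kappa_pos by simp
  have "exp (x $ 3) = znorm y / \<kappa>" using z by (simp add: x(2))
  then have "exp (- M / 2) \<le> exp (x $ 3)" "exp (x $ 3) \<le> exp (M / 2)"
    using y kappa_pos by (simp_all add: pos_le_divide_eq pos_divide_le_eq mult.commute)
  then have "- M / 2 \<le> x $ 3" "x $ 3 \<le> M / 2" by (simp_all only: exp_le_cancel_iff)
  then have x3: "\<bar>x $ 3\<bar> \<le> M / 2" by linarith
  have "max \<bar>x $ 1\<bar> \<bar>x $ 3\<bar> = \<bar>x $ 1\<bar>" using x(3) x3 M by linarith
  then have "znorm x = \<bar>x $ 2\<bar> + \<bar>x $ 1\<bar>" by (simp add: znorm_def)
  then have "x \<in> shell M" using x(3,4) M unfolding shell_def by (simp; linarith)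
  then show ?thesis using x(1) by blast
qed

lemma kappa_exp_growth:
  assumes "M \<ge> 4 * \<tau>"
  shows "2 * M \<le> \<kappa> * exp (M / 2)"
proof -
  have M: "M \<ge> 80000" using assms tau_ge by linarith
  have "1 + M / 4 + (M / 4)\<^sup>2 / 2 \<le> exp (M / 4)" using M by (intro exp_lower_Taylor_quadratic) auto
  moreover have "(M / 4)\<^sup>2 / 2 = M * (M / 32)" by (simp add: power2_eq_square)
  moreover have "M * 2 \<le> M * (M / 32)" using M by (intro mult_left_mono) auto
  ultimately have "2 * M \<le> exp (M / 4)" using M by linarith
  also have "\<dots> \<le> exp (M / 2 - \<tau>)" using assms by simp
  also have "\<dots> \<le> \<tau> / 8 * exp (M / 2 - \<tau>)" using tau_ge by simp
  finally show ?thesis unfolding kappa_exp .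
qed

lemma funpow_Suc_image: "(f ^^ Suc n) ` U = f ` (f ^^ n) ` U"
  by (simp add: image_comp)

text \<open>A step replaces the outer radius \<open>M'\<close> by
  \<open>\<kappa> * exp (M' / 2)\<close>, at least twice as large, and also covers inwards down to
  \<open>\<kappa> * exp (- M' / 2)\<close>. Both ends escape, so every nonzero point is
  reached.\<close>

lemma shell_orbit_covers:
  assumes "shell M \<subseteq> (zero_map ^^ n) ` U" "M \<ge> 4 * \<tau>"
  shows "UNIV - {0} \<subseteq> forward_orbit zero_map U"
proof
  fix y :: "real^3" assume "y \<in> UNIV - {0}"
  then have N: "znorm y > 0" by (simp add: znorm_pos)
  have M0: "M \<ge> 80000" using assms(2) tau_ge by linarith
  have "\<exists>M'. shell M' \<subseteq> (zero_map ^^ (n + m)) ` U \<and> M' \<ge> 2 ^ m * M" for m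
  proof (induction m)
    case 0
    then show ?case using assms(1) by auto
  next
    case (Suc m)
    then obtain M' where M': "shell M' \<subseteq> (zero_map ^^ (n + m)) ` U" "M' \<ge> 2 ^ m * M" by blast
    have "1 * M \<le> 2 ^ m * M" using M0 by (intro mult_right_mono) auto
    then have ge: "M' \<ge> 4 * \<tau>" "M' \<ge> 40" using M'(2) assms(2) M0 by linarith+
    define M'' where "M'' = \<kappa> * exp (M' / 2)"
    have "shell M'' \<subseteq> zero_map ` shell M'"
    proof
      fix z assume z: "z \<in> shell M''"
      have "exp (- M' / 2) \<le> exp (M' / 2) / 2"
      proof -
        have "exp (- M' / 2) \<le> 1" using ge by simp
        moreover have "2 \<le> exp (M' / 2)" using exp_ge_add_one_self[of "M' / 2"] ge by linarith
        ultimately show ?thesis by linarith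
      qed
      then have "\<kappa> * exp (- M' / 2) \<le> M'' / 2"
        unfolding M''_def using mult_left_mono[of "exp (- M' / 2)" "exp (M' / 2) / 2" \<kappa>] kappa_pos by simp
      then show "z \<in> zero_map ` shell M'"
        using z by (intro zero_map_shell_covers ge) (auto simp: shell_def M''_def)
    qed
    then have "shell M'' \<subseteq> (zero_map ^^ (n + Suc m)) ` U"
      unfolding add_Suc_right funpow_Suc_image using image_mono[OF M'(1)] by (rule subset_trans)
    moreover have "2 ^ Suc m * M \<le> M''"
      using kappa_exp_growth[OF ge(1)] M'(2) by (simp add: M''_def)
    ultimately show ?case by blast
  qed
  note ex = this
  \<comment> \<open>One choice for both ends: \<open>M'\<close> exceeds \<open>znorm y\<close> as
    well as \<open>2 * \<kappa> / znorm y\<close>.\<close>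
  obtain m where m: "(znorm y + 2 * \<kappa> / znorm y) / M < 2 ^ m"
    using real_arch_pow[of 2] by auto
  obtain M' where M': "shell M' \<subseteq> (zero_map ^^ (n + m)) ` U" "M' \<ge> 2 ^ m * M" using ex by blast
  have "1 * M \<le> 2 ^ m * M" using M0 by (intro mult_right_mono) auto
  then have ge: "M' \<ge> 4 * \<tau>" "M' \<ge> 40" using M'(2) assms(2) M0 by linarith+
  have big: "znorm y + 2 * \<kappa> / znorm y \<le> M'"
    using m M'(2) M0 by (simp add: pos_divide_less_eq)
  have pos: "2 * \<kappa> / znorm y > 0" using N kappa_pos by simp
  have "\<kappa> * exp (- M' / 2) \<le> znorm y"
  proof -
    have "M' / 2 \<le> exp (M' / 2)" using exp_ge_add_one_self[of "M' / 2"] by linarith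
    then have "exp (- M' / 2) \<le> 2 / M'" using ge by (simp add: exp_minus field_simps)
    then have "\<kappa> * exp (- M' / 2) \<le> \<kappa> * (2 / M')" using kappa_pos by (intro mult_left_mono) auto
    also have "\<dots> \<le> znorm y"
    proof -
      have "2 * \<kappa> / znorm y \<le> M'" using big N by linarith
      then show ?thesis using N ge by (simp add: field_simps)
    qed
    finally show ?thesis .
  qed
  moreover have "znorm y \<le> \<kappa> * exp (M' / 2)"
    using kappa_exp_growth[OF ge(1)] big pos ge by linarith
  ultimately have "y \<in> zero_map ` shell M'" by (intro zero_map_shell_covers ge)
  then have "y \<in> (zero_map ^^ Suc (n + m)) ` U"
    unfolding funpow_Suc_image by (rule subsetD[OF image_mono[OF M'(1)]])
  then show "y \<in> forward_orbit zero_map U" unfolding forward_orbit_def by blast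
qed

section \<open>The basin and the Julia set\<close>

definition basin :: "(real^3) set" where
  "basin = (\<Union>n. {x. (zero_map ^^ n) x $ 3 < \<tau>})"

text \<open>Radii at least double, as \<open>\<tau> / 416 \<ge> 2\<close>, up to the cap
  \<open>1 / 2\<close>. One further step gives radius \<open>\<tau> / 832\<close>, which exceeds
  \<open>21\<close>, so the next image contains a shell. This last requirement dictates the size of
  \<open>\<tau>\<close>.\<close>

lemma expanding_orbit_covers:
  assumes U: "open U" "x \<in> U" and x: "x \<notin> basin"
  shows "UNIV - {0} \<subseteq> forward_orbit zero_map U"
proof -
  have h: "(zero_map ^^ n) x $ 3 \<ge> \<tau>" for n using x by (auto simp: basin_def not_less)
  obtain r where r: "r > 0" "ball x r \<subseteq> U" using U open_contains_ball by blast
  have grow: "ball ((zero_map ^^ n) x) (min (2 ^ n * r) (1 / 2)) \<subseteq> (zero_map ^^ n) ` U" for n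
  proof (induction n)
    case 0
    then show ?case using r by auto
  next
    case (Suc n)
    let ?m = "min (2 ^ n * r) (1 / 2)"
    have m: "0 < ?m" "?m \<le> 1 / 2" using r by auto
    have "min (2 ^ Suc n * r) (1 / 2) \<le> 2 * ?m" using r by auto
    also have "\<dots> \<le> \<tau> / 416 * ?m" using m tau_ge by (intro mult_right_mono) auto
    finally have "ball (zero_map ((zero_map ^^ n) x)) (min (2 ^ Suc n * r) (1 / 2)) \<subseteq> ball (zero_map ((zero_map ^^ n) x)) (\<tau> / 416 * ?m)"
      by (rule subset_ball)
    also have "\<dots> \<subseteq> zero_map ` ball ((zero_map ^^ n) x) ?m" by (rule zero_map_expands[OF h m])
    also have "\<dots> \<subseteq> zero_map ` (zero_map ^^ n) ` U" using Suc by blast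
    finally show ?case unfolding funpow_Suc_image by simp
  qed
  obtain n where "1 / 2 / r < 2 ^ n" using real_arch_pow[of 2] by auto
  then have "1 / 2 \<le> 2 ^ n * r" using r by (simp add: field_simps)
  then have "min (2 ^ n * r) (1 / 2) = 1 / 2" by simp
  then have "ball ((zero_map ^^ n) x) (1 / 2) \<subseteq> (zero_map ^^ n) ` U" using grow[of n] by (simp only:)
  then have "zero_map ` ball ((zero_map ^^ n) x) (1 / 2) \<subseteq> (zero_map ^^ Suc n) ` U" unfolding funpow_Suc_image by blast
  moreover have "ball (zero_map ((zero_map ^^ n) x)) (\<tau> / 416 * (1 / 2)) \<subseteq> zero_map ` ball ((zero_map ^^ n) x) (1 / 2)"
    by (rule zero_map_expands[OF h]) auto
  ultimately have b: "ball ((zero_map ^^ Suc n) x) (\<tau> / 832) \<subseteq> (zero_map ^^ Suc n) ` U" by simp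
  define p where "p = (zero_map ^^ Suc n) x"
  define M where "M = \<kappa> * exp (p $ 3 + 10)"
  have Ep: "\<kappa> * exp (p $ 3) \<ge> \<tau> / 8" unfolding p_def by (rule kappa_exp_ge[OF h])
  have e10: "exp (10::real) \<ge> 61"
    using exp_lower_Taylor_quadratic[of "10::real"] by (simp add: power2_eq_square)
  have Mge: "M \<ge> \<kappa> * exp (p $ 3) * 61"
    unfolding M_def exp_add using e10 kappa_pos by (simp add: mult.assoc[symmetric] mult_left_mono)
  have "shell M \<subseteq> zero_map ` ball p (\<tau> / 832)"
  proof
    fix y assume "y \<in> shell M"
    then have "\<kappa> * exp (p $ 3) \<le> znorm y" "znorm y \<le> \<kappa> * exp (p $ 3 + 10)"
      using Mge Ep tau_ge by (auto simp: shell_def M_def)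
    then show "y \<in> zero_map ` ball p (\<tau> / 832)" using tau_ge by (intro zero_map_ball_covers_shell) auto
  qed
  also have "\<dots> \<subseteq> (zero_map ^^ Suc (Suc n)) ` U"
    using b unfolding p_def[symmetric] funpow_Suc_image[where n = "Suc n"] by blast
  finally have "shell M \<subseteq> (zero_map ^^ Suc (Suc n)) ` U" .
  moreover have "M \<ge> 4 * \<tau>" using Mge Ep tau_ge by linarith
  ultimately show ?thesis by (rule shell_orbit_covers)
qed

lemma not_basin_julia:
  assumes "x \<notin> basin"
  shows "x \<in> julia_set zero_map"
  unfolding julia_set_def
proof (intro CollectI allI impI)
  fix U assume U: "open U \<and> x \<in> U"
  show "capacity_zero (UNIV - forward_orbit zero_map U)"
    unfolding capacity_zero_def
  proof (intro allI impI)
    fix C assume "compact C \<and> C \<subseteq> UNIV - forward_orbit zero_map U"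
    then have "C \<subseteq> {0}" using expanding_orbit_covers[of U x] U assms by blast
    then show "compact_capacity_zero C" by (intro compact_capacity_zero_singleton) auto
  qed
qed

lemma continuous_on_funpow_zero_map: "continuous_on A (zero_map ^^ n)"
proof (induction n arbitrary: A)
  case (Suc n)
  have "continuous_on A (zero_map \<circ> (zero_map ^^ n))" by (intro continuous_on_compose Suc continuous_on_zero_map)
  then show ?case by simp
qed simp

text \<open>A small neighbourhood enters the half-space at a common time and from the next iterate
  on stays in the ball of radius \<open>\<tau>\<close>. The earlier iterates are finitely many
  images of a compact ball, so the whole orbit is bounded and omits a set of positive
  capacity.\<close>

lemma basin_not_julia:
  assumes "x \<in> basin"
  shows "x \<notin> julia_set zero_map"
proof
  assume J: "x \<in> julia_set zero_map"
  obtain N where N: "(zero_map ^^ N) x $ 3 < \<tau>" using assms by (auto simp: basin_def)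
  define U where "U = {y. (zero_map ^^ N) y $ 3 < \<tau>} \<inter> ball x 1"
  have "open U" unfolding U_def
    by (intro open_Int open_Collect_less continuous_intros continuous_on_funpow_zero_map) simp
  moreover have "x \<in> U" using N by (simp add: U_def)
  ultimately have cap: "capacity_zero (UNIV - forward_orbit zero_map U)" using J by (auto simp: julia_set_def)
  have later: "norm ((zero_map ^^ (N + Suc m)) y) < \<tau> \<and> (zero_map ^^ (N + Suc m)) y $ 3 < \<tau>" if "y \<in> U" for y m
  proof (induction m)
    case 0
    then show ?case using that zero_map_lower_half[of "(zero_map ^^ N) y"] by (simp add: U_def)
  next
    case (Suc m)
    then show ?case using zero_map_lower_half[of "(zero_map ^^ (N + Suc m)) y"] by simp
  qed
  have "forward_orbit zero_map U \<subseteq> (\<Union>k\<le>N. (zero_map ^^ k) ` cball x 1) \<union> ball 0 \<tau>"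
  proof
    fix z assume "z \<in> forward_orbit zero_map U"
    then obtain k y where ky: "y \<in> U" "z = (zero_map ^^ k) y" unfolding forward_orbit_def by blast
    show "z \<in> (\<Union>k\<le>N. (zero_map ^^ k) ` cball x 1) \<union> ball 0 \<tau>"
    proof (cases "k \<le> N")
      case True
      have "z \<in> (zero_map ^^ k) ` cball x 1" using ky by (auto simp: U_def)
      then show ?thesis using True by blast
    next
      case False
      then obtain m where "k = N + Suc m" using less_imp_Suc_add[of N k] by auto
      then show ?thesis using later[OF ky(1), of m] ky(2) by simp
    qed
  qed
  moreover have "bounded ((\<Union>k\<le>N. (zero_map ^^ k) ` cball x 1) \<union> ball 0 \<tau>)"
    by (auto intro!: compact_imp_bounded compact_continuous_image continuous_on_funpow_zero_map)
  ultimately have "bounded (forward_orbit zero_map U)" by (rule bounded_subset[rotated])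
  then show False using not_capacity_zero_Compl_bounded cap by blast
qed

lemma quasi_fatou_eq_basin: "quasi_fatou_set zero_map = basin"
  using not_basin_julia basin_not_julia by (auto simp: quasi_fatou_set_def)

lemma convex_lower_half: "convex {x::real^3. x $ 3 < c}"
  using convex_halfspace_lt[of "axis 3 1 :: real^3" c] by (simp add: inner_axis')

text \<open>
  By the Lipschitz and co-Lipschitz estimates a component \<open>W\<close> of the preimage that stays in the
  expanding region has an image that is open and closed in \<open>S\<close>, so \<open>W\<close> contains the only zero.
\<close>
lemma connected_zero_map_vimage:
  assumes S: "open S" "connected S" and H: "{x. x $ 3 < \<tau>} \<subseteq> S"
  shows "connected (zero_map -` S)"
proof -
  let ?H = "{x::real^3. x $ 3 < \<tau>}"
  have H0: "0 \<in> ?H" using tau_ge by simp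
  have HP: "?H \<subseteq> zero_map -` S" using H zero_map_lower_half(2) by blast
  have Hc: "connected ?H" by (intro convex_connected convex_lower_half)
  have cc: "connected_component (zero_map -` S) x 0" if x: "x \<in> zero_map -` S" for x
  proof (rule ccontr)
    assume not0: "\<not> connected_component (zero_map -` S) x 0"
    define W where "W = connected_component_set (zero_map -` S) x"
    have xW: "x \<in> W" using x by (simp add: W_def connected_component_refl)
    have WS: "W \<subseteq> zero_map -` S" unfolding W_def by (rule connected_component_subset)
    \<comment> \<open>The half-space is a connected part of the preimage and contains
      \<open>0\<close>, so a component without \<open>0\<close> avoids it.\<close>
    have WH: "w $ 3 \<ge> \<tau>" if "w \<in> W" for w
    proof (rule ccontr)
      assume "\<not> w $ 3 \<ge> \<tau>"
      then have "connected_component (zero_map -` S) w 0"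
        unfolding connected_component_def using Hc HP H0 by (intro exI[of _ ?H]) auto
      then show False using not0 that connected_component_trans unfolding W_def by fastforce
    qed
    \<comment> \<open>The constant is \<open>1561 = 1 + 30 * 52\<close>. The ball about
      \<open>w\<close> that reaches the lift of \<open>y\<close> has its image within
      \<open>30 * 52 * \<eta>\<close> of \<open>zero_map w\<close>, hence within
      \<open>\<epsilon>\<close> of \<open>y\<close>. It therefore lies in the preimage of
      \<open>S\<close>, and the lift belongs to the same component.\<close>
    have lift: "y \<in> zero_map ` W" if y: "ball y \<epsilon> \<subseteq> S" "0 < \<epsilon>" "\<epsilon> \<le> 1" and w: "w \<in> W" "norm (y - zero_map w) < \<epsilon> / 1561" for y w \<epsilon>
    proof -
      define E where "E = \<kappa> * exp (w $ 3)"
      define \<eta> where "\<eta> = norm (y - zero_map w)"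
      have E: "E \<ge> 2500" using kappa_exp_ge[OF WH[OF w(1)]] tau_ge by (simp add: E_def)
      have \<eta>: "0 \<le> \<eta>" "\<eta> < \<epsilon> / 1561" using w(2) by (auto simp: \<eta>_def)
      have "\<eta> \<le> E / 100" using \<eta> y E by linarith
      then obtain x' where x': "zero_map x' = y" "norm (w - x') \<le> 52 * \<eta> / E"
        using zero_map_colipschitz[of y w] unfolding \<eta>_def E_def by blast
      have le1: "52 * \<eta> / E \<le> 1" using \<eta> y E by (simp add: divide_le_eq)
      have "cball w (norm (w - x')) \<subseteq> zero_map -` S"
      proof
        fix z assume "z \<in> cball w (norm (w - x'))"
        then have z: "norm (w - z) \<le> 52 * \<eta> / E" using x'(2) by (simp add: dist_norm)
        then have "norm (zero_map w - zero_map z) \<le> 30 * E * norm (w - z)"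
          using le1 zero_map_lipschitz[of w z] by (simp add: E_def)
        also have "\<dots> \<le> 30 * E * (52 * \<eta> / E)" using z E by (intro mult_left_mono) auto
        also have "\<dots> = 1560 * \<eta>" using E by simp
        finally have "norm (y - zero_map z) \<le> 1561 * \<eta>"
          using norm_triangle_ineq[of "y - zero_map w" "zero_map w - zero_map z"] by (simp add: \<eta>_def)
        also have "\<dots> < \<epsilon>" using \<eta>(2) by simp
        finally show "z \<in> zero_map -` S" using y(1) by (auto simp: dist_norm)
      qed
      then have "connected_component (zero_map -` S) w x'"
        unfolding connected_component_def
        by (intro exI[of _ "cball w (norm (w - x'))"]) (auto simp: dist_norm)
      then have "x' \<in> W" using w(1) connected_component_trans unfolding W_def by fastforce
      then show ?thesis using x'(1) by blast
    qed
    have nb: "\<exists>\<epsilon>>0. \<epsilon> \<le> 1 \<and> ball y \<epsilon> \<subseteq> S" if y: "y \<in> S" for y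
    proof -
      obtain e where e: "e > 0" "ball y e \<subseteq> S" using openE[OF S(1) y] by blast
      have "ball y (min e 1) \<subseteq> ball y e" by (rule subset_ball) simp
      then show ?thesis using e by (intro exI[of _ "min e 1"]) auto
    qed
    have "open (zero_map ` W)"
      unfolding open_contains_ball
    proof
      fix y0 assume "y0 \<in> zero_map ` W"
      then obtain w where w: "w \<in> W" "y0 = zero_map w" by blast
      then obtain \<epsilon> where e: "\<epsilon> > 0" "\<epsilon> \<le> 1" "ball y0 \<epsilon> \<subseteq> S" using nb[of y0] WS by blast
      have "ball y0 (\<epsilon> / 3122) \<subseteq> zero_map ` W"
      proof
        fix y assume y: "y \<in> ball y0 (\<epsilon> / 3122)"
        have "ball y (\<epsilon> / 2) \<subseteq> ball y0 \<epsilon>"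
        proof
          fix z assume "z \<in> ball y (\<epsilon> / 2)"
          then show "z \<in> ball y0 \<epsilon>" using y e(1) dist_triangle[of y0 z y] by simp
        qed
        then show "y \<in> zero_map ` W"
          using y e w by (intro lift[of y "\<epsilon> / 2" w]) (auto simp: dist_norm norm_minus_commute)
      qed
      then show "\<exists>e>0. ball y0 e \<subseteq> zero_map ` W" using e(1) by (intro exI[of _ "\<epsilon> / 3122"]) auto
    qed
    moreover have "open (S - zero_map ` W)"
      unfolding open_contains_ball
    proof
      fix y assume y: "y \<in> S - zero_map ` W"
      then obtain \<epsilon> where e: "\<epsilon> > 0" "\<epsilon> \<le> 1" "ball y \<epsilon> \<subseteq> S" using nb[of y] by blast
      have "ball y (\<epsilon> / 1561) \<subseteq> S - zero_map ` W"
      proof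
        fix z assume z: "z \<in> ball y (\<epsilon> / 1561)"
        have "z \<notin> zero_map ` W"
        proof
          assume "z \<in> zero_map ` W"
          then obtain w where "w \<in> W" "z = zero_map w" by blast
          then have "y \<in> zero_map ` W" using z e by (intro lift[of y \<epsilon> w]) (auto simp: dist_norm)
          then show False using y by blast
        qed
        moreover have "z \<in> ball y \<epsilon>" using z e(1) by simp
        ultimately show "z \<in> S - zero_map ` W" using e(3) by blast
      qed
      then show "\<exists>e>0. ball y e \<subseteq> S - zero_map ` W" using e(1) by (intro exI[of _ "\<epsilon> / 1561"]) auto
    qed
    moreover have "zero_map ` W \<subseteq> S" using WS by blast
    ultimately have "S - zero_map ` W = {}"
      using connectedD[OF S(2), of "zero_map ` W" "S - zero_map ` W"] xW by blast
    moreover have "0 \<in> S" using H H0 by blast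
    ultimately have "0 \<in> zero_map ` W" by (metis DiffI empty_iff)
    then obtain w where w: "0 = zero_map w" "w \<in> W" by (rule imageE)
    then have "w = 0" using zero_map_eq_0_iff by metis
    then have "0 \<in> W" using w(2) by simp
    then show False using not0 by (simp add: W_def)
  qed
  show ?thesis
    unfolding connected_iff_connected_component
  proof (intro ballI)
    fix x y assume "x \<in> zero_map -` S" "y \<in> zero_map -` S"
    then show "connected_component (zero_map -` S) x y"
      by (intro connected_component_trans[OF cc connected_component_sym[OF cc]])
  qed
qed

text \<open>By induction every preimage of the half-space is connected; all of them contain the
  half-space, hence have \<open>0\<close> in common.\<close>

lemma connected_basin: "connected basin"
proof -
  let ?A = "\<lambda>n. {x. (zero_map ^^ n) x $ 3 < \<tau>}"
  have H: "?A 0 \<subseteq> ?A n" for n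
  proof (induction n)
    case (Suc n)
    show ?case
    proof
      fix x assume "x \<in> ?A 0"
      then have "zero_map x \<in> ?A 0" using zero_map_lower_half(2) by simp
      then have "zero_map x \<in> ?A n" using Suc by blast
      then show "x \<in> ?A (Suc n)" by (simp add: funpow_swap1)
    qed
  qed simp
  have op: "open (?A n)" for n
    by (intro open_Collect_less continuous_intros continuous_on_funpow_zero_map)
  have con: "connected (?A n)" for n
  proof (induction n)
    case 0
    then show ?case by (auto intro!: convex_connected convex_lower_half)
  next
    case (Suc n)
    have "?A (Suc n) = zero_map -` ?A n" by (auto simp: funpow_swap1)
    moreover have "connected (zero_map -` ?A n)"
      using H[of n] by (intro connected_zero_map_vimage op Suc) simp
    ultimately show ?case by simp
  qed
  have "0 \<in> ?A 0" using tau_ge by simp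
  then have "(0::real^3) \<in> (\<Inter>n. ?A n)" using H by blast
  then have "(\<Inter>n. ?A n) \<noteq> {}" by blast
  then show ?thesis unfolding basin_def by (intro connected_Union) (use con in auto)
qed

section \<open>The invariant axis, regularity and transcendental type\<close>

text \<open>The action on the symmetry axis from height \<open>- ln 2\<close> upwards, where the
  axis runs through the middle \<open>q = 0\<close> of the inserted piece.\<close>

definition axis_map :: "real \<Rightarrow> real" where "axis_map t = \<kappa> * (exp t - 1)"

lemma zero_map_axis: "- ln 2 \<le> t \<Longrightarrow> zero_map (t *\<^sub>R axis 3 1) = axis_map t *\<^sub>R axis 3 1"
  by (simp add: zero_map_def zmap_axis axis_map_def)

lemma axis_map_pos: "t > 0 \<Longrightarrow> axis_map t > 0"
  using kappa_pos by (simp add: axis_map_def)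

lemma axis_map_ge:
  assumes "t \<ge> 2 * \<tau>"
  shows "axis_map t \<ge> t"
proof -
  have "t / 2 \<le> t - \<tau>" using assms by simp
  also have "\<dots> \<le> exp (t - \<tau>) - 1" using exp_ge_add_one_self[of "t - \<tau>"] by linarith
  finally have 1: "t / 2 \<le> exp (t - \<tau>) - 1" .
  have "t \<le> 2 * (t / 2)" by simp
  also have "\<dots> \<le> \<tau> / 8 * (t / 2)" using assms tau_ge by (intro mult_right_mono) auto
  also have "\<dots> \<le> \<tau> / 8 * (exp (t - \<tau>) - 1)" using 1 tau_ge by (intro mult_left_mono) auto
  also have "\<dots> \<le> axis_map t"
    using exp_le_one_iff[of "- \<tau>"] tau_ge unfolding axis_map_def right_diff_distrib kappa_exp
    by (simp add: \<kappa>_def mult_left_le)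
  finally show ?thesis .
qed

definition axis_ray :: "(real^3) set" where
  "axis_ray = {(2 * \<tau>) *\<^sub>R axis 3 1 + t *\<^sub>R axis 3 1 | t. t > 0}"

lemma half_ray_axis_ray: "half_ray axis_ray"
  unfolding half_ray_def axis_ray_def by (intro exI[of _ "(2 * \<tau>) *\<^sub>R axis 3 1"] exI[of _ "axis 3 1"]) (simp add: axis_eq_0_iff)

lemma axis_ray_iff: "x \<in> axis_ray \<longleftrightarrow> (\<exists>t>2 * \<tau>. x = t *\<^sub>R axis 3 1)"
proof
  assume "x \<in> axis_ray"
  then obtain t where "t > 0" "x = (2 * \<tau> + t) *\<^sub>R axis 3 1" by (auto simp: axis_ray_def scaleR_add_left)
  then show "\<exists>t>2 * \<tau>. x = t *\<^sub>R axis 3 1" by (intro exI[of _ "2 * \<tau> + t"]) auto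
next
  assume "\<exists>t>2 * \<tau>. x = t *\<^sub>R axis 3 1"
  then obtain t where "t > 2 * \<tau>" "x = t *\<^sub>R axis 3 1" by blast
  then show "x \<in> axis_ray"
    unfolding axis_ray_def by (auto intro!: exI[of _ "t - 2 * \<tau>"] simp flip: scaleR_add_left)
qed

lemma ln2_pos: "- ln 2 \<le> t" if "t \<ge> (0::real)"
  using that ln_ge_zero[of 2] by linarith

lemma axis_ray_julia: "axis_ray \<subseteq> julia_set zero_map"
proof
  fix x assume x: "x \<in> axis_ray"
  have "(zero_map ^^ n) x \<in> axis_ray" for n
  proof (induction n)
    case (Suc n)
    then obtain t where t: "t > 2 * \<tau>" "(zero_map ^^ n) x = t *\<^sub>R axis 3 1" by (auto simp: axis_ray_iff)
    then have "zero_map ((zero_map ^^ n) x) = axis_map t *\<^sub>R axis 3 1" using tau_ge by (simp add: zero_map_axis ln2_pos)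
    moreover have "axis_map t > 2 * \<tau>" using axis_map_ge[of t] t(1) by linarith
    ultimately show ?case by (auto simp: axis_ray_iff)
  qed (simp add: x)
  moreover have "y $ 3 \<ge> \<tau>" if "y \<in> axis_ray" for y
    using that tau_ge by (auto simp: axis_ray_iff axis_def)
  ultimately have "x \<notin> basin" by (auto simp: basin_def not_less)
  then show "x \<in> julia_set zero_map" by (rule not_basin_julia)
qed

lemma zero_map_locally_lipschitz:
  assumes "compact K"
  shows "\<exists>L. L-lipschitz_on K zero_map"
proof -
  obtain L where "L-lipschitz_on K zmap" using zmap_lipschitz_on_compact[OF assms] by blast
  then have "(\<bar>\<kappa>\<bar> * L)-lipschitz_on K zero_map" unfolding zero_map_def[abs_def] by (rule lipschitz_on_cmult)
  then show ?thesis ..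
qed

lemma det_matrix_scaleR:
  fixes D :: "real^3 \<Rightarrow> real^3"
  shows "det (matrix (\<lambda>h. c *\<^sub>R D h)) = c ^ 3 * det (matrix D)"
  by (simp add: det_3 matrix_def power3_eq_cube algebra_simps)

lemma zero_map_has_derivative:
  assumes "x \<notin> kinks"
  shows "\<exists>D. (zero_map has_derivative D) (at x) \<and> det (matrix D) = (\<kappa> * exp (x $ 3)) ^ 3 \<and>
    (\<forall>h. norm (D h) \<le> 60 * (\<kappa> * exp (x $ 3)) * norm h)"
proof -
  obtain D where D: "(zmap has_derivative D) (at x)" "det (matrix D) = exp (x $ 3) ^ 3"
    using zmap_has_derivative[OF assms] by blast
  show ?thesis
  proof (intro exI[of _ "\<lambda>h. \<kappa> *\<^sub>R D h"] conjI allI)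
    show "(zero_map has_derivative (\<lambda>h. \<kappa> *\<^sub>R D h)) (at x)"
      unfolding zero_map_def[abs_def] by (intro has_derivative_scaleR_right D)
    show "det (matrix (\<lambda>h. \<kappa> *\<^sub>R D h)) = (\<kappa> * exp (x $ 3)) ^ 3"
      by (simp add: det_matrix_scaleR D(2) power_mult_distrib)
    show "norm (\<kappa> *\<^sub>R D h) \<le> 60 * (\<kappa> * exp (x $ 3)) * norm h" for h
      using mult_left_mono[OF zmap_derivative_bound[OF D(1), of h], of \<kappa>] kappa_pos by (simp add: mult_ac)
  qed
qed

text \<open>Norm bound and Jacobian involve the same scale \<open>\<kappa> * exp (x $ 3)\<close>,
  which leaves the dilatation bound \<open>60 ^ 3\<close>.\<close>

lemma quasiregular_zero_map:
  assumes "open G" "connected G" "G \<noteq> {}"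
  shows "quasiregular_on G zero_map"
proof -
  obtain D where D: "\<And>x. x \<notin> kinks \<Longrightarrow> (zero_map has_derivative D x) (at x)"
    "\<And>x. x \<notin> kinks \<Longrightarrow> det (matrix (D x)) = (\<kappa> * exp (x $ 3)) ^ 3"
    "\<And>x h. x \<notin> kinks \<Longrightarrow> norm (D x h) \<le> 60 * (\<kappa> * exp (x $ 3)) * norm h"
    using zero_map_has_derivative by metis
  show ?thesis
    by (rule quasiregular_on_lipschitzI[OF assms zero_map_locally_lipschitz negligible_kinks,
          where D = D and s = "\<lambda>x. 60 * (\<kappa> * exp (x $ 3))" and K = "60 ^ 3"])
      (use D in \<open>auto simp: power_mult_distrib\<close>)
qed

text \<open>Bounded values far out exclude the limit infinity; arbitrarily large values far out
  exclude a finite limit.\<close>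

lemma transcendental_typeI:
  assumes small: "\<And>b. \<exists>x y. norm x \<ge> b \<and> g x = Some y \<and> norm y \<le> 1"
    and large: "\<And>b r. \<exists>x y. norm x \<ge> b \<and> g x = Some y \<and> norm y \<ge> r"
  shows "transcendental_type g"
  unfolding transcendental_type_def
proof
  assume "\<exists>l. limitin extended_space g l at_infinity"
  then obtain l where l: "limitin extended_space g l at_infinity" by blast
  have ev: "\<exists>b. \<forall>x. norm x \<ge> b \<longrightarrow> g x \<in> V" if "openin extended_space V" "l \<in> V" for V
    using l that by (auto simp: limitin_def eventually_at_infinity)
  show False
  proof (cases l)
    case None
    have "openin extended_space (insert None (Some ` (UNIV - cball 0 1)))"
      unfolding openin_Alexandroff_compactification
      by (intro disjI2 exI[of _ "cball 0 1"]) auto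
    from ev[OF this] None obtain b where "\<And>x. norm x \<ge> b \<Longrightarrow> g x \<in> insert None (Some ` (UNIV - cball 0 1))" by auto
    then show False using small[of b] by fastforce
  next
    case (Some v)
    have "openin extended_space (Some ` ball v 1)" by simp
    from ev[OF this] Some obtain b where b: "\<And>x. norm x \<ge> b \<Longrightarrow> g x \<in> Some ` ball v 1" by auto
    obtain x y where xy: "norm x \<ge> b" "g x = Some y" "norm y \<ge> norm v + 2" using large[of b "norm v + 2"] by blast
    then have "dist v y < 1" using b[OF xy(1)] by auto
    then show False using xy(3) norm_triangle_sub[of y v] by (simp add: dist_norm norm_minus_commute)
  qed
qed

lemma norm_zero_map_neg_axis:
  assumes "t \<ge> 0"
  shows "norm (zero_map ((- t) *\<^sub>R axis 3 1)) \<le> exp (- t)"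
proof -
  have "norm (zero_map ((- t) *\<^sub>R axis 3 1)) \<le> 5 * \<kappa> * exp (- t)"
    using norm_zero_map[of "(- t) *\<^sub>R axis 3 1"] by (simp add: axis_def)
  also have "\<dots> \<le> 1 * exp (- t)" using kappa_le by (intro mult_right_mono) auto
  finally show ?thesis by simp
qed

lemma transcendental_zero_map: "transcendental_type (Some \<circ> zero_map)"
proof (rule transcendental_typeI)
  fix b :: real
  define t where "t = max b 0"
  have "exp (- t) \<le> 1" by (simp add: t_def)
  moreover have "t \<ge> 0" by (simp add: t_def)
  ultimately have "norm (zero_map ((- t) *\<^sub>R axis 3 1)) \<le> 1" using norm_zero_map_neg_axis[of t] by linarith
  then show "\<exists>x y. norm x \<ge> b \<and> (Some \<circ> zero_map) x = Some y \<and> norm y \<le> 1"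
    by (intro exI[of _ "(- t) *\<^sub>R axis 3 1"] exI[of _ "zero_map ((- t) *\<^sub>R axis 3 1)"]) (simp add: t_def)
next
  fix b r :: real
  define t where "t = max (2 * \<tau>) (max b r)"
  have t: "t \<ge> 2 * \<tau>" "t \<ge> b" "t \<ge> r" "t \<ge> 0" using tau_ge by (auto simp: t_def)
  have "zero_map (t *\<^sub>R axis 3 1) = axis_map t *\<^sub>R axis 3 1" using t by (intro zero_map_axis ln2_pos)
  moreover have "axis_map t \<ge> r" using axis_map_ge[OF t(1)] t by linarith
  ultimately show "\<exists>x y. norm x \<ge> b \<and> (Some \<circ> zero_map) x = Some y \<and> norm y \<ge> r"
    using t by (intro exI[of _ "t *\<^sub>R axis 3 1"] exI[of _ "axis_map t *\<^sub>R axis 3 1"]) simp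
qed

section \<open>The map with one pole\<close>

text \<open>A reflection that makes the inversion orientation preserving while fixing the third
  axis, on which the dynamics is studied.\<close>

definition flip1 :: "real^3 \<Rightarrow> real^3" where
  "flip1 y = vector [- y $ 1, y $ 2, y $ 3]"

definition inversion :: "real^3 \<Rightarrow> real^3" where
  "inversion y = (1 / (y \<bullet> y)) *\<^sub>R flip1 y"

definition moebius_inversion :: "(real^3) option \<Rightarrow> (real^3) option" where
  "moebius_inversion = sphere_reflection 0 1 \<circ> (plane_reflection (axis 1 1) 0 \<circ> id)"

lemma flip1_nth [simp]: "flip1 y $ 1 = - y $ 1" "flip1 y $ 2 = y $ 2" "flip1 y $ 3 = y $ 3"
  by (simp_all add: flip1_def)

lemma flip1_inner: "flip1 x \<bullet> flip1 y = x \<bullet> y"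
  by (simp add: inner_vec_def sum_3)

lemma flip1_flip1 [simp]: "flip1 (flip1 y) = y"
  by (rule vec3_eqI) simp_all

lemma flip1_scaleR: "flip1 (c *\<^sub>R y) = c *\<^sub>R flip1 y"
  by (rule vec3_eqI) simp_all

lemma flip1_add: "flip1 (x + y) = flip1 x + flip1 y"
  by (rule vec3_eqI) simp_all

lemma norm_flip1 [simp]: "norm (flip1 y) = norm y"
  by (simp add: norm_eq_sqrt_inner flip1_inner)

lemma flip1_eq_0_iff [simp]: "flip1 y = 0 \<longleftrightarrow> y = 0"
  using norm_flip1[of y] norm_eq_zero by metis

lemma linear_flip1: "linear flip1"
  by (rule linearI) (simp_all add: flip1_add flip1_scaleR)

lemma moebius_inversion_None: "moebius_inversion None = Some 0"
  by (simp add: moebius_inversion_def)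

lemma moebius_inversion_Some:
  "moebius_inversion (Some y) = (if y = 0 then None else Some (inversion y))"
proof -
  have "y - (2 * (axis 1 1 \<bullet> y - 0) / (axis 1 1 \<bullet> (axis 1 1 :: real^3))) *\<^sub>R axis 1 1 = flip1 y"
    unfolding inner_axis' by (rule vec3_eqI) (simp_all add: axis_def)
  then have "plane_reflection (axis 1 1) 0 (Some y) = Some (flip1 y)" by simp
  then show ?thesis
    by (simp add: moebius_inversion_def inversion_def power_divide dot_square_norm)
qed

lemma moebius_moebius_inversion: "moebius moebius_inversion"
  unfolding moebius_inversion_def
  by (intro moebius.sphere moebius.plane moebius.id) (simp_all add: axis_eq_0_iff)

lemma norm_inversion: "norm (inversion y) = 1 / norm y"
  by (simp add: inversion_def dot_square_norm power2_eq_square)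

lemma inversion_inversion: "y \<noteq> 0 \<Longrightarrow> inversion (inversion y) = y"
  by (simp add: inversion_def flip1_scaleR flip1_inner)

lemma inversion_eq_0_iff: "inversion y = 0 \<longleftrightarrow> y = 0"
  by (simp add: inversion_def)

lemma continuous_on_flip1: "continuous_on A flip1"
  using linear_continuous_on linear_flip1 linear_conv_bounded_linear by blast

lemma continuous_on_inversion: "0 \<notin> A \<Longrightarrow> continuous_on A inversion"
  unfolding inversion_def[abs_def] by (intro continuous_intros continuous_on_flip1) auto

definition inversion_deriv :: "real^3 \<Rightarrow> real^3 \<Rightarrow> real^3" where
  "inversion_deriv y h = (1 / (y \<bullet> y)) *\<^sub>R flip1 (h - (2 * (y \<bullet> h) / (y \<bullet> y)) *\<^sub>R y)"

lemma inversion_has_derivative: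
  assumes "y \<noteq> 0"
  shows "(inversion has_derivative inversion_deriv y) (at y)"
proof -
  have N: "y \<bullet> y \<noteq> 0" using assms by simp
  have 1: "((\<lambda>y. y \<bullet> y) has_derivative (\<lambda>h. 2 * (y \<bullet> h))) (at y)"
    by (auto intro!: derivative_eq_intros simp: inner_commute)
  have 2: "((\<lambda>y. inverse (y \<bullet> y)) has_derivative (\<lambda>h. 2 * (y \<bullet> h) * - (inverse (y \<bullet> y) ^ Suc (Suc 0)))) (at y)"
    by (rule DERIV_compose_FDERIV[OF DERIV_inverse[OF N] 1])
  have 3: "(flip1 has_derivative flip1) (at y)"
    using linear_flip1 by (simp add: bounded_linear_imp_has_derivative linear_conv_bounded_linear)
  have "((\<lambda>y. inverse (y \<bullet> y) *\<^sub>R flip1 y) has_derivative inversion_deriv y) (at y)"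
    by (rule has_derivative_eq_rhs[OF has_derivative_scaleR[OF 2 3]])
      (simp add: fun_eq_iff inversion_deriv_def linear_diff[OF linear_flip1] flip1_scaleR divide_inverse algebra_simps)
  then show ?thesis by (simp add: inversion_def[abs_def] divide_inverse)
qed

text \<open>The vector to which \<open>flip1\<close> is applied is the reflection of
  \<open>h\<close> in the hyperplane orthogonal to \<open>y\<close>, so the derivative is a
  similarity.\<close>

lemma norm_inversion_deriv:
  assumes "y \<noteq> 0"
  shows "norm (inversion_deriv y h) = norm h / (y \<bullet> y)"
proof -
  have N: "y \<bullet> y > 0" using assms by simp
  have "(norm (h - (2 * (y \<bullet> h) / (y \<bullet> y)) *\<^sub>R y))\<^sup>2 = (norm h)\<^sup>2"
    using N unfolding power2_norm_eq_inner
    by (simp add: inner_diff_left inner_diff_right inner_commute[of h y] field_simps)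
  then have "norm (h - (2 * (y \<bullet> h) / (y \<bullet> y)) *\<^sub>R y) = norm h" by simp
  then show ?thesis using N by (simp add: inversion_deriv_def)
qed

lemma det_inversion_deriv:
  assumes "y \<noteq> 0"
  shows "det (matrix (inversion_deriv y)) = 1 / (y \<bullet> y) ^ 3"
proof -
  define n where "n = 1 / (y \<bullet> y)"
  have "n * (y \<bullet> y) = 1" using assms by (simp add: n_def)
  then have n: "n * (y $ 1 * y $ 1 + y $ 2 * y $ 2 + y $ 3 * y $ 3) = 1" by (simp add: inner_vec_def sum_3)
  have idr: "inversion_deriv y h = n *\<^sub>R flip1 (h - (2 * (y \<bullet> h) * n) *\<^sub>R y)" for h
    by (simp add: inversion_deriv_def n_def)
  have ax: "(axis 1 1 :: real^3) $ 1 = 1" "(axis 1 1 :: real^3) $ 2 = 0" "(axis 1 1 :: real^3) $ 3 = 0"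
    "(axis 2 1 :: real^3) $ 1 = 0" "(axis 2 1 :: real^3) $ 2 = 1" "(axis 2 1 :: real^3) $ 3 = 0"
    "(axis 3 1 :: real^3) $ 1 = 0" "(axis 3 1 :: real^3) $ 2 = 0" "(axis 3 1 :: real^3) $ 3 = 1"
    by (simp_all add: axis_def)
  have "det (matrix (inversion_deriv y)) = n ^ 3"
    by (simp add: det_3 matrix_def inner_axis ax idr) (use n in algebra)
  then show ?thesis by (simp add: n_def power_divide)
qed

lemma sense_preserving_moebius_inversion: "sense_preserving_moebius moebius_inversion"
  unfolding sense_preserving_moebius_def
proof (intro conjI allI impI moebius_moebius_inversion)
  fix x :: "real^3" assume "moebius_inversion (Some x) \<noteq> None"
  then have x: "x \<noteq> 0" by (auto simp: moebius_inversion_Some)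
  have "((\<lambda>z. the (moebius_inversion (Some z))) has_derivative inversion_deriv x) (at x)"
    by (rule has_derivative_transform_within_open[OF inversion_has_derivative[OF x], of "- {0}"])
      (use x in \<open>auto simp: moebius_inversion_Some\<close>)
  then have "jacobian (\<lambda>z. the (moebius_inversion (Some z))) (at x) = matrix (inversion_deriv x)"
    unfolding jacobian_def by (simp add: frechet_derivative_at[symmetric])
  then show "0 < det (jacobian (\<lambda>z. the (moebius_inversion (Some z))) (at x))"
    using x by (simp add: det_inversion_deriv)
qed

definition pole_map :: "real^3 \<Rightarrow> (real^3) option" where
  "pole_map x = moebius_inversion (Some (zero_map x))"

lemma pole_map_0: "pole_map 0 = None"
  using zero_map_eq_0_iff[of 0] by (simp add: pole_map_def moebius_inversion_Some)

lemma pole_map_nonzero: "x \<noteq> 0 \<Longrightarrow> pole_map x = Some (inversion (zero_map x))"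
  using zero_map_eq_0_iff[of x] by (simp add: pole_map_def moebius_inversion_Some)

lemma moebius_inversion_pole_map: "moebius_inversion (pole_map x) = Some (zero_map x)"
  by (cases "x = 0")
    (simp_all add: pole_map_0 pole_map_nonzero moebius_inversion_None moebius_inversion_Some zero_map_eq_0_iff inversion_eq_0_iff inversion_inversion)

lemma det_matrix_compose:
  assumes "linear A" "linear B"
  shows "det (matrix (\<lambda>h. A (B h))) = det (matrix A) * det (matrix (B :: real^'n::finite \<Rightarrow> real^'n))"
  using matrix_compose[OF assms(2,1)] by (simp add: o_def det_mul)

text \<open>Inversion is conformal: the norm bound is divided by
  \<open>zero_map x \<bullet> zero_map x\<close> and the Jacobian by its cube, so the dilatation
  bound \<open>60 ^ 3\<close> persists.\<close>

lemma quasiregular_inversion_zero_map: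
  assumes G: "open G" "connected G" "G \<noteq> {}" "0 \<notin> G"
    and F: "\<And>x. x \<in> G \<Longrightarrow> F x = inversion (zero_map x)"
  shows "quasiregular_on G F"
proof -
  have nz: "zero_map x \<noteq> 0" if "x \<in> G" for x using G(4) that zero_map_eq_0_iff by metis
  obtain D where D: "\<And>x. x \<notin> kinks \<Longrightarrow> (zero_map has_derivative D x) (at x)"
    "\<And>x. x \<notin> kinks \<Longrightarrow> det (matrix (D x)) = (\<kappa> * exp (x $ 3)) ^ 3"
    "\<And>x h. x \<notin> kinks \<Longrightarrow> norm (D x h) \<le> 60 * (\<kappa> * exp (x $ 3)) * norm h"
    using zero_map_has_derivative by metis
  define Dg where "Dg x h = inversion_deriv (zero_map x) (D x h)" for x h
  define s where "s x = 60 * (\<kappa> * exp (x $ 3)) / (zero_map x \<bullet> zero_map x)" for x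
  show ?thesis
  proof (rule quasiregular_on_lipschitzI[OF G(1-3) _ negligible_kinks, where D = Dg and s = s and K = "60 ^ 3"])
    fix K assume K: "compact K" "K \<subseteq> G"
    obtain L where L: "L-lipschitz_on K zero_map" using zero_map_locally_lipschitz[OF K(1)] by blast
    have "compact (zero_map ` K)" using K by (intro compact_continuous_image continuous_on_zero_map)
    have "0 \<notin> zero_map ` K" using K nz by force
    then obtain m where m: "m > 0" "ball 0 m \<subseteq> - zero_map ` K"
      using openE[of "- zero_map ` K" 0] compact_imp_closed[OF \<open>compact (zero_map ` K)\<close>] by auto
    then have fm: "norm (zero_map x) \<ge> m" if "x \<in> K" for x using that by (force simp: not_less)
    \<comment> \<open>An exact identity for distances under inversion. As \<open>zero_map\<close> is
      bounded away from \<open>0\<close> on \<open>K\<close>, it gives the Lipschitz bound for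
      \<open>F\<close>.\<close>
    have inv_diff: "norm (inversion u - inversion v) = norm (u - v) / (norm u * norm v)" if "u \<noteq> 0" "v \<noteq> 0" for u v
    proof -
      have "(norm (inversion u - inversion v))\<^sup>2 = (norm (u - v) / (norm u * norm v))\<^sup>2"
        using that unfolding power_divide power_mult_distrib power2_norm_eq_inner
        by (simp add: inversion_def inner_diff_left inner_diff_right flip1_inner inner_commute[of v u] field_simps)
      then show ?thesis by (simp add: power2_eq_iff_nonneg)
    qed
    have "(L / (m * m))-lipschitz_on K F"
    proof (rule lipschitz_onI)
      fix x y assume xy: "x \<in> K" "y \<in> K"
      have ne: "zero_map x \<noteq> 0" "zero_map y \<noteq> 0" using xy K nz by blast+
      have "dist (zero_map x) (zero_map y) \<le> L * dist x y" using L xy by (rule lipschitz_onD)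
      then have d: "norm (zero_map x - zero_map y) \<le> L * dist x y" by (simp add: dist_norm)
      have "m * m \<le> norm (zero_map x) * norm (zero_map y)" using fm[OF xy(1)] fm[OF xy(2)] m(1) by (intro mult_mono) auto
      then have "norm (zero_map x - zero_map y) / (norm (zero_map x) * norm (zero_map y)) \<le> (L * dist x y) / (m * m)"
        using d m(1) order_trans[OF norm_ge_zero d] by (intro frac_le) auto
      moreover have "F x = inversion (zero_map x)" "F y = inversion (zero_map y)" using xy K F by blast+
      ultimately show "dist (F x) (F y) \<le> L / (m * m) * dist x y"
        by (simp add: dist_norm inv_diff[OF ne])
    qed (use m(1) lipschitz_on_nonneg[OF L] in simp)
    then show "\<exists>L. L-lipschitz_on K F" ..
  next
    fix x assume x: "x \<in> G - kinks"
    then have ne: "zero_map x \<noteq> 0" using nz by blast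
    have N: "zero_map x \<bullet> zero_map x > 0" using ne by simp
    have "((\<lambda>x. inversion (zero_map x)) has_derivative Dg x) (at x)"
      unfolding Dg_def
      by (rule has_derivative_compose[of zero_map, OF _ inversion_has_derivative[OF ne]]) (use x D(1) in auto)
    then show "(F has_derivative Dg x) (at x)"
      by (rule has_derivative_transform_within_open[OF _ G(1)]) (use x F in auto)
    show "norm (Dg x h) \<le> s x * norm h" for h
      unfolding Dg_def s_def norm_inversion_deriv[OF ne] using D(3)[of x h] x N
      by (simp add: divide_right_mono)
    have lin: "linear (inversion_deriv (zero_map x))" "linear (D x)"
      using has_derivative_linear inversion_has_derivative[OF ne] D(1) x by blast+
    have "det (matrix (Dg x)) = (\<kappa> * exp (x $ 3)) ^ 3 / (zero_map x \<bullet> zero_map x) ^ 3"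
      unfolding Dg_def using x by (simp add: det_matrix_compose[OF lin] det_inversion_deriv[OF ne] D(2))
    then show "s x ^ CARD(3) \<le> 60 ^ 3 * det (matrix (Dg x))"
      by (simp add: s_def power_divide power_mult_distrib)
  qed simp
qed

lemma continuous_map_pole_map: "continuous_map (top_of_set UNIV) extended_space pole_map"
  unfolding continuous_map_def
proof (intro conjI allI impI)
  show "pole_map \<in> topspace (top_of_set UNIV) \<rightarrow> topspace extended_space"
    by (auto simp: not_None_eq image_iff) 
  have cont: "continuous_on (- {0}) (\<lambda>x. inversion (zero_map x))"
    by (rule continuous_on_compose2[OF continuous_on_inversion[of "- {0}"] continuous_on_zero_map])
      (auto simp: zero_map_eq_0_iff)
  have op: "open {x. x \<noteq> 0 \<and> inversion (zero_map x) \<in> S}" if "open S" for S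
  proof -
    have "open (- {0} \<inter> (\<lambda>x. inversion (zero_map x)) -` S)"
      using cont that by (intro continuous_open_preimage) auto
    moreover have "- {0} \<inter> (\<lambda>x. inversion (zero_map x)) -` S = {x. x \<noteq> 0 \<and> inversion (zero_map x) \<in> S}" by auto
    ultimately show ?thesis by simp
  qed
  fix V :: "(real^3) option set" assume "openin extended_space V"
  then consider S where "open S" "V = Some ` S" | C where "compact C" "V = insert None (Some ` (- C))"
    unfolding openin_Alexandroff_compactification by (auto simp: Compl_eq_Diff_UNIV)
  then have "open {x. pole_map x \<in> V}"
  proof cases
    case 1
    have "{x. pole_map x \<in> V} = {x. x \<noteq> 0 \<and> inversion (zero_map x) \<in> S}"
    proof (rule set_eqI)
      show "x \<in> {x. pole_map x \<in> V} \<longleftrightarrow> x \<in> {x. x \<noteq> 0 \<and> inversion (zero_map x) \<in> S}" for x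
        using 1 by (cases "x = 0") (auto simp: pole_map_0 pole_map_nonzero)
    qed
    then show ?thesis using op[OF 1(1)] by simp
  next
    case 2
    obtain B where B: "\<And>y. y \<in> C \<Longrightarrow> norm y \<le> B" "B > 0"
      using compact_imp_bounded[OF 2(1)] by (auto simp: bounded_pos)
    \<comment> \<open>On \<open>W\<close> the image under inversion has norm above \<open>B\<close>,
      hence lies outside \<open>C\<close>; this supplies the neighbourhood of the pole.\<close>
    define W where "W = {x. norm (zero_map x) < 1 / B}"
    have "open W" unfolding W_def by (intro open_Collect_less continuous_intros continuous_on_zero_map)
    have "{x. pole_map x \<in> V} = {x. x \<noteq> 0 \<and> inversion (zero_map x) \<in> - C} \<union> W"
    proof (rule set_eqI)
      fix x
      show "x \<in> {x. pole_map x \<in> V} \<longleftrightarrow> x \<in> {x. x \<noteq> 0 \<and> inversion (zero_map x) \<in> - C} \<union> W"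
      proof (cases "x = 0")
        case True
        then show ?thesis using 2 B(2) zero_map_eq_0_iff[of 0] by (simp add: pole_map_0 W_def)
      next
        case False
        have "inversion (zero_map x) \<notin> C" if "x \<in> W"
        proof
          assume "inversion (zero_map x) \<in> C"
          then have "1 / norm (zero_map x) \<le> B" using B(1) norm_inversion by metis
          moreover have "norm (zero_map x) > 0" using False zero_map_eq_0_iff by simp
          ultimately show False using that B(2) by (simp add: W_def field_simps)
        qed
        then show ?thesis using False 2 by (auto simp: pole_map_nonzero)
      qed
    qed
    then show ?thesis using op[OF open_Compl[OF compact_imp_closed[OF 2(1)]]] \<open>open W\<close> by (simp add: open_Un)
  qed
  then show "openin (top_of_set UNIV) {x \<in> topspace (top_of_set UNIV). pole_map x \<in> V}" by simp
qed

lemma quasimeromorphic_pole_map: "quasimeromorphic_on UNIV pole_map"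
  unfolding quasimeromorphic_on_def
proof (intro conjI ballI continuous_map_pole_map)
  fix x :: "real^3"
  show "\<exists>U. open U \<and> x \<in> U \<and> U \<subseteq> UNIV \<and> (finite_quasiregular_on U pole_map \<or>
      (\<exists>M. sense_preserving_moebius M \<and> M None \<noteq> None \<and> finite_quasiregular_on U (M \<circ> pole_map)))"
  proof (cases "x = 0")
    case True
    \<comment> \<open>The inversion is an involution, so composing with it once more returns
      \<open>zero_map\<close>.\<close>
    have "finite_quasiregular_on UNIV (moebius_inversion \<circ> pole_map)"
      unfolding finite_quasiregular_on_def using quasiregular_zero_map[OF open_UNIV connected_UNIV] by (simp add: moebius_inversion_pole_map)
    then show ?thesis
      using sense_preserving_moebius_inversion moebius_inversion_None
      by (intro exI[of _ UNIV] conjI disjI2 exI[of _ moebius_inversion]) auto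
  next
    case False
    define U where "U = ball x (norm x)"
    have U: "open U" "connected U" "x \<in> U" "0 \<notin> U" using False by (auto simp: U_def)
    have nz: "pole_map y = Some (inversion (zero_map y))" if "y \<in> U" for y
      using that U(4) by (intro pole_map_nonzero) auto
    then have "quasiregular_on U (\<lambda>y. the (pole_map y))"
      using U by (intro quasiregular_inversion_zero_map) auto
    then have "finite_quasiregular_on U pole_map" using nz by (simp add: finite_quasiregular_on_def)
    then show ?thesis using U by blast
  qed
qed auto

lemma transcendental_pole_map: "transcendental_type pole_map"
proof (rule transcendental_typeI)
  fix b :: real
  define t where "t = max (2 * \<tau>) b"
  have t: "t \<ge> 2 * \<tau>" "t \<ge> b" "t \<ge> 1" using tau_ge by (auto simp: t_def)
  have "zero_map (t *\<^sub>R axis 3 1) = axis_map t *\<^sub>R axis 3 1" using t by (intro zero_map_axis ln2_pos) auto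
  then have "norm (zero_map (t *\<^sub>R axis 3 1)) \<ge> 1" using axis_map_ge[OF t(1)] t by simp
  then have "norm (inversion (zero_map (t *\<^sub>R axis 3 1))) \<le> 1" by (simp add: norm_inversion divide_le_eq)
  then show "\<exists>x y. norm x \<ge> b \<and> pole_map x = Some y \<and> norm y \<le> 1"
    using t by (intro exI[of _ "t *\<^sub>R axis 3 1"] exI[of _ "inversion (zero_map (t *\<^sub>R axis 3 1))"])
      (simp add: pole_map_nonzero axis_eq_0_iff)
next
  fix b r :: real
  define t where "t = max 1 (max b r)"
  have t: "t \<ge> 1" "t \<ge> b" "t \<ge> r" by (auto simp: t_def)
  let ?x = "(- t) *\<^sub>R axis 3 1 :: real^3"
  have ne: "?x \<noteq> 0" using t by (simp add: axis_eq_0_iff)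
  then have pos: "norm (zero_map ?x) > 0" by (simp add: zero_map_eq_0_iff)
  have "t \<le> exp t" using exp_ge_add_one_self[of t] by linarith
  also have "\<dots> = 1 / exp (- t)" by (simp add: exp_minus field_simps)
  also have "\<dots> \<le> 1 / norm (zero_map ?x)" using norm_zero_map_neg_axis[of t] t pos by (intro divide_left_mono) auto
  finally have "norm (inversion (zero_map ?x)) \<ge> t" by (simp only: norm_inversion)
  moreover have "norm ?x \<ge> b" using t by simp
  ultimately show "\<exists>x y. norm x \<ge> b \<and> pole_map x = Some y \<and> norm y \<ge> r"
    using t pole_map_nonzero[OF ne] by (meson order_trans)
qed

text \<open>The only pole is \<open>0\<close>, and \<open>0\<close> is omitted because
  \<open>zero_map\<close> never takes the value infinity; the tree of preimages ends after one
  step.\<close>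

lemma backward_orbit_pole_map: "backward_orbit_of_infinity pole_map = {Some 0, None}"
proof -
  have N: "pole_map x = None \<longleftrightarrow> x = 0" for x by (cases "x = 0") (simp_all add: pole_map_0 pole_map_nonzero)
  have Z: "pole_map x \<noteq> Some 0" for x
    by (cases "x = 0") (simp_all add: pole_map_0 pole_map_nonzero inversion_eq_0_iff zero_map_eq_0_iff)
  have 1: "preimage_of_infinity pole_map (Suc 0) = {Some 0}" by (auto simp: N)
  have "preimage_of_infinity pole_map (Suc (Suc n)) = {}" for n
  proof (induction n)
    case 0
    then show ?case using Z unfolding preimage_of_infinity.simps(2)[of _ "Suc 0"] 1 by auto
  next
    case (Suc n)
    then show ?case unfolding preimage_of_infinity.simps(2)[of _ "Suc (Suc n)"] by auto
  qed
  then have "preimage_of_infinity pole_map n \<subseteq> {Some 0, None}" for n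
    using 1 by (cases n; cases "n - 1") auto
  moreover have "None \<in> preimage_of_infinity pole_map 0" "Some 0 \<in> preimage_of_infinity pole_map (Suc 0)" using 1 by auto
  ultimately show ?thesis unfolding backward_orbit_of_infinity_def by blast
qed

lemma pole_map_axis:
  assumes "t > 0"
  shows "pole_map (t *\<^sub>R axis 3 1) = Some ((1 / axis_map t) *\<^sub>R axis 3 1)"
proof -
  have f: "zero_map (t *\<^sub>R axis 3 1) = axis_map t *\<^sub>R axis 3 1" using assms by (intro zero_map_axis ln2_pos) simp
  have fl: "flip1 (axis 3 1) = axis 3 1" by (rule vec3_eqI) (simp_all add: axis_def)
  have "inversion (axis_map t *\<^sub>R axis 3 1) = (1 / axis_map t) *\<^sub>R axis 3 1"
    using axis_map_pos[OF assms] by (simp add: inversion_def flip1_scaleR fl inner_axis_axis)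
  then show ?thesis using assms by (simp add: pole_map_nonzero axis_eq_0_iff f)
qed

text \<open>Since \<open>axis_map\<close> is asymptotically linear at \<open>0\<close>, two steps of \<open>t \<mapsto> 1 / axis_map t\<close> act on large \<open>t\<close> like a
  multiple of \<open>axis_map\<close>.\<close>
lemma axis_map_two_steps:
  assumes "t \<ge> 2 * \<tau>"
  shows "1 / axis_map (1 / axis_map t) \<ge> t + 1" "1 / axis_map t \<le> 1"
proof -
  have t: "t \<ge> 40000" using assms tau_ge by linarith
  have p: "axis_map t \<ge> t" by (rule axis_map_ge[OF assms])
  define s where "s = 1 / axis_map t"
  have s: "0 < s" "s \<le> 1" using p t by (auto simp: s_def divide_le_eq)
  then show "1 / axis_map t \<le> 1" by (simp add: s_def)
  have "exp s - 1 \<le> 2 * s" using abs_exp_minus_1[of s] s by simp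
  then have "axis_map s \<le> \<kappa> * (2 * s)" unfolding axis_map_def using kappa_pos by (intro mult_left_mono) auto
  then have "1 / (\<kappa> * (2 * s)) \<le> 1 / axis_map s" using axis_map_pos[OF s(1)] by (intro divide_left_mono mult_pos_pos) (use s kappa_pos in auto)
  \<comment> \<open>The constant \<open>\<kappa>\<close> cancels: \<open>axis_map s\<close> is about
    \<open>\<kappa> * s\<close>, with \<open>s\<close> the reciprocal of
    \<open>\<kappa> * (exp t - 1)\<close>. The factor \<open>2\<close> comes from the bound
    \<open>exp s - 1 \<le> 2 * s\<close>.\<close>
  moreover have "1 / (\<kappa> * (2 * s)) = (exp t - 1) / 2"
    using kappa_pos p t by (simp add: s_def) (simp add: axis_map_def)
  moreover have "t + 1 \<le> (exp t - 1) / 2"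
  proof -
    have "1 + t + t\<^sup>2 / 2 \<le> exp t" using t by (intro exp_lower_Taylor_quadratic) auto
    moreover have "4 * t \<le> t\<^sup>2" using t by (simp add: power2_eq_square mult_right_mono)
    ultimately show ?thesis using t by argo
  qed
  ultimately show "1 / axis_map (1 / axis_map t) \<ge> t + 1" by (simp add: s_def)
qed

text \<open>Along the axis the even iterates grow by at least one in every two steps, and the odd
  iterates have norm at most one. The former exclude boundedness, the latter a limit at
  infinity.\<close>

lemma oscillation_on_ray:
  assumes "x \<in> axis_ray"
  shows "\<exists>y. y 0 = x \<and> finite_orbit pole_map y \<and> \<not> bounded (range y) \<and> \<not> filterlim y at_infinity sequentially"
proof -
  obtain t where t: "t > 2 * \<tau>" "x = t *\<^sub>R axis 3 1" using assms by (auto simp: axis_ray_iff)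
  define u where "u n = ((\<lambda>t. 1 / axis_map t) ^^ n) t" for n
  define y where "y n = u n *\<^sub>R (axis 3 1 :: real^3)" for n
  have u_Suc: "u (Suc n) = 1 / axis_map (u n)" for n by (simp add: u_def)
  have u_pos: "u n > 0" for n
  proof (induction n)
    case 0
    then show ?case using t tau_ge by (simp add: u_def)
  next
    case (Suc n)
    then show ?case by (simp add: u_Suc axis_map_pos)
  qed
  have even: "u (2 * k) \<ge> 2 * \<tau> + real k" for k
  proof (induction k)
    case 0
    then show ?case using t by (simp add: u_def)
  next
    case (Suc k)
    then have "1 / axis_map (1 / axis_map (u (2 * k))) \<ge> u (2 * k) + 1" by (intro axis_map_two_steps) simp
    then show ?case using Suc by (simp add: u_Suc)
  qed
  have odd: "u (Suc (2 * k)) \<le> 1" for k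
    using axis_map_two_steps(2)[of "u (2 * k)"] even[of k] by (simp add: u_Suc)
  have ny: "norm (y n) = u n" for n using u_pos[of n] by (simp add: y_def)
  have "y 0 = x" by (simp add: y_def u_def t)
  moreover have "finite_orbit pole_map y"
    unfolding finite_orbit_def y_def using pole_map_axis[OF u_pos] by (simp add: u_Suc)
  moreover have "\<not> bounded (range y)"
  proof
    assume "bounded (range y)"
    then obtain B where B: "\<And>n. norm (y n) \<le> B" by (auto simp: bounded_iff)
    obtain k :: nat where "real k > B" using reals_Archimedean2 by blast
    then show False using B[of "2 * k"] even[of k] tau_ge by (simp add: ny)
  qed
  moreover have "\<not> filterlim y at_infinity sequentially"
  proof
    assume "filterlim y at_infinity sequentially"
    then have "\<forall>\<^sub>F n in sequentially. 2 \<le> norm (y n)" by (simp add: filterlim_at_infinity[of 0])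
    then obtain N where "\<And>n. n \<ge> N \<Longrightarrow> 2 \<le> norm (y n)" by (auto simp: eventually_sequentially)
    from this[of "Suc (2 * N)"] show False using odd[of N] by (simp add: ny)
  qed
  ultimately show ?thesis by blast
qed

theorem theorem1p3:
  shows "(\<exists>\<F> :: (real^3 \<Rightarrow> real^3) set. \<F> \<noteq> {} \<and>
            (\<forall>f\<in>\<F>. quasiregular_on UNIV f \<and> transcendental_type (Some \<circ> f) \<and>
               (\<forall>x. f x = 0 \<longleftrightarrow> x = 0) \<and>
               (\<exists>R. half_ray R \<and> R \<subseteq> julia_set f) \<and>
               connected (quasi_fatou_set f))) \<and>
         (\<exists>\<G> :: (real^3 \<Rightarrow> (real^3) option) set. \<G> \<noteq> {} \<and>
            (\<forall>g\<in>\<G>. quasimeromorphic_on UNIV g \<and> transcendental_type g \<and>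
               backward_orbit_of_infinity g = {Some 0, None} \<and>
               (\<exists>R. half_ray R \<and>
                  (\<forall>x\<in>R. \<exists>y. y 0 = x \<and> finite_orbit g y \<and>
                     \<not> bounded (range y) \<and> \<not> filterlim y at_infinity sequentially))))"
proof (intro conjI)
  have "quasiregular_on UNIV zero_map" by (intro quasiregular_zero_map) auto
  moreover have "connected (quasi_fatou_set zero_map)" by (simp add: quasi_fatou_eq_basin connected_basin)
  ultimately show "\<exists>\<F> :: (real^3 \<Rightarrow> real^3) set. \<F> \<noteq> {} \<and>
            (\<forall>f\<in>\<F>. quasiregular_on UNIV f \<and> transcendental_type (Some \<circ> f) \<and>
               (\<forall>x. f x = 0 \<longleftrightarrow> x = 0) \<and>
               (\<exists>R. half_ray R \<and> R \<subseteq> julia_set f) \<and>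
               connected (quasi_fatou_set f))"
    using transcendental_zero_map zero_map_eq_0_iff half_ray_axis_ray axis_ray_julia by (intro exI[of _ "{zero_map}"]) blast
  show "\<exists>\<G> :: (real^3 \<Rightarrow> (real^3) option) set. \<G> \<noteq> {} \<and>
            (\<forall>g\<in>\<G>. quasimeromorphic_on UNIV g \<and> transcendental_type g \<and>
               backward_orbit_of_infinity g = {Some 0, None} \<and>
               (\<exists>R. half_ray R \<and>
                  (\<forall>x\<in>R. \<exists>y. y 0 = x \<and> finite_orbit g y \<and>
                     \<not> bounded (range y) \<and> \<not> filterlim y at_infinity sequentially)))"
    using quasimeromorphic_pole_map transcendental_pole_map backward_orbit_pole_map half_ray_axis_ray oscillation_on_ray
    by (intro exI[of _ "{pole_map}"]) blast
qed

end
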